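(* Let $n\ge3$ be an integer and let $\rho:(0,1]\to(0,\infty)$ be a nondecreasing function such that $\lim_{\tau\to0+}\rho(\tau)=0$. Assume that the set $$\Phi_\rho:=\{(x,t)\in\mathbf{R}^n\times(-1,0):(-t)^{1/2}\rho(-t)<|x|<\rho(1)\}$$ is open. Then the origin $(0,0)$ is regular for the heat equation with respect to $\Phi_\rho$ if and only if $$\int_0^1\rho(\tau)^{n-2}\,\frac{d\tau}{\tau}=\infty.$$
   Context: Regularity for the heat equation is the following notion with $p=2$. Let $n\ge1$ be an integer, $1<p<\infty$, and let $\Theta\subset\mathbf{R}^{n+1}$ be a nonempty bounded open set, with points written $(x,t)$, $x\in\mathbf{R}^n$, $t\in\mathbf{R}$. $\nabla$ and $\operatorname{div}$ are taken with respect to $x$ only, and $\partial\Theta$ is the full topological boundary. The $p$-parabolic equation is $\partial_t u-\Delta_p u=0$, where $\Delta_p u=\operatorname{div}(|\nabla u|^{p-2}\nabla u)$ (the heat equation if $p=2$). Solutions: $u:\Theta\to[-\infty,\infty]$ is a (weak) solution if for every open cylinder $U_{t_1,t_2}=U\times(t_1,t_2)\Subset\Theta$ we have $u\in C([t_1,t_2];L^2(U))\cap L^p(t_1,t_2;W^{1,p}(U))$ and $$\int_{t_1}^{t_2}\int_U|\nabla u|^{p-2}\nabla u\cdot\nabla\varphi\,dx\,dt-\int_{t_1}^{t_2}\int_U u\,\frac{\partial\varphi}{\partial t}\,dx\,dt=0\quad\text{for all }\varphi\in C_0^\infty(U_{t_1,t_2}).$$ A $p$-parabolic function is a continuous solution.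 Superparabolic functions: $u:\Theta\to(-\infty,\infty]$ is $p$-superparabolic if (i) $u$ is lower semicontinuous; (ii) $u$ is finite in a dense subset of $\Theta$; (iii) for every space-time box $Q_{t_1,t_2}=Q\times(t_1,t_2)\Subset\Theta$, $Q=(a_1,b_1)\times\dots\times(a_n,b_n)$, and every $h$ that is $p$-parabolic in $Q_{t_1,t_2}$, continuous on $\overline{Q_{t_1,t_2}}$ and satisfies $h\le u$ on the parabolic boundary $(\overline{Q}\times\{t_1\})\cup(\partial Q\times(t_1,t_2])$, we have $h\le u$ in $Q_{t_1,t_2}$. Perron solution: for bounded $f:\partial\Theta\to\mathbf{R}$, let $\mathcal{U}_f$ be the set of $p$-superparabolic $u$ on $\Theta$ with $\liminf_{\Theta\ni\eta\to\xi}u(\eta)\ge f(\xi)$ for all $\xi\in\partial\Theta$, and $\overline{H}_\Theta f(\xi)=\inf_{u\in\mathcal{U}_f}u(\xi)$ for $\xi\in\Theta$. Regularity: $\xi_0\in\partial\Theta$ is regular with respect to $\Theta$ if $\lim_{\Theta\ni\xi\to\xi_0}\overline{H}_\Theta f(\xi)=f(\xi_0)$ for all $f\in C(\partial\Theta)$; otherwise it is irregular. *)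

theory Defs
  imports "HOL-Analysis.Analysis"
begin

text \<open>
  Points of space-time are pairs \<open>(x, t) :: 'a \<times> real\<close>, with \<open>'a :: euclidean_space\<close> in the role
  of \<open>\<real>\<^sup>n\<close>. A function on a subset of space-time is a total function, of which only the values on
  that subset are used.
\<close>

definition compactly_contained :: "'a::topological_space set \<Rightarrow> 'a set \<Rightarrow> bool" where
  "compactly_contained A B \<longleftrightarrow> compact (closure A) \<and> closure A \<subseteq> B"


section \<open>Test functions and gradients\<close>

fun iterated_partial :: "'a::euclidean_space list \<Rightarrow> ('a \<Rightarrow> real) \<Rightarrow> 'a \<Rightarrow> real" where
  "iterated_partial [] f = f"
| "iterated_partial (b # bs) f = (\<lambda>x. frechet_derivative (iterated_partial bs f) (at x) b)"

text \<open>Differentiability of all iterated partial derivatives makes each of them continuous, so this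
  is \<open>C\<^sup>\<infinity>\<close> on the whole space.\<close>

definition smooth :: "('a::euclidean_space \<Rightarrow> real) \<Rightarrow> bool" where
  "smooth f \<longleftrightarrow> (\<forall>bs. set bs \<subseteq> Basis \<longrightarrow> (\<forall>x. iterated_partial bs f differentiable (at x)))"

text \<open>The functions in \<open>C\<^sub>0\<^sup>\<infinity>(\<Omega>)\<close>, extended by zero outside \<open>\<Omega>\<close>.\<close>

definition test_function :: "'a::euclidean_space set \<Rightarrow> ('a \<Rightarrow> real) \<Rightarrow> bool" where
  "test_function \<Omega> \<phi> \<longleftrightarrow> smooth \<phi> \<and> compactly_contained {x. \<phi> x \<noteq> 0} \<Omega>"

definition grad :: "('a::euclidean_space \<Rightarrow> real) \<Rightarrow> 'a \<Rightarrow> 'a" where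
  "grad f x = (\<Sum>b\<in>Basis. frechet_derivative f (at x) b *\<^sub>R b)"


section \<open>Function spaces\<close>

definition in_Lp :: "real \<Rightarrow> 'a::euclidean_space set \<Rightarrow> ('a \<Rightarrow> 'b::euclidean_space) \<Rightarrow> bool" where
  "in_Lp q A f \<longleftrightarrow> set_borel_measurable lebesgue A f
      \<and> set_integrable lebesgue A (\<lambda>x. norm (f x) powr q)"

definition Lp_norm :: "real \<Rightarrow> 'a::euclidean_space set \<Rightarrow> ('a \<Rightarrow> 'b::euclidean_space) \<Rightarrow> real" where
  "Lp_norm q A f = (LINT x:A|lebesgue. norm (f x) powr q) powr (1 / q)"

text \<open>\<open>v \<in> W\<^sup>1\<^sup>,\<^sup>q(U)\<close> with distributional gradient \<open>g\<close>.\<close>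

definition in_W1p :: "real \<Rightarrow> 'a::euclidean_space set \<Rightarrow> ('a \<Rightarrow> real) \<Rightarrow> ('a \<Rightarrow> 'a) \<Rightarrow> bool" where
  "in_W1p q U v g \<longleftrightarrow> in_Lp q U v \<and> in_Lp q U g
      \<and> (\<forall>\<phi>. test_function U \<phi> \<longrightarrow>
            (LINT x:U|lebesgue. v x *\<^sub>R grad \<phi> x) = - (LINT x:U|lebesgue. \<phi> x *\<^sub>R g x))"

text \<open>\<open>u \<in> C([t1,t2]; L\<^sup>2(U))\<close>, for the time slices \<open>u(\<cdot>,t)\<close> of an extended-real-valued function.\<close>

definition in_C_L2 :: "'a::euclidean_space set \<Rightarrow> real \<Rightarrow> real \<Rightarrow> ('a \<times> real \<Rightarrow> ereal) \<Rightarrow> bool" where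
  "in_C_L2 U t1 t2 u \<longleftrightarrow>
      (\<forall>t\<in>{t1..t2}. (AE x in lebesgue. x \<in> U \<longrightarrow> \<bar>u (x, t)\<bar> \<noteq> \<infinity>)
                  \<and> in_Lp 2 U (\<lambda>x. real_of_ereal (u (x, t))))
    \<and> (\<forall>t0\<in>{t1..t2}.
          ((\<lambda>t. Lp_norm 2 U (\<lambda>x. real_of_ereal (u (x, t)) - real_of_ereal (u (x, t0)))) \<longlongrightarrow> 0)
            (at t0 within {t1..t2}))"

text \<open>\<open>u \<in> L\<^sup>p(t1,t2; W\<^sup>1\<^sup>,\<^sup>p(U))\<close> with spatial gradient \<open>g\<close>: almost every time slice is in
  \<open>W\<^sup>1\<^sup>,\<^sup>p(U)\<close>, and the integral of \<open>\<bar>u\<bar>\<^sup>p + \<bar>g\<bar>\<^sup>p\<close> over the cylinder is finite. This determines \<open>g\<close>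
  almost everywhere in the cylinder.\<close>

definition in_Lp_W1p :: "real \<Rightarrow> 'a::euclidean_space set \<Rightarrow> real \<Rightarrow> real
    \<Rightarrow> ('a \<times> real \<Rightarrow> ereal) \<Rightarrow> ('a \<times> real \<Rightarrow> 'a) \<Rightarrow> bool" where
  "in_Lp_W1p p U t1 t2 u g \<longleftrightarrow>
      (AE z in lebesgue. z \<in> U \<times> {t1<..<t2} \<longrightarrow> \<bar>u z\<bar> \<noteq> \<infinity>)
    \<and> in_Lp p (U \<times> {t1<..<t2}) (\<lambda>z. real_of_ereal (u z))
    \<and> in_Lp p (U \<times> {t1<..<t2}) g
    \<and> (AE t in lebesgue. t \<in> {t1<..<t2} \<longrightarrow>
          in_W1p p U (\<lambda>x. real_of_ereal (u (x, t))) (\<lambda>x. g (x, t)))"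


section \<open>The equation \<open>\<partial>\<^sub>t u - \<Delta>\<^sub>p u = 0\<close>\<close>

text \<open>Where \<open>g z = 0\<close>, the value of \<open>norm (g z) powr (p - 2)\<close> is \<open>0\<close> for every \<open>p\<close>, including
  \<open>p = 2\<close>; this does not matter as it multiplies the zero vector.\<close>

definition weak_solution :: "real \<Rightarrow> ('a::euclidean_space \<times> real) set \<Rightarrow> ('a \<times> real \<Rightarrow> ereal) \<Rightarrow> bool" where
  "weak_solution p \<Theta> u \<longleftrightarrow>
    (\<forall>U t1 t2. open U \<and> t1 < t2 \<and> compactly_contained (U \<times> {t1<..<t2}) \<Theta> \<longrightarrow>
      in_C_L2 U t1 t2 u \<and>
      (\<exists>g. in_Lp_W1p p U t1 t2 u g \<and>
        (\<forall>\<phi>. test_function (U \<times> {t1<..<t2}) \<phi> \<longrightarrow>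
          (LINT (x, t):U \<times> {t1<..<t2}|lebesgue.
              (norm (g (x, t)) powr (p - 2) *\<^sub>R g (x, t)) \<bullet> grad (\<lambda>y. \<phi> (y, t)) x)
          - (LINT (x, t):U \<times> {t1<..<t2}|lebesgue.
              real_of_ereal (u (x, t)) * deriv (\<lambda>s. \<phi> (x, s)) t) = 0)))"

definition parabolic :: "real \<Rightarrow> ('a::euclidean_space \<times> real) set \<Rightarrow> ('a \<times> real \<Rightarrow> real) \<Rightarrow> bool" where
  "parabolic p \<Theta> h \<longleftrightarrow> continuous_on \<Theta> h \<and> weak_solution p \<Theta> (\<lambda>z. ereal (h z))"

definition lower_semicontinuous_on :: "'a::topological_space set \<Rightarrow> ('a \<Rightarrow> ereal) \<Rightarrow> bool" where
  "lower_semicontinuous_on S u \<longleftrightarrow> (\<forall>c. openin (top_of_set S) {z \<in> S. c < u z})"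

definition superparabolic :: "real \<Rightarrow> ('a::euclidean_space \<times> real) set \<Rightarrow> ('a \<times> real \<Rightarrow> ereal) \<Rightarrow> bool" where
  "superparabolic p \<Theta> u \<longleftrightarrow>
      (\<forall>z\<in>\<Theta>. u z \<noteq> -\<infinity>)
    \<and> lower_semicontinuous_on \<Theta> u
    \<and> \<Theta> \<subseteq> closure {z \<in> \<Theta>. u z \<noteq> \<infinity>}
    \<and> (\<forall>a b t1 t2 h.
        box a b \<noteq> {} \<and> t1 < t2 \<and> compactly_contained (box a b \<times> {t1<..<t2}) \<Theta>
        \<and> parabolic p (box a b \<times> {t1<..<t2}) h
        \<and> continuous_on (closure (box a b \<times> {t1<..<t2})) h
        \<and> (\<forall>z \<in> closure (box a b) \<times> {t1} \<union> frontier (box a b) \<times> {t1<..t2}. ereal (h z) \<le> u z)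
        \<longrightarrow> (\<forall>z \<in> box a b \<times> {t1<..<t2}. ereal (h z) \<le> u z))"


section \<open>Perron solutions and boundary regularity\<close>

definition upper_class :: "real \<Rightarrow> ('a::euclidean_space \<times> real) set \<Rightarrow> ('a \<times> real \<Rightarrow> real)
    \<Rightarrow> ('a \<times> real \<Rightarrow> ereal) set" where
  "upper_class p \<Theta> f =
    {u. superparabolic p \<Theta> u \<and> (\<forall>\<xi>\<in>frontier \<Theta>. Liminf (at \<xi> within \<Theta>) u \<ge> ereal (f \<xi>))}"

definition upper_perron :: "real \<Rightarrow> ('a::euclidean_space \<times> real) set \<Rightarrow> ('a \<times> real \<Rightarrow> real)
    \<Rightarrow> 'a \<times> real \<Rightarrow> ereal" where
  "upper_perron p \<Theta> f \<xi> = (INF u\<in>upper_class p \<Theta> f. u \<xi>)"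

text \<open>Used for bounded open \<open>\<Theta>\<close>, where every continuous \<open>f\<close> on the boundary is bounded.\<close>

definition regular_point :: "real \<Rightarrow> ('a::euclidean_space \<times> real) set \<Rightarrow> 'a \<times> real \<Rightarrow> bool" where
  "regular_point p \<Theta> \<xi>0 \<longleftrightarrow> \<xi>0 \<in> frontier \<Theta> \<and>
    (\<forall>f. continuous_on (frontier \<Theta>) f \<longrightarrow>
      (upper_perron p \<Theta> f \<longlongrightarrow> ereal (f \<xi>0)) (at \<xi>0 within \<Theta>))"

definition Phi :: "(real \<Rightarrow> real) \<Rightarrow> ('a::euclidean_space \<times> real) set" where
  "Phi \<rho> = {(x, t). -1 < t \<and> t < 0 \<and> (- t) powr (1/2) * \<rho> (- t) < norm x \<and> norm x < \<rho> 1}"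

end

theory Submission
  imports Defs
begin

text \<open>
  Both directions compare with potentials \<open>\<integral> a(\<tau>) \<Gamma>(x, t + \<tau>) d\<tau>\<close> of the heat kernel \<open>\<Gamma>\<close>, carried by the
  segment \<open>{0} \<times> [-\<tau>\<^sub>1, -\<tau>\<^sub>0]\<close> of the time axis, which lies outside \<open>Phi \<rho>\<close>. The density \<open>a(\<tau>)\<close> is comparable
  to the capacity \<open>(\<tau>\<^sup>1\<^sup>/\<^sup>2 \<rho>(\<tau>))\<^sup>n\<^sup>-\<^sup>2\<close> of the ball removed at time \<open>-\<tau>\<close>, so that the value of the potential at the
  origin is comparable to the integral of \<open>\<rho>\<^sup>n\<^sup>-\<^sup>2 / \<tau>\<close> over \<open>[\<tau>\<^sub>0, \<tau>\<^sub>1]\<close>.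

  If the integral converges, the potential is at least 1 on the tube near the origin, but small on the
  parabola \<open>\<bar>x\<bar>\<^sup>2 = -t\<close>. Every member of the upper class of a suitable \<open>f\<close> with \<open>f(0, 0) = 0\<close> therefore stays
  above 1/2 on the parabola.

  If it diverges, let \<open>S\<close> be the value at the origin. On \<open>Phi \<rho>\<close> the potential is at most \<open>C\<^sub>L + (1 - 1/L)\<^sup>-\<^sup>n\<^sup>/\<^sup>2 S\<close> for
  every \<open>L > 1\<close>: times \<open>\<tau> \<ge> L\<bar>t\<bar>\<close> contribute the second term, since there \<open>\<Gamma>(x, t + \<tau>)\<close> is at most
  \<open>(1 - 1/L)\<^sup>-\<^sup>n\<^sup>/\<^sup>2\<close> times its value at the origin, and the times in between contribute a constant independent of
  \<open>S\<close>, provided that \<open>\<rho>(\<tau>/L)\<close> replaces \<open>\<rho>(\<tau>)\<close> in \<open>a\<close>. Letting \<open>S \<rightarrow> \<infinity>\<close> and then \<open>L \<rightarrow> \<infinity>\<close>, the normalized potential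
  tends to 1 at the origin and to 0 away from it, which yields barriers.

  Comparison is elementary. A superparabolic function is tested from below, at a minimum of its difference
  with a classical solution, by that solution plus a caloric polynomial. Conversely, classical solutions are
  superparabolic, since continuous weak solutions become classical after mollification.
\<close>

section \<open>Directional derivatives and integration by parts\<close>

text \<open>The test functions \<open>h\<close> in \<open>superparabolic\<close> are weak solutions,
  known only through integrals, while the members of the upper class are merely lower
  semicontinuous. The two never have to be handled together: weak solutions are compared only with
  explicit classical solutions, and superparabolic functions are tested only with explicit classical
  solutions. Hence the class \<open>heat_classical\<close>.

  Density and region match because the heat kernel, integrated in time, is bounded by a multiple of
  the Newtonian kernel \<open>norm x powr (2 - n)\<close>, while outside the tube at time
  \<open>- T\<close> the capacity \<open>(sqrt T * \<rho> T) ^ (n - 2)\<close> is at most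
  \<open>norm x ^ (n - 2)\<close>. The product is bounded only if the density of the recent sources
  sees no value of \<rho> beyond \<open>T\<close>, which forces the rescaling by \<open>L\<close>.
  Divergence survives it, since d\<tau>/\<tau> is invariant under dilations.

  For irregularity nothing is known about the upper class just before time 0. Comparison is
  therefore stated up to a time \<open>T\<close>, ignoring later boundary points, and a potential
  cut off at \<open>\<tau>0\<close> is compared only before \<open>- \<tau>0\<close>, with constants
  that do not depend on \<open>\<tau>0\<close>.\<close>

definition has_dir_deriv :: "('a::euclidean_space \<Rightarrow> real) \<Rightarrow> real \<Rightarrow> 'a \<Rightarrow> 'a \<Rightarrow> bool" where
  "has_dir_deriv f d b z \<longleftrightarrow> ((\<lambda>s. f (z + s *\<^sub>R b)) has_real_derivative d) (at 0)"

lemma has_dir_deriv_line: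
  assumes "has_dir_deriv f d b (z + r *\<^sub>R b)"
  shows "((\<lambda>s. f (z + s *\<^sub>R b)) has_real_derivative d) (at r)"
proof -
  have "((\<lambda>s. f (z + (s + r) *\<^sub>R b)) has_real_derivative d) (at 0)"
    using assms by (simp add: has_dir_deriv_def algebra_simps)
  then show ?thesis
    using DERIV_shift[of "\<lambda>s. f (z + s *\<^sub>R b)" d 0 r] by simp
qed

lemma has_dir_deriv_mult:
  assumes "has_dir_deriv f d b z" "has_dir_deriv g e b z"
  shows "has_dir_deriv (\<lambda>x. f x * g x) (d * g z + f z * e) b z"
  using DERIV_mult[OF assms[unfolded has_dir_deriv_def]]
  by (simp add: has_dir_deriv_def algebra_simps)

lemma eventually_line:
  fixes z b :: "'a::real_normed_vector"
  assumes "open S" "z \<in> S"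
  shows "\<forall>\<^sub>F s in nhds 0. z + s *\<^sub>R b \<in> S"
proof -
  have "((\<lambda>s. z + s *\<^sub>R b) \<longlongrightarrow> z + 0 *\<^sub>R b) (nhds 0)"
    by (intro tendsto_intros filterlim_ident)
  then show ?thesis
    using assms by (auto dest!: topological_tendstoD)
qed

lemma has_dir_deriv_cong:
  assumes "open S" "z \<in> S" "\<And>x. x \<in> S \<Longrightarrow> f x = g x"
  shows "has_dir_deriv f d b z \<longleftrightarrow> has_dir_deriv g d b z"
proof -
  have "\<forall>\<^sub>F s in nhds 0. f (z + s *\<^sub>R b) = g (z + s *\<^sub>R b)"
    using eventually_line[OF assms(1,2), of b] by eventually_elim (use assms(3) in auto)
  then show ?thesis
    unfolding has_dir_deriv_def by (intro DERIV_cong_ev) auto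
qed

lemma has_dir_deriv_unique:
  "has_dir_deriv f d b z \<Longrightarrow> has_dir_deriv f e b z \<Longrightarrow> d = e"
  unfolding has_dir_deriv_def by (rule DERIV_unique)

lemma has_dir_deriv_const: "has_dir_deriv (\<lambda>_. c) 0 b z"
  by (simp add: has_dir_deriv_def)

lemma has_dir_deriv_zero_outside:
  assumes "closed K" "\<And>x. x \<notin> K \<Longrightarrow> f x = 0" "has_dir_deriv f d b z" "z \<notin> K"
  shows "d = 0"
  using has_dir_deriv_cong[of "-K" z f "\<lambda>_. 0" 0 b] has_dir_deriv_const[of 0 b z] assms
    has_dir_deriv_unique by (metis (no_types, lifting) ComplI Compl_iff open_Compl)

lemma continuous_compact_support_integrable:
  fixes f :: "'a::euclidean_space \<Rightarrow> real"
  assumes "continuous_on UNIV f" "compact K" "\<And>x. x \<notin> K \<Longrightarrow> f x = 0"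
  shows "integrable lborel f"
proof -
  have "integrable lborel (\<lambda>x. indicator K x *\<^sub>R f x)"
    by (rule borel_integrable_compact) (use assms(2) in \<open>auto intro: continuous_on_subset[OF assms(1)]\<close>)
  also have "(\<lambda>x. indicator K x *\<^sub>R f x) = f"
    using assms(3) by (fastforce simp: indicator_def)
  finally show ?thesis .
qed

lemma continuous_compact_support_bounded:
  fixes f :: "'a::euclidean_space \<Rightarrow> real"
  assumes "continuous_on UNIV f" "compact K" "\<And>x. x \<notin> K \<Longrightarrow> f x = 0"
  obtains B where "B \<ge> 0" "\<And>x. \<bar>f x\<bar> \<le> B"
proof -
  have "bounded (f ` K)"
    using assms by (meson compact_continuous_image compact_imp_bounded continuous_on_subset top_greatest)
  then obtain B where "\<And>x. x \<in> K \<Longrightarrow> \<bar>f x\<bar> \<le> B"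
    by (auto simp: bounded_iff)
  then have "\<And>x. \<bar>f x\<bar> \<le> max B 0"
    using assms(3) by (metis abs_zero max.coboundedI1 max.cobounded2)
  then show ?thesis using that[of "max B 0"] by auto
qed

lemma lborel_integral_translate:
  fixes f :: "'a::euclidean_space \<Rightarrow> real"
  assumes "f \<in> borel_measurable borel"
  shows "(\<integral>x. f (x + a) \<partial>lborel) = (\<integral>x. f x \<partial>lborel)"
proof -
  have "(\<integral>x. f x \<partial>lborel) = (\<integral>x. f x \<partial>(distr lborel borel ((+) a)))"
    by (simp add: lborel_distr_plus)
  also have "\<dots> = (\<integral>x. f (a + x) \<partial>lborel)"
    by (subst integral_distr) (use assms in auto)
  finally show ?thesis by (simp add: add.commute)
qed

text \<open>Translation invariance makes the integral of every difference quotient of \<open>G\<close> vanish.\<close>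

lemma integral_dir_deriv_eq_0:
  fixes G G' :: "'a::euclidean_space \<Rightarrow> real"
  assumes G: "continuous_on UNIV G" and G': "continuous_on UNIV G'" and K: "compact K"
    and out: "\<And>x. x \<notin> K \<Longrightarrow> G x = 0" and deriv: "\<And>x. has_dir_deriv G (G' x) b x"
  shows "(\<integral>x. G' x \<partial>lborel) = 0"
proof -
  have out': "G' x = 0" if "x \<notin> K" for x
    using has_dir_deriv_zero_outside[OF compact_imp_closed[OF K] out deriv that] by auto
  obtain B where B: "B \<ge> 0" "\<And>x. \<bar>G' x\<bar> \<le> B"
    using continuous_compact_support_bounded[OF G' K out'] by blast
  obtain R where R: "\<And>x. x \<in> K \<Longrightarrow> norm x \<le> R"
    using compact_imp_bounded[OF K] by (auto simp: bounded_iff)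
  \<comment> \<open>The step sizes \<open>s m\<close> are at most 1, so one ball contains the
    supports of all difference quotients, and a multiple of its indicator dominates them.\<close>
  define C where "C = cball (0::'a) (R + norm b)"
  define s where "s m = 1 / real (Suc m)" for m
  have s0: "s m > 0" "s m \<le> 1" for m by (auto simp: s_def field_simps)
  define f where "f m x = (G (x + s m *\<^sub>R b) - G x) / s m" for m x
  have meas: "G \<in> borel_measurable borel" "G' \<in> borel_measurable borel"
    using G G' by (auto intro: borel_measurable_continuous_onI)
  have bound: "\<bar>f m x\<bar> \<le> B" for m x
  proof -
    have "\<exists>\<xi>>0. \<xi> < s m \<and> G (x + s m *\<^sub>R b) - G (x + 0 *\<^sub>R b) = (s m - 0) * G' (x + \<xi> *\<^sub>R b)"
      by (rule MVT2) (use s0 has_dir_deriv_line[OF deriv] in auto)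
    then show ?thesis
      using s0[of m] B by (auto simp: f_def abs_mult)
  qed
  have zero: "f m x = 0" if "x \<notin> C" for m x
  proof -
    have "norm x > R + norm b" using that by (auto simp: C_def)
    moreover have "norm (s m *\<^sub>R b) \<le> norm b"
      using s0[of m] by (simp add: mult_left_le_one_le)
    moreover have "norm (x + s m *\<^sub>R b) \<ge> norm x - norm (s m *\<^sub>R b)"
      by (metis add.commute diff_add_cancel norm_diff_ineq norm_minus_commute)
    ultimately have "norm x > R" "norm (x + s m *\<^sub>R b) > R"
      by (auto intro: le_less_trans[of R "R + norm b"])
    then have "x \<notin> K" "x + s m *\<^sub>R b \<notin> K" using R by force+
    then show ?thesis using out by (simp add: f_def)
  qed
  have intG: "integrable lborel G"
    by (rule continuous_compact_support_integrable[OF G K out])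
  have intGs: "integrable lborel (\<lambda>x. G (x + s m *\<^sub>R b))" for m
  proof (rule continuous_compact_support_integrable)
    show "continuous_on UNIV (\<lambda>x. G (x + s m *\<^sub>R b))"
      by (rule continuous_on_compose2[OF G]) (auto intro!: continuous_intros)
    show "compact ((\<lambda>x. x + - (s m *\<^sub>R b)) ` K)"
      using K by (intro compact_continuous_image continuous_intros)
    show "G (x + s m *\<^sub>R b) = 0" if "x \<notin> (\<lambda>x. x + - (s m *\<^sub>R b)) ` K" for x
    proof -
      have "x + s m *\<^sub>R b \<notin> K" using that by (auto simp: image_iff algebra_simps)
      then show ?thesis by (rule out)
    qed
  qed
  have "(\<integral>x. f m x \<partial>lborel) = 0" for m
    using intG intGs[of m] lborel_integral_translate[OF meas(1), of "s m *\<^sub>R b"]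
    by (simp add: f_def)
  moreover have "(\<lambda>m. \<integral>x. f m x \<partial>lborel) \<longlonglongrightarrow> (\<integral>x. G' x \<partial>lborel)"
  proof (rule integral_dominated_convergence[where w = "\<lambda>x. B * indicator C x"])
    show "integrable lborel (\<lambda>x. B * indicator C x)"
      by (intro integrable_mult_right integrable_real_indicator)
        (auto simp: C_def intro!: emeasure_bounded_finite[unfolded infinity_ennreal_def])
    show "AE x in lborel. (\<lambda>m. f m x) \<longlonglongrightarrow> G' x"
    proof (rule AE_I2)
      fix x
      have lim: "filterlim s (at 0) sequentially"
        unfolding filterlim_at
        using s0 LIMSEQ_inverse_real_of_nat
        by (auto simp: s_def[abs_def] inverse_eq_divide intro!: always_eventually)
      have "((\<lambda>h. (G (x + (0 + h) *\<^sub>R b) - G (x + 0 *\<^sub>R b)) / h) \<longlongrightarrow> G' x) (at 0)"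
        using deriv[of x] unfolding has_dir_deriv_def DERIV_def .
      from filterlim_compose[OF this lim] show "(\<lambda>m. f m x) \<longlonglongrightarrow> G' x"
        by (simp add: f_def)
    qed
    show "AE x in lborel. norm (f m x) \<le> B * indicator C x" for m
      using bound zero by (auto simp: indicator_def)
    show "f m \<in> borel_measurable lborel" for m
      using intG intGs[of m] unfolding f_def by (auto intro!: borel_measurable_integrable)
  qed (use meas in auto)
  ultimately show ?thesis
    by (simp add: LIMSEQ_const_iff)
qed

lemma continuous_on_extend_0:
  fixes f :: "'a::topological_space \<Rightarrow> 'b::real_normed_vector"
  assumes "open A" "closed K" "K \<subseteq> A" "continuous_on A f" "\<And>x. x \<in> A - K \<Longrightarrow> f x = 0"
  shows "continuous_on UNIV (\<lambda>x. if x \<in> A then f x else 0)"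
proof -
  have "continuous_on (A \<union> -K) (\<lambda>x. if x \<in> A then f x else 0)"
  proof (rule continuous_on_open_Un)
    show "continuous_on A (\<lambda>x. if x \<in> A then f x else 0)"
      using assms(4) by (rule continuous_on_eq) auto
    show "continuous_on (-K) (\<lambda>x. if x \<in> A then f x else 0)"
      by (rule continuous_on_eq[of _ "\<lambda>_. 0"]) (use assms(5) in auto)
  qed (use assms in auto)
  moreover have "A \<union> -K = UNIV" using assms by auto
  ultimately show ?thesis by simp
qed

lemma set_integral_eq_extend_0:
  fixes f :: "'a::euclidean_space \<Rightarrow> real"
  assumes "continuous_on UNIV (\<lambda>x. if x \<in> A then f x else 0)" "compact K"
    "\<And>x. x \<in> A - K \<Longrightarrow> f x = 0"
  shows "set_integrable lebesgue A f"
    "(LINT x:A|lebesgue. f x) = (\<integral>x. (if x \<in> A then f x else 0) \<partial>lborel)"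
proof -
  have eq: "(\<lambda>x. indicator A x *\<^sub>R f x) = (\<lambda>x. if x \<in> A then f x else 0)" by auto
  have "integrable lborel (\<lambda>x. if x \<in> A then f x else 0)"
    by (rule continuous_compact_support_integrable[OF assms(1,2)]) (use assms(3) in auto)
  then show "set_integrable lebesgue A f"
    unfolding set_integrable_def eq by (simp add: integrable_completion borel_measurable_integrable)
  show "(LINT x:A|lebesgue. f x) = (\<integral>x. (if x \<in> A then f x else 0) \<partial>lborel)"
    unfolding set_lebesgue_integral_def eq
    by (rule integral_completion) (use assms(1) borel_measurable_continuous_onI in auto)
qed

text \<open>The product \<open>F * \<phi>\<close>, extended by 0, has a continuous derivative along
  \<open>b\<close> on the whole space, whatever \<open>F\<close> does near the boundary of
  \<open>A\<close>; the integral of that derivative vanishes.\<close>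

lemma set_integral_by_parts:
  fixes F F' \<phi> \<phi>' :: "'a::euclidean_space \<Rightarrow> real"
  assumes A: "open A" and F: "continuous_on A F" and F': "continuous_on A F'"
    and dF: "\<And>x. x \<in> A \<Longrightarrow> has_dir_deriv F (F' x) b x"
    and \<phi>: "continuous_on UNIV \<phi>" and \<phi>': "continuous_on UNIV \<phi>'"
    and d\<phi>: "\<And>x. has_dir_deriv \<phi> (\<phi>' x) b x"
    and K: "compact K" "K \<subseteq> A" and out: "\<And>x. x \<notin> K \<Longrightarrow> \<phi> x = 0"
  shows "set_integrable lebesgue A (\<lambda>x. F x * \<phi>' x)" "set_integrable lebesgue A (\<lambda>x. F' x * \<phi> x)"
    "(LINT x:A|lebesgue. F x * \<phi>' x) = - (LINT x:A|lebesgue. F' x * \<phi> x)"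
proof -
  note clK = compact_imp_closed[OF K(1)]
  have out': "\<phi>' x = 0" if "x \<notin> K" for x
    using has_dir_deriv_zero_outside[OF clK out d\<phi> that] by auto
  have c\<phi>: "continuous_on A \<phi>" "continuous_on A \<phi>'"
    using \<phi> \<phi>' continuous_on_subset by auto
  let ?e = "\<lambda>f x. if x \<in> A then (f x::real) else 0"
  have c: "continuous_on UNIV (?e (\<lambda>x. F x * \<phi> x))"
    "continuous_on UNIV (?e (\<lambda>x. F x * \<phi>' x))" "continuous_on UNIV (?e (\<lambda>x. F' x * \<phi> x))"
    by (rule continuous_on_extend_0[OF A clK K(2)];
        use out out' in \<open>auto intro!: continuous_intros F F' c\<phi>\<close>)+
  have z: "F x * \<phi>' x = 0" "F' x * \<phi> x = 0" if "x \<in> A - K" for x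
    using that out out' by auto
  note i1 = set_integral_eq_extend_0[OF c(2) K(1) z(1)]
  note i2 = set_integral_eq_extend_0[OF c(3) K(1) z(2)]
  show "set_integrable lebesgue A (\<lambda>x. F x * \<phi>' x)" "set_integrable lebesgue A (\<lambda>x. F' x * \<phi> x)"
    using i1(1) i2(1) by auto
  have "(\<integral>x. ?e (\<lambda>x. F' x * \<phi> x) x + ?e (\<lambda>x. F x * \<phi>' x) x \<partial>lborel) = 0"
  proof (rule integral_dir_deriv_eq_0[OF c(1) _ K(1)])
    show "continuous_on UNIV (\<lambda>x. ?e (\<lambda>x. F' x * \<phi> x) x + ?e (\<lambda>x. F x * \<phi>' x) x)"
      using c by (intro continuous_on_add)
    show "has_dir_deriv (?e (\<lambda>x. F x * \<phi> x)) (?e (\<lambda>x. F' x * \<phi> x) x + ?e (\<lambda>x. F x * \<phi>' x) x) b x" for x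
    proof (cases "x \<in> A")
      case True
      then show ?thesis
        using has_dir_deriv_mult[OF dF[OF True] d\<phi>]
        by (subst has_dir_deriv_cong[OF A True, of _ "\<lambda>x. F x * \<phi> x"]) auto
    next
      case False
      then have "x \<in> -K" using K by auto
      then show ?thesis
        using False has_dir_deriv_const[of 0 b x] out clK
        by (subst has_dir_deriv_cong[of "-K" _ _ "\<lambda>x. 0"]) auto
    qed
  qed (use out in auto)
  moreover have "integrable lborel (?e (\<lambda>x. F x * \<phi>' x))" "integrable lborel (?e (\<lambda>x. F' x * \<phi> x))"
    using continuous_compact_support_integrable[OF c(2) K(1)] out'
      continuous_compact_support_integrable[OF c(3) K(1)] out by auto
  ultimately show "(LINT x:A|lebesgue. F x * \<phi>' x) = - (LINT x:A|lebesgue. F' x * \<phi> x)"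
    using i1(2) i2(2) by auto
qed

section \<open>Classical solutions of the heat equation\<close>

text \<open>Only first and pure second derivatives along the axes appear, each continuous: what
  integration by parts and the second derivative test at a maximum consume. For potentials they are
  obtained by differentiating under the integral along lines.\<close>

definition heat_classical :: "('a::euclidean_space \<times> real) set \<Rightarrow> ('a \<times> real \<Rightarrow> real) \<Rightarrow> bool" where
  "heat_classical \<Omega> v \<longleftrightarrow> continuous_on \<Omega> v \<and>
    (\<exists>D1 D2 Dt. continuous_on \<Omega> Dt \<and>
      (\<forall>i\<in>Basis. continuous_on \<Omega> (D1 i) \<and> continuous_on \<Omega> (D2 i)) \<and>
      (\<forall>z\<in>\<Omega>. has_dir_deriv v (Dt z) (0, 1) z \<and> Dt z = (\<Sum>i\<in>Basis. D2 i z) \<and>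
        (\<forall>i\<in>Basis. has_dir_deriv v (D1 i z) (i, 0) z \<and> has_dir_deriv (D1 i) (D2 i z) (i, 0) z)))"

lemma heat_classicalE:
  assumes "heat_classical \<Omega> v"
  obtains D1 D2 Dt where "continuous_on \<Omega> v" "continuous_on \<Omega> Dt"
    "\<And>i. i \<in> Basis \<Longrightarrow> continuous_on \<Omega> (D1 i)" "\<And>i. i \<in> Basis \<Longrightarrow> continuous_on \<Omega> (D2 i)"
    "\<And>z. z \<in> \<Omega> \<Longrightarrow> has_dir_deriv v (Dt z) (0, 1) z"
    "\<And>z. z \<in> \<Omega> \<Longrightarrow> Dt z = (\<Sum>i\<in>Basis. D2 i z)"
    "\<And>z i. z \<in> \<Omega> \<Longrightarrow> i \<in> Basis \<Longrightarrow> has_dir_deriv v (D1 i z) (i, 0) z"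
    "\<And>z i. z \<in> \<Omega> \<Longrightarrow> i \<in> Basis \<Longrightarrow> has_dir_deriv (D1 i) (D2 i z) (i, 0) z"
proof -
  from assms obtain D1 D2 Dt where "continuous_on \<Omega> v" "continuous_on \<Omega> Dt"
    "\<forall>i\<in>Basis. continuous_on \<Omega> (D1 i) \<and> continuous_on \<Omega> (D2 i)"
    "\<forall>z\<in>\<Omega>. has_dir_deriv v (Dt z) (0, 1) z \<and> Dt z = (\<Sum>i\<in>Basis. D2 i z) \<and>
        (\<forall>i\<in>Basis. has_dir_deriv v (D1 i z) (i, 0) z \<and> has_dir_deriv (D1 i) (D2 i z) (i, 0) z)"
    unfolding heat_classical_def by (elim conjE exE)
  then show thesis by (intro that[of Dt D1 D2]) blast+
qed

lemma heat_classicalI: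
  assumes "continuous_on \<Omega> v" "continuous_on \<Omega> Dt"
    "\<And>i. i \<in> Basis \<Longrightarrow> continuous_on \<Omega> (D1 i)" "\<And>i. i \<in> Basis \<Longrightarrow> continuous_on \<Omega> (D2 i)"
    "\<And>z. z \<in> \<Omega> \<Longrightarrow> has_dir_deriv v (Dt z) (0, 1) z"
    "\<And>z. z \<in> \<Omega> \<Longrightarrow> Dt z = (\<Sum>i\<in>Basis. D2 i z)"
    "\<And>z i. z \<in> \<Omega> \<Longrightarrow> i \<in> Basis \<Longrightarrow> has_dir_deriv v (D1 i z) (i, 0) z"
    "\<And>z i. z \<in> \<Omega> \<Longrightarrow> i \<in> Basis \<Longrightarrow> has_dir_deriv (D1 i) (D2 i z) (i, 0) z"
  shows "heat_classical \<Omega> v"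
  unfolding heat_classical_def
  by (rule conjI, rule assms(1), rule exI[of _ D1], rule exI[of _ D2], rule exI[of _ Dt])
     (intro conjI ballI; (rule assms; assumption))

lemma heat_classical_subset:
  assumes "heat_classical \<Omega> v" "A \<subseteq> \<Omega>"
  shows "heat_classical A v"
proof -
  obtain D1 D2 Dt where *: "continuous_on \<Omega> v" "continuous_on \<Omega> Dt"
    "\<And>i. i \<in> Basis \<Longrightarrow> continuous_on \<Omega> (D1 i)" "\<And>i. i \<in> Basis \<Longrightarrow> continuous_on \<Omega> (D2 i)"
    and D: "\<And>z. z \<in> \<Omega> \<Longrightarrow> has_dir_deriv v (Dt z) (0, 1) z"
    "\<And>z. z \<in> \<Omega> \<Longrightarrow> Dt z = (\<Sum>i\<in>Basis. D2 i z)"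
    "\<And>z i. z \<in> \<Omega> \<Longrightarrow> i \<in> Basis \<Longrightarrow> has_dir_deriv v (D1 i z) (i, 0) z"
    "\<And>z i. z \<in> \<Omega> \<Longrightarrow> i \<in> Basis \<Longrightarrow> has_dir_deriv (D1 i) (D2 i z) (i, 0) z"
    by (rule heat_classicalE[OF assms(1)]) (rule that)
  show ?thesis
    by (rule heat_classicalI[of A v Dt D1 D2];
        rule *(1,2)[THEN continuous_on_subset, OF assms(2)] *(3,4)[THEN continuous_on_subset, OF _ assms(2)]
          D[OF subsetD[OF assms(2)]]; assumption)
qed

section \<open>From classical to weak solutions\<close>

lemma test_functionD:
  fixes \<phi> :: "'a::euclidean_space \<Rightarrow> real"
  assumes "test_function \<Omega> \<phi>"
  shows "\<phi> differentiable (at x)" "continuous_on UNIV \<phi>"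
    "b \<in> Basis \<Longrightarrow> has_dir_deriv \<phi> (frechet_derivative \<phi> (at x) b) b x"
    "b \<in> Basis \<Longrightarrow> continuous_on UNIV (\<lambda>x. frechet_derivative \<phi> (at x) b)"
    "compact (closure {x. \<phi> x \<noteq> 0})" "closure {x. \<phi> x \<noteq> 0} \<subseteq> \<Omega>"
    "x \<notin> closure {x. \<phi> x \<noteq> 0} \<Longrightarrow> \<phi> x = 0"
proof -
  have s: "set bs \<subseteq> Basis \<Longrightarrow> iterated_partial bs \<phi> differentiable (at x)" for bs x
    using assms by (auto simp: test_function_def smooth_def)
  show d: "\<phi> differentiable (at x)" for x using s[of "[]" x] by simp
  show "continuous_on UNIV \<phi>"
    using d by (auto simp: continuous_on_eq_continuous_at intro: differentiable_imp_continuous_within)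
  show "has_dir_deriv \<phi> (frechet_derivative \<phi> (at x) b) b x" if "b \<in> Basis"
  proof -
    have "(\<phi> has_derivative frechet_derivative \<phi> (at x)) (at (x + 0 *\<^sub>R b))"
      using d frechet_derivative_works by auto
    then have "((\<lambda>s. \<phi> (x + s *\<^sub>R b)) has_derivative (\<lambda>s. frechet_derivative \<phi> (at x) (s *\<^sub>R b))) (at 0)"
      by (rule has_derivative_compose[where f = "\<lambda>s. x + s *\<^sub>R b" and g = \<phi>, rotated])
         (auto intro!: derivative_eq_intros)
    moreover have "(\<lambda>s. frechet_derivative \<phi> (at x) (s *\<^sub>R b)) = (*) (frechet_derivative \<phi> (at x) b)"
      using linear_frechet_derivative[OF d[of x]] by (auto simp: linear_cmul)
    ultimately show ?thesis by (simp add: has_dir_deriv_def has_field_derivative_def)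
  qed
  show "continuous_on UNIV (\<lambda>x. frechet_derivative \<phi> (at x) b)" if "b \<in> Basis"
    using s[of "[b]"] that
    by (auto simp: continuous_on_eq_continuous_at intro: differentiable_imp_continuous_within)
  show "compact (closure {x. \<phi> x \<noteq> 0})" "closure {x. \<phi> x \<noteq> 0} \<subseteq> \<Omega>"
    using assms by (auto simp: test_function_def compactly_contained_def)
  show "x \<notin> closure {x. \<phi> x \<noteq> 0} \<Longrightarrow> \<phi> x = 0"
    using closure_subset[of "{x. \<phi> x \<noteq> 0}"] by blast
qed

text \<open>\<open>weak_solution\<close> differentiates slices of a test function, whereas
  \<open>smooth\<close> speaks of its derivatives in space-time; the chain rule identifies the
  two.\<close>

lemma frechet_derivative_slice:
  fixes \<phi> :: "'a::euclidean_space \<times> real \<Rightarrow> real"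
  assumes "\<phi> differentiable (at (x, t))"
  shows "frechet_derivative (\<lambda>y. \<phi> (y, t)) (at x) b = frechet_derivative \<phi> (at (x, t)) (b, 0)"
    "deriv (\<lambda>s. \<phi> (x, s)) t = frechet_derivative \<phi> (at (x, t)) (0, 1)"
proof -
  let ?D = "frechet_derivative \<phi> (at (x, t))"
  have D: "(\<phi> has_derivative ?D) (at (x, t))"
    using assms frechet_derivative_works by auto
  have "((\<lambda>y. \<phi> (y, t)) has_derivative (\<lambda>b. ?D (b, 0))) (at x)"
    by (rule has_derivative_compose[of "\<lambda>y. (y, t)" _ _ _ \<phi>, OF _ D]) (auto intro!: derivative_eq_intros)
  then show "frechet_derivative (\<lambda>y. \<phi> (y, t)) (at x) b = ?D (b, 0)"
    by (metis frechet_derivative_at)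
  have "((\<lambda>s. \<phi> (x, s)) has_derivative (\<lambda>s. ?D (0, s))) (at t)"
    by (rule has_derivative_compose[of "\<lambda>y. (x, y)" _ _ _ \<phi>, OF _ D]) (auto intro!: derivative_eq_intros)
  moreover have "(\<lambda>s. ?D (0, s)) = (*) (?D (0, 1))"
  proof
    fix s :: real
    have "?D (s *\<^sub>R (0, 1)) = s *\<^sub>R ?D (0, 1)"
      using linear_frechet_derivative[OF assms] by (rule linear_cmul)
    then show "?D (0, s) = ?D (0, 1) * s" by simp
  qed
  ultimately have "((\<lambda>s. \<phi> (x, s)) has_real_derivative ?D (0, 1)) (at t)"
    by (simp add: has_field_derivative_def)
  then show "deriv (\<lambda>s. \<phi> (x, s)) t = ?D (0, 1)" by (rule DERIV_imp_deriv)
qed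

lemma in_Lp_continuous:
  fixes f :: "'a::euclidean_space \<Rightarrow> 'b::euclidean_space"
  assumes "compact K" "open U" "U \<subseteq> K" "continuous_on K f" "q \<ge> 0"
  shows "in_Lp q U f"
proof -
  have U: "U \<in> sets borel" using assms by auto
  have m: "(\<lambda>x. indicator U x *\<^sub>R f x) \<in> borel_measurable borel"
    using assms by (intro borel_measurable_continuous_on_indicator U) (auto intro: continuous_on_subset)
  then have m': "set_borel_measurable lebesgue U f"
    unfolding set_borel_measurable_def by (simp add: measurable_completion)
  \<comment> \<open>Measurability of \<open>f\<close> is available on \<open>U\<close> only, hence
    the second cut-off inside the norm.\<close>
  have "(\<lambda>x. indicator U x *\<^sub>R (norm (indicator U x *\<^sub>R f x) powr q)) \<in> borel_measurable borel"
    using m U by measurable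
  also have "(\<lambda>x. indicator U x *\<^sub>R (norm (indicator U x *\<^sub>R f x) powr q)) = (\<lambda>x. indicator U x *\<^sub>R (norm (f x) powr q))"
    by (auto simp: indicator_def)
  finally have m2: "(\<lambda>x. indicator U x *\<^sub>R (norm (f x) powr q)) \<in> borel_measurable borel" .
  have "bounded (f ` K)" using assms by (simp add: compact_continuous_image compact_imp_bounded)
  then obtain B where B: "\<And>x. x \<in> K \<Longrightarrow> norm (f x) \<le> B" by (auto simp: bounded_iff)
  have fin: "emeasure lborel U < \<infinity>"
    using assms by (meson bounded_subset compact_imp_bounded emeasure_bounded_finite)
  have "integrable lborel (\<lambda>x. indicator U x *\<^sub>R (indicator U x *\<^sub>R (norm (f x) powr q)))"
    by (rule integrableI_bounded_set_indicator[where B = "B powr q"])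
       (use U m2 fin B assms in \<open>auto simp: indicator_def subset_iff intro!: powr_mono2\<close>)
  also have "(\<lambda>x. indicator U x *\<^sub>R (indicator U x *\<^sub>R (norm (f x) powr q))) = (\<lambda>x. indicator U x *\<^sub>R (norm (f x) powr q))"
    by (auto simp: indicator_def)
  finally have "set_integrable lebesgue U (\<lambda>x. norm (f x) powr q)"
    unfolding set_integrable_def using m2 by (simp add: integrable_completion)
  then show ?thesis using m' by (simp add: in_Lp_def)
qed

lemma in_C_L2_continuous:
  fixes v :: "'a::euclidean_space \<times> real \<Rightarrow> real"
  assumes "compact K" "open U" "U \<subseteq> K" "continuous_on (K \<times> {t1..t2}) v"
  shows "in_C_L2 U t1 t2 (\<lambda>z. ereal (v z))"
proof -
  have U: "U \<in> sets borel" using assms by auto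
  have slice: "continuous_on K (\<lambda>x. v (x, t))" if "t \<in> {t1..t2}" for t
    by (rule continuous_on_compose2[OF assms(4)]) (use that in \<open>auto intro!: continuous_intros\<close>)
  have "((\<lambda>t. Lp_norm 2 U (\<lambda>x. v (x, t) - v (x, t0))) \<longlongrightarrow> 0) (at t0 within {t1..t2})"
    if t0: "t0 \<in> {t1..t2}" for t0
  proof -
    define I where "I t = (LINT x:U|lebesgue. norm (v (x, t) - v (x, t0)) powr 2)" for t
    have I0: "I t \<ge> 0" for t
      unfolding I_def set_lebesgue_integral_def by (rule Bochner_Integration.integral_nonneg) auto
    have fin: "emeasure lborel U < \<infinity>"
      using assms by (meson bounded_subset compact_imp_bounded emeasure_bounded_finite)
    have uc: "uniformly_continuous_on (K \<times> {t1..t2}) v"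
      by (rule compact_uniformly_continuous) (use assms in \<open>auto intro: compact_Times\<close>)
    have "(I \<longlongrightarrow> 0) (at t0 within {t1..t2})"
    proof (rule tendstoI)
      fix e :: real assume "e > 0"
      \<comment> \<open>Chosen so that \<open>e'\<^sup>2\<close> times the measure of
        \<open>U\<close> is strictly below \<open>e\<close>; the added 1 covers a null set
        \<open>U\<close>.\<close>
      define e' where "e' = sqrt (e / (measure lborel U + 1))"
      have "e' > 0" using \<open>e > 0\<close> by (auto simp: e'_def divide_simps add_nonneg_pos)
      then obtain d where d: "d > 0"
        "\<And>z w. z \<in> K \<times> {t1..t2} \<Longrightarrow> w \<in> K \<times> {t1..t2} \<Longrightarrow> dist w z < d \<Longrightarrow> dist (v w) (v z) < e'"
        using uc unfolding uniformly_continuous_on_def by metis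
      have "I t < e" if t: "t \<in> {t1..t2}" "dist t t0 < d" for t
      proof -
        have b: "\<bar>v (x, t) - v (x, t0)\<bar> powr 2 \<le> e'\<^sup>2" if "x \<in> U" for x
        proof -
          have "dist (v (x, t)) (v (x, t0)) < e'"
            using that t t0 assms by (intro d) (auto simp: dist_Pair_Pair)
          then show ?thesis by (simp add: dist_real_def abs_le_square_iff[symmetric])
        qed
        have "in_Lp 2 U (\<lambda>x. v (x, t) - v (x, t0))"
          by (rule in_Lp_continuous[OF assms(1,2,3)]) (auto intro!: continuous_intros slice t t0)
        then have "I t \<le> (LINT x:U|lebesgue. e'\<^sup>2)"
          unfolding I_def using b U fin
          by (intro set_integral_mono) (auto simp: in_Lp_def set_integrable_def
              intro!: integrable_scaleR_left integrable_mult_left)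
        also have "\<dots> = measure lborel U * e'\<^sup>2"
          using U fin by (simp add: set_integral_const)
        also have "\<dots> = (measure lborel U / (measure lborel U + 1)) * e"
          using \<open>e > 0\<close> by (simp add: e'_def)
        also have "\<dots> < 1 * e"
          using \<open>e > 0\<close> by (intro mult_strict_right_mono) (auto simp: divide_simps add_nonneg_pos)
        finally show ?thesis by simp
      qed
      then show "\<forall>\<^sub>F t in at t0 within {t1..t2}. dist (I t) 0 < e"
        unfolding eventually_at using d(1) I0 by (intro exI[of _ d]) auto
    qed
    then have "((\<lambda>t. I t powr (1/2)) \<longlongrightarrow> 0) (at t0 within {t1..t2})"
      by (rule tendsto_zero_powrI[where b = "1/2"]) (use I0 in auto)
    then show ?thesis by (simp add: Lp_norm_def I_def)
  qed
  then show ?thesis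
    using slice assms by (auto simp: in_C_L2_def intro!: in_Lp_continuous[of K])
qed

text \<open>The vector \<open>g\<close> of first derivatives serves as weak gradient: integration by
  parts on each time slice gives \<open>in_W1p\<close>. Over the cylinder, one integration by parts
  in space and one in time turn the weak formulation into the integral of \<open>\<phi>\<close>
  against the difference of \<open>Dt\<close> and the sum of the \<open>D2 i\<close>.\<close>

lemma heat_classical_imp_parabolic:
  fixes v :: "'a::euclidean_space \<times> real \<Rightarrow> real"
  assumes v: "heat_classical \<Omega> v"
  shows "parabolic 2 \<Omega> v"
proof -
  obtain D1 D2 Dt where cont: "continuous_on \<Omega> v" "continuous_on \<Omega> Dt"
    "\<And>i. i \<in> Basis \<Longrightarrow> continuous_on \<Omega> (D1 i)" "\<And>i. i \<in> Basis \<Longrightarrow> continuous_on \<Omega> (D2 i)"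
    and D: "\<And>z. z \<in> \<Omega> \<Longrightarrow> has_dir_deriv v (Dt z) (0, 1) z"
    "\<And>z. z \<in> \<Omega> \<Longrightarrow> Dt z = (\<Sum>i\<in>Basis. D2 i z)"
    "\<And>z i. z \<in> \<Omega> \<Longrightarrow> i \<in> Basis \<Longrightarrow> has_dir_deriv v (D1 i z) (i, 0) z"
    "\<And>z i. z \<in> \<Omega> \<Longrightarrow> i \<in> Basis \<Longrightarrow> has_dir_deriv (D1 i) (D2 i z) (i, 0) z"
    by (rule heat_classicalE[OF v]) (rule that)
  define g where "g z = (\<Sum>i\<in>Basis. D1 i z *\<^sub>R i)" for z
  have gi: "g z \<bullet> i = D1 i z" if "i \<in> Basis" for z i
    using that by (simp add: g_def)
  have cg: "continuous_on \<Omega> g" unfolding g_def by (intro continuous_intros cont)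
  have "weak_solution 2 \<Omega> (\<lambda>z. ereal (v z))"
    unfolding weak_solution_def
  proof (intro allI impI, elim conjE)
    fix U :: "'a set" and t1 t2 :: real
    assume U: "open U" and t: "t1 < t2" and cc: "compactly_contained (U \<times> {t1<..<t2}) \<Omega>"
    have cl: "closure (U \<times> {t1<..<t2}) = closure U \<times> {t1..t2}"
      using t by (simp add: closure_Times)
    have sub: "closure U \<times> {t1..t2} \<subseteq> \<Omega>" and comp: "compact (closure U \<times> {t1..t2})"
      using cc unfolding compactly_contained_def cl by auto
    have cU: "compact (closure U)"
      using comp t compact_continuous_image[OF continuous_on_fst[OF continuous_on_id], of "closure U \<times> {t1..t2}"]
      by (simp add: fst_image_times)
    let ?O = "U \<times> {t1<..<t2}"
    have O: "open ?O" using U by (auto intro: open_Times)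
    have Osub: "?O \<subseteq> closure U \<times> {t1..t2}" using closure_subset by auto
    have O\<Omega>: "?O \<subseteq> \<Omega>" using Osub sub by auto
    have C: "in_C_L2 U t1 t2 (\<lambda>z. ereal (v z))"
      by (rule in_C_L2_continuous[OF cU U closure_subset continuous_on_subset[OF cont(1) sub]])
    have W: "in_W1p 2 U (\<lambda>x. v (x, t)) (\<lambda>x. g (x, t))" if t: "t \<in> {t1<..<t2}" for t
    proof -
      have sl: "continuous_on (closure U) (\<lambda>x. f (x, t))" if "continuous_on \<Omega> f" for f :: "'a \<times> real \<Rightarrow> 'b::euclidean_space"
        by (rule continuous_on_compose2[OF that]) (use t sub in \<open>auto intro!: continuous_intros\<close>)
      have "(LINT x:U|lebesgue. v (x, t) *\<^sub>R grad \<phi> x) = - (LINT x:U|lebesgue. \<phi> x *\<^sub>R g (x, t))"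
        if \<phi>: "test_function U \<phi>" for \<phi>
      proof -
        note T = test_functionD[OF \<phi>]
        have P: "set_integrable lebesgue U (\<lambda>x. v (x, t) * frechet_derivative \<phi> (at x) i)"
          "set_integrable lebesgue U (\<lambda>x. D1 i (x, t) * \<phi> x)"
          "(LINT x:U|lebesgue. v (x, t) * frechet_derivative \<phi> (at x) i) = - (LINT x:U|lebesgue. D1 i (x, t) * \<phi> x)"
          if i: "i \<in> Basis" for i
        proof -
          have d: "has_dir_deriv (\<lambda>x. v (x, t)) (D1 i (x, t)) i x" if "x \<in> U" for x
            using D(3)[of "(x, t)" i] i that t subsetD[OF O\<Omega>, of "(x, t)"] by (auto simp: has_dir_deriv_def)
          note c1 = continuous_on_subset[OF sl[OF cont(1)] closure_subset]
          note c2 = continuous_on_subset[OF sl[OF cont(3)[OF i]] closure_subset]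
          note * = set_integral_by_parts[OF U c1 c2 d T(2) T(4)[OF i] T(3)[OF i] T(5,6,7), simplified]
          show "set_integrable lebesgue U (\<lambda>x. v (x, t) * frechet_derivative \<phi> (at x) i)"
            "set_integrable lebesgue U (\<lambda>x. D1 i (x, t) * \<phi> x)"
            "(LINT x:U|lebesgue. v (x, t) * frechet_derivative \<phi> (at x) i) = - (LINT x:U|lebesgue. D1 i (x, t) * \<phi> x)"
            using * by auto
        qed
        have e1: "indicator U x *\<^sub>R v (x, t) *\<^sub>R grad \<phi> x =
            (\<Sum>i\<in>Basis. (indicator U x *\<^sub>R (v (x, t) * frechet_derivative \<phi> (at x) i)) *\<^sub>R i)" for x
          by (simp add: grad_def scaleR_sum_right)
        have e2: "indicator U x *\<^sub>R \<phi> x *\<^sub>R g (x, t) =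
            (\<Sum>i\<in>Basis. (indicator U x *\<^sub>R (D1 i (x, t) * \<phi> x)) *\<^sub>R i)" for x
          by (simp add: g_def scaleR_sum_right ac_simps)
        have "(LINT x:U|lebesgue. v (x, t) *\<^sub>R grad \<phi> x) =
          (\<Sum>i\<in>Basis. (LINT x:U|lebesgue. v (x, t) * frechet_derivative \<phi> (at x) i) *\<^sub>R i)"
          unfolding set_lebesgue_integral_def e1 using P(1)
          by (subst Bochner_Integration.integral_sum) (auto simp: set_integrable_def)
        also have "\<dots> = - (\<Sum>i\<in>Basis. (LINT x:U|lebesgue. D1 i (x, t) * \<phi> x) *\<^sub>R i)"
          using P(3) by (simp add: sum_negf)
        also have "(\<Sum>i\<in>Basis. (LINT x:U|lebesgue. D1 i (x, t) * \<phi> x) *\<^sub>R i) =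
            (LINT x:U|lebesgue. \<phi> x *\<^sub>R g (x, t))"
          unfolding set_lebesgue_integral_def e2 using P(2)
          by (subst Bochner_Integration.integral_sum) (auto simp: set_integrable_def)
        finally show ?thesis .
      qed
      then show ?thesis
        unfolding in_W1p_def using sl[OF cont(1)] sl[OF cg] cU U closure_subset
        by (auto intro!: in_Lp_continuous[of "closure U"])
    qed
    have L: "in_Lp_W1p 2 U t1 t2 (\<lambda>z. ereal (v z)) g"
      unfolding in_Lp_W1p_def
      using W in_Lp_continuous[OF comp O Osub, of v 2] in_Lp_continuous[OF comp O Osub, of g 2]
        continuous_on_subset[OF cont(1) sub] continuous_on_subset[OF cg sub] by auto
    have "(LINT (x, t):?O|lebesgue. (norm (g (x, t)) powr (2 - 2) *\<^sub>R g (x, t)) \<bullet> grad (\<lambda>y. \<phi> (y, t)) x)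
        - (LINT (x, t):?O|lebesgue. real_of_ereal (ereal (v (x, t))) * deriv (\<lambda>s. \<phi> (x, s)) t) = 0"
      if \<phi>: "test_function ?O \<phi>" for \<phi>
    proof -
      note T = test_functionD[OF \<phi>]
      let ?d = "\<lambda>b z. frechet_derivative \<phi> (at z) b"
      have bt: "(0::'a, 1::real) \<in> Basis" by (simp add: Basis_prod_def)
      have bi: "(i, 0::real) \<in> Basis" if "i \<in> Basis" for i :: 'a
        using that by (simp add: Basis_prod_def)
      have P: "set_integrable lebesgue ?O (\<lambda>z. D1 i z * ?d (i, 0) z)"
        "set_integrable lebesgue ?O (\<lambda>z. D2 i z * \<phi> z)"
        "(LINT z:?O|lebesgue. D1 i z * ?d (i, 0) z) = - (LINT z:?O|lebesgue. D2 i z * \<phi> z)"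
        if i: "i \<in> Basis" for i
        using set_integral_by_parts[OF O continuous_on_subset[OF cont(3)[OF i] O\<Omega>]
            continuous_on_subset[OF cont(4)[OF i] O\<Omega>]
            D(4)[OF subsetD[OF O\<Omega>] i] T(2) T(4)[OF bi[OF i]] T(3)[OF bi[OF i]] T(5,6,7)] by blast+
      have Q: "(LINT z:?O|lebesgue. v z * ?d (0, 1) z) = - (LINT z:?O|lebesgue. Dt z * \<phi> z)"
        using set_integral_by_parts(3)[OF O continuous_on_subset[OF cont(1) O\<Omega>]
            continuous_on_subset[OF cont(2) O\<Omega>]
            D(1)[OF subsetD[OF O\<Omega>]] T(2) T(4)[OF bt] T(3)[OF bt] T(5,6,7)] by blast
      have e1: "indicator ?O z *\<^sub>R (case z of (x, t) \<Rightarrow>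
            (norm (g (x, t)) powr (2 - 2) *\<^sub>R g (x, t)) \<bullet> grad (\<lambda>y. \<phi> (y, t)) x) =
          (\<Sum>i\<in>Basis. indicator ?O z *\<^sub>R (D1 i z * ?d (i, 0) z))" for z
      proof (cases z)
        case (Pair x t)
        have "norm (g z) powr (2 - 2) *\<^sub>R g z = g z" by auto
        moreover have "grad (\<lambda>y. \<phi> (y, t)) x = (\<Sum>i\<in>Basis. ?d (i, 0) z *\<^sub>R i)"
          by (simp add: grad_def frechet_derivative_slice(1)[OF T(1)] Pair)
        ultimately have "(norm (g z) powr (2 - 2) *\<^sub>R g z) \<bullet> grad (\<lambda>y. \<phi> (y, t)) x
            = (\<Sum>i\<in>Basis. D1 i z * ?d (i, 0) z)"
          by (simp add: inner_sum_right gi mult.commute)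
        then show ?thesis by (simp only: Pair prod.case scaleR_sum_right)
      qed
      have e2: "indicator ?O z *\<^sub>R (case z of (x, t) \<Rightarrow> real_of_ereal (ereal (v (x, t))) * deriv (\<lambda>s. \<phi> (x, s)) t)
          = indicator ?O z *\<^sub>R (v z * ?d (0, 1) z)" for z
        using frechet_derivative_slice(2)[OF T(1)] by (cases z) auto
      \<comment> \<open>The heat equation enters here.\<close>
      have e3: "(\<Sum>i\<in>Basis. indicator ?O z *\<^sub>R (D2 i z * \<phi> z)) = indicator ?O z *\<^sub>R (Dt z * \<phi> z)" for z
        using D(2)[of z] O\<Omega> by (auto simp: indicator_def sum_distrib_right)
      have "(LINT (x, t):?O|lebesgue. (norm (g (x, t)) powr (2 - 2) *\<^sub>R g (x, t)) \<bullet> grad (\<lambda>y. \<phi> (y, t)) x)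
         = (\<Sum>i\<in>Basis. LINT z:?O|lebesgue. D1 i z * ?d (i, 0) z)"
        unfolding set_lebesgue_integral_def e1 using P(1)
        by (subst Bochner_Integration.integral_sum) (auto simp: set_integrable_def)
      also have "\<dots> = - (\<Sum>i\<in>Basis. LINT z:?O|lebesgue. D2 i z * \<phi> z)"
        unfolding sum_negf[symmetric] by (rule sum.cong[OF refl], rule P(3))
      also have "(\<Sum>i\<in>Basis. LINT z:?O|lebesgue. D2 i z * \<phi> z) = (LINT z:?O|lebesgue. Dt z * \<phi> z)"
        unfolding set_lebesgue_integral_def e3[symmetric] using P(2)
        by (subst Bochner_Integration.integral_sum) (auto simp: set_integrable_def)
      also have "- \<dots> = (LINT z:?O|lebesgue. v z * ?d (0, 1) z)"
        using Q by simp
      also have "\<dots> = (LINT (x, t):?O|lebesgue. real_of_ereal (ereal (v (x, t))) * deriv (\<lambda>s. \<phi> (x, s)) t)"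
        unfolding set_lebesgue_integral_def e2 ..
      finally show ?thesis by simp
    qed
    then show "in_C_L2 U t1 t2 (\<lambda>z. ereal (v z)) \<and>
      (\<exists>g. in_Lp_W1p 2 U t1 t2 (\<lambda>z. ereal (v z)) g \<and>
        (\<forall>\<phi>. test_function ?O \<phi> \<longrightarrow>
          (LINT (x, t):?O|lebesgue. (norm (g (x, t)) powr (2 - 2) *\<^sub>R g (x, t)) \<bullet> grad (\<lambda>y. \<phi> (y, t)) x)
        - (LINT (x, t):?O|lebesgue. real_of_ereal (ereal (v (x, t))) * deriv (\<lambda>s. \<phi> (x, s)) t) = 0))"
      using C L by blast
  qed
  then show ?thesis using cont by (simp add: parabolic_def)
qed

section \<open>Mollifiers\<close>

text \<open>For \<open>k = 0\<close> this is the standard smooth function that is flat at 0. Its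
  derivatives are linear combinations of the functions with larger \<open>k\<close>, so that
  smoothness follows by induction within the family.\<close>

definition flat_fun :: "nat \<Rightarrow> real \<Rightarrow> real" where
  "flat_fun k s = (if s > 0 then (1 / s) ^ k * exp (- 1 / s) else 0)"

lemma flat_fun_tendsto_0: "(flat_fun k \<longlongrightarrow> 0) (at 0)"
proof -
  have "((\<lambda>s. inverse s ^ k / exp (inverse s)) \<longlongrightarrow> (0::real)) (at_right 0)"
    by (rule filterlim_compose[OF tendsto_power_div_exp_0 filterlim_inverse_at_top_right])
  then have "(flat_fun k \<longlongrightarrow> 0) (at_right 0)"
    by (rule Lim_transform_eventually)
       (auto simp: flat_fun_def exp_minus field_simps eventually_at_right_field intro!: exI[of _ 1])
  moreover have "(flat_fun k \<longlongrightarrow> 0) (at_left 0)"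
    by (rule tendsto_eventually) (auto simp: flat_fun_def eventually_at_left_field intro!: exI[of _ "-1"])
  ultimately show ?thesis by (simp add: filterlim_at_split)
qed

text \<open>At 0 the difference quotient of \<open>flat_fun k\<close> is
  \<open>flat_fun (Suc k)\<close> itself, which tends to 0.\<close>

lemma flat_fun_deriv:
  "(flat_fun k has_real_derivative flat_fun (k + 2) s - k * flat_fun (Suc k) s) (at s)"
proof -
  consider "s > 0" | "s < 0" | "s = 0" by linarith
  then show ?thesis
  proof cases
    case 1
    have inv: "((\<lambda>s. 1 / s) has_real_derivative - ((1 / s)\<^sup>2)) (at s)"
      using 1 by (auto intro!: derivative_eq_intros simp: field_simps power2_eq_square)
    have "((\<lambda>s. (1 / s) ^ k) has_real_derivative - real k * (1 / s) ^ Suc k) (at s)"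
    proof (cases k)
      case (Suc m)
      show ?thesis
        unfolding Suc by (rule DERIV_cong[OF DERIV_power_Suc[OF inv]])
          (use 1 in \<open>simp add: power2_eq_square field_simps\<close>)
    qed simp
    moreover have "((\<lambda>s. exp (- 1 / s)) has_real_derivative exp (- 1 / s) * (1 / s)\<^sup>2) (at s)"
      using 1 by (auto intro!: derivative_eq_intros simp: field_simps power2_eq_square)
    ultimately have "((\<lambda>s. (1 / s) ^ k * exp (- 1 / s)) has_real_derivative
        flat_fun (k + 2) s - k * flat_fun (Suc k) s) (at s)"
      using 1 by (auto intro!: DERIV_cong[OF DERIV_mult] simp: flat_fun_def algebra_simps power2_eq_square)
    moreover have "\<forall>\<^sub>F x in nhds s. flat_fun k x = (1 / x) ^ k * exp (- 1 / x)"
      by (rule eventually_mono[OF eventually_nhds_in_open[of "{0<..}" s]]) (use 1 in \<open>auto simp: flat_fun_def\<close>)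
    ultimately show ?thesis
      by (subst DERIV_cong_ev[OF refl _ refl])
  next
    case 2
    have "((\<lambda>s. 0) has_real_derivative flat_fun (k + 2) s - k * flat_fun (Suc k) s) (at s)"
      using 2 by (auto simp: flat_fun_def)
    moreover have "\<forall>\<^sub>F x in nhds s. flat_fun k x = 0"
      by (rule eventually_mono[OF eventually_nhds_in_open[of "{..<0}" s]]) (use 2 in \<open>auto simp: flat_fun_def\<close>)
    ultimately show ?thesis
      by (subst DERIV_cong_ev[OF refl _ refl])
  next
    case 3
    have "(\<lambda>h. (flat_fun k (0 + h) - flat_fun k 0) / h) = flat_fun (Suc k)"
      by (auto simp: flat_fun_def fun_eq_iff)
    then show ?thesis
      using 3 flat_fun_tendsto_0[of "Suc k"] by (simp add: DERIV_def flat_fun_def)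
  qed
qed

text \<open>A class closed under differentiation all of whose members vanish off the interval from
  -1 to 1. It contains the standard bump, hence all of its iterated derivatives.\<close>

inductive bump_class :: "(real \<Rightarrow> real) \<Rightarrow> bool" where
  prod: "bump_class (\<lambda>s. flat_fun j (1 + s) * flat_fun k (1 - s))"
| lincomb: "bump_class f \<Longrightarrow> bump_class g \<Longrightarrow> bump_class (\<lambda>s. f s + c * g s)"

lemma bump_class_deriv:
  "bump_class f \<Longrightarrow> \<exists>f'. bump_class f' \<and> (\<forall>s. (f has_real_derivative f' s) (at s))"
proof (induction rule: bump_class.induct)
  case (prod j k)
  let ?p = "\<lambda>j k s. flat_fun j (1 + s) * flat_fun k (1 - s)"
  let ?f = "\<lambda>s. ((?p (j + 2) k s + (- real j) * ?p (Suc j) k s) + (- 1) * ?p j (k + 2) s) + real k * ?p j (Suc k) s"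
  have "bump_class ?f" by (intro bump_class.intros)
  moreover have "(?p j k has_real_derivative ?f s) (at s)" for s
  proof -
    have "((\<lambda>s. flat_fun j (1 + s)) has_real_derivative (flat_fun (j + 2) (1 + s) - j * flat_fun (Suc j) (1 + s)) * 1) (at s)"
      by (rule DERIV_chain2[OF flat_fun_deriv]) (auto intro!: derivative_eq_intros)
    moreover have "((\<lambda>s. flat_fun k (1 - s)) has_real_derivative (flat_fun (k + 2) (1 - s) - k * flat_fun (Suc k) (1 - s)) * (-1)) (at s)"
      by (rule DERIV_chain2[OF flat_fun_deriv]) (auto intro!: derivative_eq_intros)
    ultimately show ?thesis
      by (rule DERIV_cong[OF DERIV_mult]) (simp add: algebra_simps)
  qed
  ultimately show ?case by blast
next
  case (lincomb f g c)
  then obtain f' g' where "bump_class f'" "bump_class g'"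
    "\<And>s. (f has_real_derivative f' s) (at s)" "\<And>s. (g has_real_derivative g' s) (at s)"
    by blast
  then show ?case
    by (intro exI[of _ "\<lambda>s. f' s + c * g' s"] conjI allI)
       (auto intro!: bump_class.lincomb derivative_eq_intros)
qed

lemma bump_class_support: "bump_class f \<Longrightarrow> \<bar>s\<bar> \<ge> 1 \<Longrightarrow> f s = 0"
  by (induction rule: bump_class.induct) (auto simp: flat_fun_def)

text \<open>A bump of radius \<epsilon> bundled with all its derivatives, \<open>D k\<close> being
  the \<open>k\<close>-th one, so that differentiation becomes an index shift. No normalization is
  imposed; the mass is divided out later.\<close>

definition bump_seq :: "real \<Rightarrow> (nat \<Rightarrow> real \<Rightarrow> real) \<Rightarrow> bool" where
  "bump_seq \<epsilon> D \<longleftrightarrow> (\<forall>k s. (D k has_real_derivative D (Suc k) s) (at s)) \<and>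
    (\<forall>k s. \<bar>s\<bar> \<ge> \<epsilon> \<longrightarrow> D k s = 0) \<and> (\<forall>s. D 0 s \<ge> 0) \<and> D 0 0 > 0"

lemma ex_bump_seq:
  assumes "\<epsilon> > 0"
  shows "\<exists>D. bump_seq \<epsilon> D"
proof -
  define f where "f s = flat_fun 0 (1 + s) * flat_fun 0 (1 - s)" for s
  have B: "bump_class ((deriv ^^ k) f)" for k
  proof (induction k)
    case 0
    show ?case using bump_class.prod[of 0 0] by (simp add: f_def[abs_def])
  next
    case (Suc k)
    then obtain f' where f': "bump_class f'" "\<And>s. ((deriv ^^ k) f has_real_derivative f' s) (at s)"
      using bump_class_deriv by blast
    then have "deriv ((deriv ^^ k) f) = f'" by (auto intro!: ext DERIV_imp_deriv)
    then show ?case using f' by simp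
  qed
  have D: "((deriv ^^ k) f has_real_derivative (deriv ^^ Suc k) f s) (at s)" for k s
  proof -
    obtain f' where f': "bump_class f'" "\<And>s. ((deriv ^^ k) f has_real_derivative f' s) (at s)"
      using bump_class_deriv[OF B] by blast
    then have "deriv ((deriv ^^ k) f) s = f' s" by (auto intro!: DERIV_imp_deriv)
    then show ?thesis using f' by simp
  qed
  define E where "E k s = (deriv ^^ k) f (s / \<epsilon>) / \<epsilon> ^ k" for k s
  have "(E k has_real_derivative E (Suc k) s) (at s)" for k s
  proof -
    have "((\<lambda>s. (deriv ^^ k) f (s / \<epsilon>)) has_real_derivative (deriv ^^ Suc k) f (s / \<epsilon>) * (1 / \<epsilon>)) (at s)"
      by (rule DERIV_chain2[OF D]) (use assms in \<open>auto intro!: derivative_eq_intros\<close>)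
    from DERIV_cdivide[OF this, of "\<epsilon> ^ k"] show ?thesis
      using assms by (simp add: E_def[abs_def] divide_simps mult.commute)
  qed
  moreover have "E k s = 0" if "\<bar>s\<bar> \<ge> \<epsilon>" for k s
    using bump_class_support[OF B, of "s / \<epsilon>" k] that assms by (simp add: E_def divide_simps)
  ultimately have "bump_seq \<epsilon> E"
    using assms by (auto simp: bump_seq_def E_def f_def flat_fun_def)
  then show ?thesis by blast
qed

text \<open>For a multi-index \<open>k\<close> this is the partial derivative of order
  \<open>k\<close> of the product bump \<open>bump_prod D (\<lambda>_. 0)\<close>. Its support lies
  in a cube, which suits the boxes in the definition of superparabolic functions.\<close>

definition bump_prod :: "(nat \<Rightarrow> real \<Rightarrow> real) \<Rightarrow> ('a::euclidean_space \<Rightarrow> nat) \<Rightarrow> 'a \<Rightarrow> real" where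
  "bump_prod D k w = (\<Prod>b\<in>Basis. D (k b) (w \<bullet> b))"

lemma bump_seq_continuous: "bump_seq \<epsilon> D \<Longrightarrow> continuous_on UNIV (D k)"
  unfolding bump_seq_def by (intro DERIV_continuous_on) (auto intro: has_field_derivative_at_within)

lemma continuous_bump_prod [continuous_intros]:
  assumes "bump_seq \<epsilon> D" "continuous_on A f"
  shows "continuous_on A (\<lambda>x. bump_prod D k (f x))"
  unfolding bump_prod_def
  by (intro continuous_on_prod continuous_on_compose2[OF bump_seq_continuous[OF assms(1)]])
     (auto intro!: continuous_intros assms)

lemma bump_prod_support:
  assumes "bump_seq \<epsilon> D" "bump_prod D k w \<noteq> 0" "b \<in> Basis"
  shows "\<bar>w \<bullet> b\<bar> < \<epsilon>"
proof -
  have "D (k b) (w \<bullet> b) \<noteq> 0"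
    using assms(2,3) by (auto simp: bump_prod_def prod_zero_iff)
  then show ?thesis using assms(1) by (force simp: bump_seq_def)
qed

lemma bump_prod_nonneg: "bump_seq \<epsilon> D \<Longrightarrow> bump_prod D (\<lambda>_. 0) w \<ge> 0"
  by (auto simp: bump_prod_def bump_seq_def intro!: prod_nonneg)

lemma bump_prod_0_pos: "bump_seq \<epsilon> D \<Longrightarrow> bump_prod D (\<lambda>_. 0) 0 > 0"
  by (auto simp: bump_prod_def bump_seq_def intro!: prod_pos)

lemma bump_prod_Pair:
  fixes x :: "'a::euclidean_space"
  shows "bump_prod D k (x, t::real) = bump_prod D (\<lambda>i. k (i, 0)) x * D (k (0, 1)) t"
proof -
  have B: "(Basis :: ('a \<times> real) set) = (\<lambda>i. (i, 0)) ` Basis \<union> {(0, 1)}"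
    by (auto simp: Basis_prod_def)
  have "(0, 1) \<notin> (\<lambda>i::'a. (i, 0::real)) ` Basis" by auto
  then show ?thesis
    unfolding bump_prod_def B
    by (subst prod.union_disjoint) (auto simp: prod.reindex inj_on_def)
qed

lemma bump_prod_has_derivative:
  assumes "bump_seq \<epsilon> D"
  shows "(bump_prod D k has_derivative
    (\<lambda>v. \<Sum>b\<in>Basis. (v \<bullet> b) * bump_prod D (k(b := Suc (k b))) w)) (at w)"
proof -
  have D: "(D j has_derivative (\<lambda>h. h * D (Suc j) s)) (at s)" for j s
    using assms by (simp add: bump_seq_def has_field_derivative_def mult_commute_abs)
  have "((\<lambda>w. D (k b) (w \<bullet> b)) has_derivative (\<lambda>v. (v \<bullet> b) * D (Suc (k b)) (w \<bullet> b))) (at w)" for b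
    by (rule has_derivative_compose[of "\<lambda>w. w \<bullet> b" _ _ _ "D (k b)", OF _ D]) (auto intro!: derivative_eq_intros)
  then have "((\<lambda>w. \<Prod>b\<in>Basis. D (k b) (w \<bullet> b)) has_derivative
      (\<lambda>v. \<Sum>b\<in>Basis. (v \<bullet> b) * D (Suc (k b)) (w \<bullet> b) * (\<Prod>c\<in>Basis - {b}. D (k c) (w \<bullet> c)))) (at w)"
    by (rule has_derivative_prod)
  moreover have "(v \<bullet> b) * D (Suc (k b)) (w \<bullet> b) * (\<Prod>c\<in>Basis - {b}. D (k c) (w \<bullet> c)) =
      (v \<bullet> b) * bump_prod D (k(b := Suc (k b))) w" if "b \<in> Basis" for v b
  proof -
    have "(\<Prod>c\<in>Basis - {b}. D (k c) (w \<bullet> c)) = (\<Prod>c\<in>Basis - {b}. D ((k(b := Suc (k b))) c) (w \<bullet> c))"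
      by (intro prod.cong) auto
    then show ?thesis
      using that by (simp add: bump_prod_def prod.remove[OF finite_Basis that])
  qed
  ultimately show ?thesis
    unfolding bump_prod_def[abs_def] by (simp cong: sum.cong)
qed

lemma bump_prod_translate_has_derivative:
  assumes "bump_seq \<epsilon> D"
  shows "((\<lambda>w. c * bump_prod D k (w - z)) has_derivative
    (\<lambda>v. c * (\<Sum>b\<in>Basis. (v \<bullet> b) * bump_prod D (k(b := Suc (k b))) (w - z)))) (at w)"
  by (intro has_derivative_mult_right
        has_derivative_compose[of "\<lambda>w. w - z" _ _ _ "bump_prod D k", OF _ bump_prod_has_derivative[OF assms]])
     (auto intro!: derivative_eq_intros)

lemma bump_prod_frechet:
  assumes "bump_seq \<epsilon> D" "b \<in> Basis"
  shows "frechet_derivative (\<lambda>w. c * bump_prod D k (w - z)) (at w) b =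
    c * bump_prod D (k(b := Suc (k b))) (w - z)"
proof -
  have "frechet_derivative (\<lambda>w. c * bump_prod D k (w - z)) (at w) =
      (\<lambda>v. c * (\<Sum>b\<in>Basis. (v \<bullet> b) * bump_prod D (k(b := Suc (k b))) (w - z)))"
    by (rule frechet_derivative_at[OF bump_prod_translate_has_derivative[OF assms(1)], symmetric])
  then show ?thesis
    using assms(2) by (simp, subst sum.remove[OF finite_Basis assms(2)]) (auto simp: inner_Basis intro!: sum.neutral split: if_splits)
qed

text \<open>Each coordinate has its own factor, so only the number of times that a direction occurs
  in the list matters, not the order.\<close>

lemma iterated_partial_bump_prod:
  assumes "bump_seq \<epsilon> D" "set bs \<subseteq> Basis"
  shows "iterated_partial bs (\<lambda>w. c * bump_prod D k (w - z)) =
    (\<lambda>w. c * bump_prod D (\<lambda>b. k b + count_list bs b) (w - z))"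
  using assms(2)
proof (induction bs)
  case (Cons b bs)
  have "(\<lambda>x. k x + count_list bs x)(b := Suc (k b + count_list bs b)) = (\<lambda>x. k x + count_list (b # bs) x)"
    by auto
  with Cons show ?case
    using bump_prod_frechet[OF assms(1), of b c "\<lambda>x. k x + count_list bs x" z] by simp
qed simp

lemma cbox_around_iff:
  fixes w z :: "'a::euclidean_space"
  shows "w \<in> cbox (z - r *\<^sub>R One) (z + r *\<^sub>R One) \<longleftrightarrow> (\<forall>b\<in>Basis. \<bar>(w - z) \<bullet> b\<bar> \<le> r)"
    "w \<in> box (z - r *\<^sub>R One) (z + r *\<^sub>R One) \<longleftrightarrow> (\<forall>b\<in>Basis. \<bar>(w - z) \<bullet> b\<bar> < r)"
  by (auto simp: mem_box inner_simps abs_le_iff abs_less_iff algebra_simps)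

lemma test_function_bump_prod:
  fixes z :: "'a::euclidean_space"
  assumes "bump_seq \<epsilon> D" "cbox (z - \<epsilon> *\<^sub>R One) (z + \<epsilon> *\<^sub>R One) \<subseteq> U"
  shows "test_function U (\<lambda>w. c * bump_prod D k (w - z))"
proof -
  have "smooth (\<lambda>w. c * bump_prod D k (w - z))"
    unfolding smooth_def
  proof (intro allI impI)
    fix bs :: "'a list" and x
    assume "set bs \<subseteq> Basis"
    then show "iterated_partial bs (\<lambda>w. c * bump_prod D k (w - z)) differentiable at x"
      using bump_prod_translate_has_derivative[OF assms(1)]
      unfolding iterated_partial_bump_prod[OF assms(1) \<open>set bs \<subseteq> Basis\<close>] differentiable_def by blast
  qed
  moreover have sub: "{w. c * bump_prod D k (w - z) \<noteq> 0} \<subseteq> cbox (z - \<epsilon> *\<^sub>R One) (z + \<epsilon> *\<^sub>R One)"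
  proof
    fix w assume "w \<in> {w. c * bump_prod D k (w - z) \<noteq> 0}"
    then have "bump_prod D k (w - z) \<noteq> 0" by auto
    from bump_prod_support[OF assms(1) this] show "w \<in> cbox (z - \<epsilon> *\<^sub>R One) (z + \<epsilon> *\<^sub>R One)"
      unfolding cbox_around_iff by (auto intro: less_imp_le)
  qed
  moreover have "closure {w. c * bump_prod D k (w - z) \<noteq> 0} \<subseteq> cbox (z - \<epsilon> *\<^sub>R One) (z + \<epsilon> *\<^sub>R One)"
    using sub by (rule closure_minimal) (rule closed_cbox)
  moreover have "compact (closure {w. c * bump_prod D k (w - z) \<noteq> 0})"
    unfolding compact_closure using bounded_subset[OF bounded_cbox sub] .
  ultimately show ?thesis
    using assms(2) unfolding test_function_def compactly_contained_def by blast
qed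

section \<open>The weak formulation tested with bumps\<close>

lemma lebesgue_integral_eq_0_by_slices:
  fixes f :: "'a::euclidean_space \<times> real \<Rightarrow> real"
  assumes f: "integrable lebesgue f"
    and slice: "AE t in lebesgue. (\<lambda>x. f (x, t)) \<in> borel_measurable lebesgue \<and> (\<integral>x. f (x, t) \<partial>lebesgue) = 0"
  shows "(\<integral>z. f z \<partial>lebesgue) = 0"
proof -
  \<comment> \<open>Fubini needs measurability with respect to the product of the Borel measures,
    whereas \<open>f\<close> is only Lebesgue measurable. The Borel representative \<open>g\<close>
    differs from \<open>f\<close> on a null set, almost every slice of which is null.\<close>
  obtain g where g: "g \<in> borel_measurable lborel" and ae: "AE z in lborel. f z = g z"
    using completion_ex_borel_measurable_real[OF borel_measurable_integrable[OF f]] by blast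
  have g': "g \<in> borel_measurable lebesgue" using g by (simp add: measurable_completion)
  have ae': "AE z in lebesgue. f z = g z" using ae by (rule AE_completion)
  have "integrable lebesgue g"
    using f ae' by (rule integrable_cong_AE_imp[OF _ g'])
  then have gi: "integrable (lborel \<Otimes>\<^sub>M lborel) g"
    using g by (simp add: integrable_completion lborel_prod)
  obtain N where N: "N \<in> null_sets lborel" "{z \<in> space lborel. f z \<noteq> g z} \<subseteq> N"
    using ae unfolding eventually_ae_filter by blast
  have Nm: "N \<in> sets (lborel \<Otimes>\<^sub>M lborel)" by (subst lborel_prod) (use N(1) in auto)
  have "AE z in lborel \<Otimes>\<^sub>M lborel. z \<notin> N"
    using N(1) by (metis AE_not_in lborel_prod)
  then have "AE x in lborel. AE t in lborel. (x, t) \<notin> N"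
    by (rule lborel_pair.AE_pair)
  moreover have "{z \<in> space (lborel \<Otimes>\<^sub>M lborel). (fst z, snd z) \<notin> N} \<in> sets (lborel \<Otimes>\<^sub>M lborel)"
    using sets.Diff[OF sets.top Nm] by (simp add: set_diff_eq)
  ultimately have N': "AE t in lborel. AE x in lborel. (x::'a, t::real) \<notin> N"
    using lborel_pair.AE_commute[of "\<lambda>x t. (x, t) \<notin> N"] by simp
  have slice': "AE t in lborel. (\<lambda>x. f (x, t)) \<in> borel_measurable lebesgue \<and> (\<integral>x. f (x, t) \<partial>lebesgue) = 0"
    using slice by (simp add: AE_completion_iff)
  have "AE t in lborel. (\<integral>x. g (x, t) \<partial>lborel) = 0"
    using N' slice'
  proof eventually_elim
    case (elim t)
    have gt: "(\<lambda>x. g (x, t)) \<in> borel_measurable lborel"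
      using g by measurable
    have "(\<integral>x. g (x, t) \<partial>lborel) = (\<integral>x. g (x, t) \<partial>lebesgue)"
      using gt by (simp add: integral_completion)
    also have "\<dots> = (\<integral>x. f (x, t) \<partial>lebesgue)"
    proof (rule integral_cong_AE)
      show "AE x in lebesgue. g (x, t) = f (x, t)"
        by (rule AE_completion, rule eventually_mono[OF elim(1)]) (use N(2) in force)
    qed (use elim gt in \<open>auto simp: measurable_completion\<close>)
    finally show ?case using elim by simp
  qed
  then have "(\<integral>t. (\<integral>x. g (x, t) \<partial>lborel) \<partial>lborel) = (\<integral>t. 0 \<partial>(lborel :: real measure))"
    using g by (intro integral_cong_AE) auto
  moreover have "(\<integral>t. (\<integral>x. g (x, t) \<partial>lborel) \<partial>lborel) = (\<integral>z. g z \<partial>(lborel \<Otimes>\<^sub>M lborel))"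
    using lborel_pair.integral_snd[of "\<lambda>x t. g (x, t)"] gi by simp
  ultimately have "(\<integral>z. g z \<partial>lborel) = 0" by (simp add: lborel_prod)
  moreover have "(\<integral>z. f z \<partial>lebesgue) = (\<integral>z. g z \<partial>lebesgue)"
    using f g' ae' by (intro integral_cong_AE) auto
  ultimately show ?thesis using g by (simp add: integral_completion)
qed

text \<open>On a set of finite measure square integrability implies integrability, by
  \<open>norm (g x) \<le> 1 + (norm (g x))\<^sup>2\<close>.\<close>

lemma in_L2_times_bounded_integrable:
  fixes g :: "'a::euclidean_space \<Rightarrow> 'b::euclidean_space"
  assumes "in_Lp 2 A g" "A \<in> sets lebesgue" "emeasure lebesgue A < \<infinity>"
    and "continuous_on UNIV \<phi>" "\<And>x. \<bar>\<phi> x\<bar> \<le> B"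
  shows "set_integrable lebesgue A (\<lambda>x. \<phi> x *\<^sub>R g x)"
proof -
  have m: "(\<lambda>x. indicator A x *\<^sub>R g x) \<in> borel_measurable lebesgue"
    using assms(1) by (simp add: in_Lp_def set_borel_measurable_def)
  have \<phi>: "\<phi> \<in> borel_measurable lebesgue"
    using borel_measurable_continuous_onI[OF assms(4)] by (simp add: measurable_completion)
  have B: "B \<ge> 0" using assms(5)[of 0] by linarith
  have "integrable lebesgue (\<lambda>x. B * (indicator A x + indicator A x *\<^sub>R (norm (g x) powr 2)))"
    using assms(1-3) unfolding in_Lp_def set_integrable_def
    by (intro integrable_mult_right Bochner_Integration.integrable_add integrable_real_indicator) auto
  then have "integrable lebesgue (\<lambda>x. \<phi> x *\<^sub>R (indicator A x *\<^sub>R g x))"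
  proof (rule Bochner_Integration.integrable_bound)
    show "(\<lambda>x. \<phi> x *\<^sub>R (indicator A x *\<^sub>R g x)) \<in> borel_measurable lebesgue"
      using m \<phi> by measurable
    have "norm (\<phi> x *\<^sub>R (indicator A x *\<^sub>R g x)) \<le> norm (B * (indicator A x + indicator A x *\<^sub>R (norm (g x) powr 2)))" for x
    proof (cases "x \<in> A")
      case True
      have "norm (g x) \<le> 1 + (norm (g x))\<^sup>2"
        using zero_le_power2[of "norm (g x) - 1/2"] by (simp add: power2_eq_square algebra_simps)
      then have "\<bar>\<phi> x\<bar> * norm (g x) \<le> B * (1 + (norm (g x))\<^sup>2)"
        using assms(5)[of x] B by (intro mult_mono) auto
      then show ?thesis using True B by (simp add: abs_mult)
    qed simp
    then show "AE x in lebesgue. norm (\<phi> x *\<^sub>R (indicator A x *\<^sub>R g x)) \<le> norm (B * (indicator A x + indicator A x *\<^sub>R (norm (g x) powr 2)))"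
      by simp
  qed
  then show ?thesis by (simp add: set_integrable_def ac_simps)
qed

lemma bump_prod_bounded:
  assumes "bump_seq \<epsilon> D"
  obtains B where "\<And>w. \<bar>bump_prod D k w\<bar> \<le> B"
proof -
  have "bump_prod D k w = 0" if "w \<notin> cbox (0 - \<epsilon> *\<^sub>R One) (0 + \<epsilon> *\<^sub>R One)" for w :: 'a
    using that bump_prod_support[OF assms, of k w] less_imp_le unfolding cbox_around_iff by auto
  from continuous_compact_support_bounded[OF continuous_bump_prod[OF assms continuous_on_id] compact_cbox this]
  show thesis using that by (metis (no_types, lifting))
qed

text \<open>The bump is the test function. The weak gradient \<open>g\<close> is removed by moving
  one more space derivative onto the bump, which leaves the distributional heat equation for
  \<open>h\<close>. The gradient relation is given only on almost every time slice, so this second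
  integration by parts is done slice by slice. The cylinder of radius \<open>2 * \<epsilon>\<close>
  contains the support of the bump with a margin.\<close>

lemma weak_solution_mollified:
  fixes h :: "'a::euclidean_space \<times> real \<Rightarrow> real"
  assumes D: "bump_seq \<epsilon> D" and \<epsilon>: "\<epsilon> > 0"
    and h: "weak_solution 2 \<Omega> (\<lambda>z. ereal (h z))"
    and sub: "cbox (x0 - (2 * \<epsilon>) *\<^sub>R One) (x0 + (2 * \<epsilon>) *\<^sub>R One) \<times> {t0 - 2 * \<epsilon>..t0 + 2 * \<epsilon>} \<subseteq> \<Omega>"
  defines "U \<equiv> box (x0 - (2 * \<epsilon>) *\<^sub>R One) (x0 + (2 * \<epsilon>) *\<^sub>R One)"
    and "I \<equiv> {t0 - 2 * \<epsilon><..<t0 + 2 * \<epsilon>}"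
    and "E \<equiv> \<lambda>k z. bump_prod D k (z - (x0, t0))"
  shows "(LINT z:U \<times> I|lebesgue. h z * (E ((\<lambda>_. 0)((0, 1) := 1)) z
      + (\<Sum>i\<in>Basis. E ((\<lambda>_. 0)((i, 0) := 2)) z))) = 0"
proof -
  define kt where "kt = (\<lambda>_::'a \<times> real. 0::nat)((0, 1) := 1)"
  define k1 where "k1 i = (\<lambda>_::'a \<times> real. 0::nat)((i, 0) := 1)" for i
  define k2 where "k2 i = (\<lambda>_::'a \<times> real. 0::nat)((i, 0) := 2)" for i
  define k0 where "k0 = (\<lambda>_::'a \<times> real. 0::nat)"
  let ?O = "U \<times> I"
  have opn: "open U" "open ?O" by (auto simp: U_def I_def intro: open_Times)
  have clU: "closure U \<subseteq> cbox (x0 - (2 * \<epsilon>) *\<^sub>R One) (x0 + (2 * \<epsilon>) *\<^sub>R One)"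
    unfolding U_def by (rule closure_minimal) (auto simp: box_subset_cbox)
  have clO: "closure ?O \<subseteq> cbox (x0 - (2 * \<epsilon>) *\<^sub>R One) (x0 + (2 * \<epsilon>) *\<^sub>R One) \<times> {t0 - 2 * \<epsilon>..t0 + 2 * \<epsilon>}"
    unfolding closure_Times using clU \<epsilon> by (auto simp: I_def)
  have bO: "bounded ?O"
    unfolding U_def I_def by (intro bounded_Times bounded_box) auto
  have cc: "compactly_contained ?O \<Omega>"
    unfolding compactly_contained_def using clO sub bO compact_closure by blast
  have suppU: "cbox (x0 - \<epsilon> *\<^sub>R One) (x0 + \<epsilon> *\<^sub>R One) \<subseteq> U"
    using \<epsilon> by (force simp: U_def cbox_around_iff)
  have suppO: "cbox ((x0, t0) - \<epsilon> *\<^sub>R One) ((x0, t0) + \<epsilon> *\<^sub>R One) \<subseteq> ?O"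
  proof
    fix z assume "z \<in> cbox ((x0, t0) - \<epsilon> *\<^sub>R One) ((x0, t0) + \<epsilon> *\<^sub>R One)"
    then have *: "\<forall>b\<in>Basis. \<bar>(z - (x0, t0)) \<bullet> b\<bar> \<le> \<epsilon>" unfolding cbox_around_iff .
    obtain x t where z: "z = (x, t)" by (cases z)
    have "\<bar>(x - x0) \<bullet> i\<bar> \<le> \<epsilon>" if "i \<in> Basis" for i
      using *[rule_format, of "(i, 0)"] that by (simp add: z Basis_prod_def)
    moreover have "\<bar>t - t0\<bar> \<le> \<epsilon>"
      using *[rule_format, of "(0, 1)"] by (simp add: z Basis_prod_def)
    ultimately show "z \<in> ?O"
      using \<epsilon> suppU by (auto simp: z I_def cbox_around_iff subset_iff abs_le_iff)
  qed
  have tE: "test_function ?O (E k)" for k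
    using test_function_bump_prod[OF D suppO, of 1 k] by (simp add: E_def)
  have "in_C_L2 U (t0 - 2 * \<epsilon>) (t0 + 2 * \<epsilon>) (\<lambda>z. ereal (h z)) \<and>
      (\<exists>g. in_Lp_W1p 2 U (t0 - 2 * \<epsilon>) (t0 + 2 * \<epsilon>) (\<lambda>z. ereal (h z)) g \<and>
        (\<forall>\<phi>. test_function ?O \<phi> \<longrightarrow>
          (LINT (x, t):?O|lebesgue. (norm (g (x, t)) powr (2 - 2) *\<^sub>R g (x, t)) \<bullet> grad (\<lambda>y. \<phi> (y, t)) x)
          - (LINT (x, t):?O|lebesgue. real_of_ereal (ereal (h (x, t))) * deriv (\<lambda>s. \<phi> (x, s)) t) = 0))"
    using h[unfolded weak_solution_def, rule_format, of U "t0 - 2 * \<epsilon>" "t0 + 2 * \<epsilon>"] opn cc \<epsilon>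
    unfolding I_def by auto
  then obtain g where g: "in_Lp_W1p 2 U (t0 - 2 * \<epsilon>) (t0 + 2 * \<epsilon>) (\<lambda>z. ereal (h z)) g"
    and weak: "\<And>\<phi>. test_function ?O \<phi> \<Longrightarrow>
      (LINT (x, t):?O|lebesgue. (norm (g (x, t)) powr (2 - 2) *\<^sub>R g (x, t)) \<bullet> grad (\<lambda>y. \<phi> (y, t)) x)
      - (LINT (x, t):?O|lebesgue. real_of_ereal (ereal (h (x, t))) * deriv (\<lambda>s. \<phi> (x, s)) t) = 0"
    by blast
  have Lg: "in_Lp 2 ?O g" and Lh: "in_Lp 2 ?O h"
    and W: "AE t in lebesgue. t \<in> I \<longrightarrow> in_W1p 2 U (\<lambda>x. h (x, t)) (\<lambda>x. g (x, t))"
    using g unfolding in_Lp_W1p_def I_def by auto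
  have bi: "(i, 0::real) \<in> Basis" if "i \<in> Basis" for i :: 'a
    using that by (simp add: Basis_prod_def)
  have bt: "(0::'a, 1::real) \<in> Basis" by (simp add: Basis_prod_def)
  have dE: "frechet_derivative (E k) (at z) b = E (k(b := Suc (k b))) z" if "b \<in> Basis" for k z b
    using bump_prod_frechet[OF D that, of 1 k "(x0, t0)" z] by (simp add: E_def)
  have contE: "continuous_on UNIV (E k)" for k
    unfolding E_def by (intro continuous_intros continuous_bump_prod[OF D])
  have upd: "k0((i, 0) := Suc (k0 (i, 0))) = k1 i" "(k1 i)((i, 0) := Suc (k1 i (i, 0))) = k2 i"
    "k0((0, 1) := Suc (k0 (0, 1))) = kt" for i
    by (auto simp: k0_def k1_def k2_def kt_def)
  have meas: "?O \<in> sets lebesgue" "U \<in> sets lebesgue" using opn by auto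
  have fin: "emeasure lebesgue ?O < \<infinity>" "emeasure lebesgue U < \<infinity>"
    using bO opn emeasure_bounded_finite[of ?O] emeasure_bounded_finite[of U]
    by (auto simp: U_def bounded_box)
  have bdE: "\<exists>B. \<forall>z. \<bar>E k z\<bar> \<le> B" for k
    using bump_prod_bounded[OF D, of k] unfolding E_def by metis
  have igE: "set_integrable lebesgue ?O (\<lambda>z. E k z *\<^sub>R g z)" "set_integrable lebesgue ?O (\<lambda>z. E k z *\<^sub>R h z)" for k
    using bdE[of k] in_L2_times_bounded_integrable[OF Lg meas(1) fin(1) contE]
      in_L2_times_bounded_integrable[OF Lh meas(1) fin(1) contE] by blast+
  \<comment> \<open>\<open>f1\<close> is the gradient term of the weak formulation,
    \<open>f2\<close> the term that is to replace it; the integral of \<open>f1 + f2\<close> over a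
    time slice is zero.\<close>
  define f1 where "f1 z = (\<Sum>i\<in>Basis. E (k1 i) z *\<^sub>R g z \<bullet> i)" for z
  define f2 where "f2 z = (\<Sum>i\<in>Basis. E (k2 i) z *\<^sub>R h z)" for z
  have i1: "set_integrable lebesgue ?O f1"
    unfolding f1_def set_integrable_def scaleR_sum_right
  proof (rule Bochner_Integration.integrable_sum)
    fix i
    have "integrable lebesgue (\<lambda>z. (indicator ?O z *\<^sub>R (E (k1 i) z *\<^sub>R g z)) \<bullet> i)"
      by (intro integrable_inner_left igE(1)[unfolded set_integrable_def])
    then show "integrable lebesgue (\<lambda>z. indicator ?O z *\<^sub>R (E (k1 i) z *\<^sub>R g z \<bullet> i))"
      by (simp add: mult.assoc)
  qed
  have i2: "set_integrable lebesgue ?O f2"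
    unfolding f2_def set_integrable_def scaleR_sum_right
    using igE(2) by (intro Bochner_Integration.integrable_sum) (auto simp: set_integrable_def)
  have e1: "indicator ?O z *\<^sub>R (case z of (x, t) \<Rightarrow> (norm (g (x, t)) powr (2 - 2) *\<^sub>R g (x, t)) \<bullet> grad (\<lambda>y. E k0 (y, t)) x)
      = indicator ?O z *\<^sub>R f1 z" for z
  proof (cases z)
    case (Pair x t)
    have "norm (g z) powr (2 - 2) *\<^sub>R g z = g z" by auto
    moreover have "grad (\<lambda>y. E k0 (y, t)) x = (\<Sum>i\<in>Basis. E (k1 i) z *\<^sub>R i)"
      by (simp add: grad_def frechet_derivative_slice(1)[OF test_functionD(1)[OF tE]] dE bi upd Pair)
    ultimately have "(norm (g z) powr (2 - 2) *\<^sub>R g z) \<bullet> grad (\<lambda>y. E k0 (y, t)) x = f1 z"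
      by (simp add: inner_sum_right f1_def)
    then show ?thesis by (simp only: Pair prod.case)
  qed
  have e2: "indicator ?O z *\<^sub>R (case z of (x, t) \<Rightarrow> real_of_ereal (ereal (h (x, t))) * deriv (\<lambda>s. E k0 (x, s)) t)
      = indicator ?O z *\<^sub>R (E kt z *\<^sub>R h z)" for z
    using frechet_derivative_slice(2)[OF test_functionD(1)[OF tE]] dE[OF bt] upd(3) by (cases z) auto
  have w: "(LINT z:?O|lebesgue. f1 z) = (LINT z:?O|lebesgue. E kt z *\<^sub>R h z)"
    using weak[OF tE[of k0]] unfolding set_lebesgue_integral_def e1 e2 by simp
  have "(\<integral>z. indicator ?O z *\<^sub>R (f1 z + f2 z) \<partial>lebesgue) = 0"
  proof (rule lebesgue_integral_eq_0_by_slices)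
    show "integrable lebesgue (\<lambda>z. indicator ?O z *\<^sub>R (f1 z + f2 z))"
      using i1 i2 by (simp add: set_integrable_def scaleR_add_right del: real_scaleR_def)
    show "AE t in lebesgue. (\<lambda>x. indicator ?O (x, t) *\<^sub>R (f1 (x, t) + f2 (x, t))) \<in> borel_measurable lebesgue \<and>
       (\<integral>x. indicator ?O (x, t) *\<^sub>R (f1 (x, t) + f2 (x, t)) \<partial>lebesgue) = 0"
      using W
    proof eventually_elim
      case (elim t)
      show ?case
      proof (cases "t \<in> I")
        case True
        with elim have Wt: "in_W1p 2 U (\<lambda>x. h (x, t)) (\<lambda>x. g (x, t))" by simp
        have Lgt: "in_Lp 2 U (\<lambda>x. g (x, t))" and Lht: "in_Lp 2 U (\<lambda>x. h (x, t))"
          using Wt by (auto simp: in_W1p_def)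
        have ct: "continuous_on UNIV (\<lambda>x. E k (x, t))" for k
          by (rule continuous_on_compose2[OF contE]) (auto intro!: continuous_intros)
        have ig: "set_integrable lebesgue U (\<lambda>x. E k (x, t) *\<^sub>R g (x, t))"
          "set_integrable lebesgue U (\<lambda>x. E k (x, t) *\<^sub>R h (x, t))" for k
          using bdE[of k] in_L2_times_bounded_integrable[OF Lgt meas(2) fin(2) ct]
            in_L2_times_bounded_integrable[OF Lht meas(2) fin(2) ct] by blast+
        have part: "(LINT x:U|lebesgue. E (k2 i) (x, t) *\<^sub>R h (x, t)) = - (LINT x:U|lebesgue. E (k1 i) (x, t) *\<^sub>R g (x, t) \<bullet> i)"
          if i: "i \<in> Basis" for i
        proof -
          let ?\<psi> = "\<lambda>x. E (k1 i) (x, t)"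
          \<comment> \<open>At a fixed time the first derivative of the bump is a multiple of a bump
            in space, hence an admissible test function for the slice.\<close>
          have eq: "?\<psi> = (\<lambda>x. D 0 (t - t0) * bump_prod D ((\<lambda>_. 0)(i := 1)) (x - x0))"
          proof
            fix x
            have "(\<lambda>j. k1 i (j, 0)) = (\<lambda>_. 0)(i := 1)" by (auto simp: k1_def)
            then show "?\<psi> x = D 0 (t - t0) * bump_prod D ((\<lambda>_. 0)(i := 1)) (x - x0)"
              by (simp add: E_def bump_prod_Pair k1_def)
          qed
          have "test_function U ?\<psi>"
            unfolding eq by (rule test_function_bump_prod[OF D suppU])
          then have "(LINT x:U|lebesgue. h (x, t) *\<^sub>R grad ?\<psi> x) = - (LINT x:U|lebesgue. ?\<psi> x *\<^sub>R g (x, t))"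
            using Wt by (simp add: in_W1p_def)
          then have *: "(LINT x:U|lebesgue. h (x, t) *\<^sub>R grad ?\<psi> x) \<bullet> i = - (LINT x:U|lebesgue. ?\<psi> x *\<^sub>R g (x, t)) \<bullet> i"
            by simp
          have gr: "grad ?\<psi> x = (\<Sum>j\<in>Basis. E ((k1 i)((j, 0) := Suc (k1 i (j, 0)))) (x, t) *\<^sub>R j)" for x
            by (simp add: grad_def frechet_derivative_slice(1)[OF test_functionD(1)[OF tE]] dE bi)
          have gi: "grad ?\<psi> x \<bullet> i = E (k2 i) (x, t)" for x
            using i by (simp add: gr upd)
          have ie: "indicator U x *\<^sub>R (h (x, t) *\<^sub>R grad ?\<psi> x)
              = (\<Sum>j\<in>Basis. (indicator U x *\<^sub>R (E ((k1 i)((j, 0) := Suc (k1 i (j, 0)))) (x, t) *\<^sub>R h (x, t))) *\<^sub>R j)" for x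
            by (simp add: gr scaleR_sum_right ac_simps)
          have "integrable lebesgue (\<lambda>x. indicator U x *\<^sub>R (h (x, t) *\<^sub>R grad ?\<psi> x))"
            unfolding ie using ig(2)[unfolded set_integrable_def]
            by (intro Bochner_Integration.integrable_sum integrable_scaleR_left) auto
          then have "(LINT x:U|lebesgue. h (x, t) *\<^sub>R grad ?\<psi> x) \<bullet> i = (LINT x:U|lebesgue. E (k2 i) (x, t) *\<^sub>R h (x, t))"
            unfolding set_lebesgue_integral_def
            by (subst integral_inner_left[symmetric]) (auto simp: gi ac_simps)
          moreover have "(LINT x:U|lebesgue. ?\<psi> x *\<^sub>R g (x, t)) \<bullet> i = (LINT x:U|lebesgue. E (k1 i) (x, t) *\<^sub>R g (x, t) \<bullet> i)"
            unfolding set_lebesgue_integral_def using ig(1)[of "k1 i", unfolded set_integrable_def]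
            by (subst integral_inner_left[symmetric]) (auto simp: mult.assoc)
          ultimately show ?thesis using * by simp
        qed
        have ind: "indicator ?O (x, t) = (indicator U x :: real)" for x
          using True by (auto simp: indicator_def)
        have j1: "integrable lebesgue (\<lambda>x. indicator U x *\<^sub>R (E (k1 i) (x, t) *\<^sub>R g (x, t) \<bullet> i))" for i
        proof -
          have "integrable lebesgue (\<lambda>x. (indicator U x *\<^sub>R (E (k1 i) (x, t) *\<^sub>R g (x, t))) \<bullet> i)"
            using ig(1)[of "k1 i", unfolded set_integrable_def] by (intro integrable_inner_left) auto
          then show ?thesis by (simp add: mult.assoc)
        qed
        have j2: "integrable lebesgue (\<lambda>x. indicator U x *\<^sub>R (E (k2 i) (x, t) *\<^sub>R h (x, t)))" for i
          using ig(2) by (simp add: set_integrable_def)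
        have ex: "indicator ?O (x, t) *\<^sub>R (f1 (x, t) + f2 (x, t)) =
            (\<Sum>i\<in>Basis. indicator U x *\<^sub>R (E (k1 i) (x, t) *\<^sub>R g (x, t) \<bullet> i))
            + (\<Sum>i\<in>Basis. indicator U x *\<^sub>R (E (k2 i) (x, t) *\<^sub>R h (x, t)))" for x
          unfolding ind f1_def f2_def scaleR_add_right scaleR_sum_right ..
        have "integrable lebesgue (\<lambda>x. indicator ?O (x, t) *\<^sub>R (f1 (x, t) + f2 (x, t)))"
          unfolding ex by (intro Bochner_Integration.integrable_add Bochner_Integration.integrable_sum j1 j2)
        moreover have "(\<integral>x. indicator ?O (x, t) *\<^sub>R (f1 (x, t) + f2 (x, t)) \<partial>lebesgue) =
          (\<Sum>i\<in>Basis. \<integral>x. indicator U x *\<^sub>R (E (k1 i) (x, t) *\<^sub>R g (x, t) \<bullet> i) \<partial>lebesgue)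
           + (\<Sum>i\<in>Basis. \<integral>x. indicator U x *\<^sub>R (E (k2 i) (x, t) *\<^sub>R h (x, t)) \<partial>lebesgue)"
          unfolding ex
          by (simp only: Bochner_Integration.integral_add[OF Bochner_Integration.integrable_sum[OF j1]
                Bochner_Integration.integrable_sum[OF j2]]
              Bochner_Integration.integral_sum[OF j1] Bochner_Integration.integral_sum[OF j2])
        moreover have "\<dots> = 0"
          using part unfolding set_lebesgue_integral_def by (simp add: sum_negf)
        ultimately show ?thesis by auto
      qed (simp add: indicator_def)
    qed
  qed
  then have "(LINT z:?O|lebesgue. f1 z) + (LINT z:?O|lebesgue. f2 z) = 0"
    using set_integral_add(2)[OF i1 i2] by (simp add: set_lebesgue_integral_def)
  then have "(LINT z:?O|lebesgue. E kt z *\<^sub>R h z) + (LINT z:?O|lebesgue. f2 z) = 0"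
    using w by simp
  then have "(LINT z:?O|lebesgue. E kt z *\<^sub>R h z + f2 z) = 0"
    using set_integral_add(2)[OF igE(2)[of kt] i2] by simp
  moreover have "E kt z *\<^sub>R h z + f2 z = h z * (E kt z + (\<Sum>i\<in>Basis. E (k2 i) z))" for z
    by (simp add: f2_def sum_distrib_left algebra_simps)
  ultimately show ?thesis unfolding kt_def k2_def by simp
qed

section \<open>Derivative tests at a maximum\<close>

lemma second_deriv_nonpos_at_max:
  fixes f f' :: "real \<Rightarrow> real"
  assumes f: "\<forall>\<^sub>F s in nhds 0. (f has_real_derivative f' s) (at s)"
    and f': "(f' has_real_derivative l) (at 0)" and max: "\<forall>\<^sub>F s in nhds 0. f s \<le> f 0"
  shows "l \<le> 0"
proof (rule ccontr)
  assume "\<not> l \<le> 0"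
  obtain d where d: "d > 0" "\<And>s. \<bar>s\<bar> < d \<Longrightarrow> (f has_real_derivative f' s) (at s) \<and> f s \<le> f 0"
    using eventually_conj[OF f max] by (auto simp: eventually_nhds_metric dist_real_def)
  have "f' 0 = 0"
    by (rule DERIV_local_max[of f "f' 0" 0 d]) (use d in auto)
  moreover obtain e where e: "e > 0" "\<And>h. 0 < h \<Longrightarrow> h < e \<Longrightarrow> f' 0 < f' (0 + h)"
    using DERIV_pos_inc_right[OF f'] \<open>\<not> l \<le> 0\<close> by auto
  moreover define s where "s = min d e / 2"
  moreover have s: "0 < s" "s < d" "s < e" using d e by (auto simp: s_def)
  moreover obtain \<xi> where "0 < \<xi>" "\<xi> < s" "f s - f 0 = (s - 0) * f' \<xi>"
    using MVT2[of 0 s f f'] s d by force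
  ultimately have "f s - f 0 > 0" using e(2)[of \<xi>] by auto
  then show False using d(2)[of s] s by auto
qed

text \<open>One-sided, because the maximum over a closed space-time box may lie on its final time
  level.\<close>

lemma first_deriv_nonneg_at_left_max:
  fixes f :: "real \<Rightarrow> real"
  assumes "(f has_real_derivative l) (at 0)" "\<forall>\<^sub>F s in at_left 0. f s \<le> f 0"
  shows "l \<ge> 0"
proof (rule ccontr)
  assume "\<not> l \<ge> 0"
  then obtain e where e: "e > 0" "\<And>h. 0 < h \<Longrightarrow> h < e \<Longrightarrow> f 0 < f (0 - h)"
    using DERIV_neg_dec_left[OF assms(1)] by auto
  obtain b where b: "b < 0" "\<And>y. y > b \<Longrightarrow> y < 0 \<Longrightarrow> f y \<le> f 0"
    using assms(2) by (auto simp: eventually_at_left_field)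
  define h where "h = min e (- b) / 2"
  have "0 < h" "h < e" "-h > b" using e b by (auto simp: h_def min_def)
  then show False using e(2)[of h] b(2)[of "-h"] by auto
qed

lemma bump_prod_dir_deriv:
  assumes "bump_seq \<epsilon> D" "b \<in> Basis"
  shows "has_dir_deriv (bump_prod D k) (bump_prod D (k(b := Suc (k b))) w) b w"
proof -
  have "((\<lambda>s. bump_prod D k (w + s *\<^sub>R b)) has_derivative
      (\<lambda>s. \<Sum>c\<in>Basis. ((s *\<^sub>R b) \<bullet> c) * bump_prod D (k(c := Suc (k c))) (w + 0 *\<^sub>R b))) (at 0)"
    by (rule has_derivative_compose[where f = "\<lambda>s. w + s *\<^sub>R b" and g = "bump_prod D k",
          OF _ bump_prod_has_derivative[OF assms(1)]]) (auto intro!: derivative_eq_intros)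
  moreover have "(\<lambda>s. \<Sum>c\<in>Basis. ((s *\<^sub>R b) \<bullet> c) * bump_prod D (k(c := Suc (k c))) (w + 0 *\<^sub>R b)) =
      (*) (bump_prod D (k(b := Suc (k b))) w)"
    using assms(2)
    by (intro ext, subst sum.remove[OF finite_Basis assms(2)])
       (auto simp: inner_Basis intro!: sum.neutral split: if_splits)
  ultimately show ?thesis by (simp add: has_dir_deriv_def has_field_derivative_def)
qed

text \<open>Convolution with a derivative of an unnormalized bump. Integrating over a fixed box
  \<open>C\<close> allows differentiation under the integral without extending \<open>h\<close>
  beyond the set where it is continuous.\<close>

definition mollify :: "'a set \<Rightarrow> (nat \<Rightarrow> real \<Rightarrow> real) \<Rightarrow> ('a \<Rightarrow> real) \<Rightarrow> ('a \<Rightarrow> nat) \<Rightarrow> 'a::euclidean_space \<Rightarrow> real" where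
  "mollify C D h k z = integral C (\<lambda>w. h w * bump_prod D k (w - z))"

lemma mollify_dir_deriv:
  assumes D: "bump_seq \<epsilon> D" and h: "continuous_on (cbox l u) h" and b: "b \<in> Basis"
  shows "has_dir_deriv (mollify (cbox l u) D h k) (- mollify (cbox l u) D h (k(b := Suc (k b))) z) b z"
proof -
  let ?k = "k(b := Suc (k b))"
  have d: "((\<lambda>s. bump_prod D k (w - (z + s *\<^sub>R b))) has_real_derivative - bump_prod D ?k (w - (z + s *\<^sub>R b))) (at s)" for w s
  proof -
    have "((\<lambda>r. bump_prod D k ((w - z) + r *\<^sub>R b)) has_real_derivative bump_prod D ?k ((w - z) + (-s) *\<^sub>R b)) (at (-s))"
      using bump_prod_dir_deriv[OF D b] by (rule has_dir_deriv_line)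
    then have "((\<lambda>s. bump_prod D k ((w - z) + (- s) *\<^sub>R b)) has_real_derivative bump_prod D ?k ((w - z) + (-s) *\<^sub>R b) * (-1)) (at s)"
      by (rule DERIV_chain2) (auto intro!: derivative_eq_intros)
    then show ?thesis by (simp add: algebra_simps)
  qed
  have "((\<lambda>s. integral (cbox l u) (\<lambda>w. h w * bump_prod D k (w - (z + s *\<^sub>R b)))) has_real_derivative
     integral (cbox l u) (\<lambda>w. - (h w * bump_prod D ?k (w - (z + 0 *\<^sub>R b))))) (at 0 within UNIV)"
  proof (rule leibniz_rule_field_derivative)
    show "((\<lambda>s. h w * bump_prod D k (w - (z + s *\<^sub>R b))) has_real_derivative - (h w * bump_prod D ?k (w - (z + s *\<^sub>R b)))) (at s within UNIV)"
      for w s using DERIV_cmult[OF d, of "h w"] by simp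
    show "(\<lambda>w. h w * bump_prod D k (w - (z + s *\<^sub>R b))) integrable_on cbox l u" for s
      by (intro integrable_continuous continuous_intros h continuous_bump_prod[OF D])
    show "continuous_on (UNIV \<times> cbox l u) (\<lambda>(s, w). - (h w * bump_prod D ?k (w - (z + s *\<^sub>R b))))"
      unfolding split_beta
      by (intro continuous_intros continuous_bump_prod[OF D] continuous_on_compose2[OF h]) auto
  qed auto
  then show ?thesis by (simp add: has_dir_deriv_def mollify_def)
qed

lemma mollify_continuous:
  assumes "bump_seq \<epsilon> D" "continuous_on (cbox l u) h"
  shows "continuous_on UNIV (mollify (cbox l u) D h k)"
proof -
  have "continuous_on (UNIV \<times> cbox l u) (\<lambda>(z, w). h w * bump_prod D k (w - z))"
    unfolding split_beta
    by (intro continuous_intros continuous_bump_prod[OF assms(1)] continuous_on_compose2[OF assms(2)]) auto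
  from integral_continuous_on_param[OF this] show ?thesis
    by (simp add: mollify_def[abs_def])
qed

lemma bump_prod_outside:
  assumes "bump_seq \<epsilon> D" "w \<notin> cbox (z - \<epsilon> *\<^sub>R One) (z + \<epsilon> *\<^sub>R One)"
  shows "bump_prod D k (w - z) = 0"
  using assms(2) bump_prod_support[OF assms(1), of k "w - z"] less_imp_le unfolding cbox_around_iff by auto

lemma bump_prod_mass:
  fixes z :: "'a::euclidean_space"
  assumes D: "bump_seq \<epsilon> D" and "cbox (z - \<epsilon> *\<^sub>R One) (z + \<epsilon> *\<^sub>R One) \<subseteq> C"
  shows "integral C (\<lambda>w. bump_prod D k (w - z)) = (\<integral>w. bump_prod D k w \<partial>lborel)"
proof -
  have c: "continuous_on UNIV (\<lambda>w. bump_prod D k (w - z))"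
    by (intro continuous_intros continuous_bump_prod[OF D])
  have i: "integrable lborel (\<lambda>w. bump_prod D k (w - z))"
    by (rule continuous_compact_support_integrable[OF c compact_cbox bump_prod_outside[OF D]])
  have "integral C (\<lambda>w. bump_prod D k (w - z)) = integral UNIV (\<lambda>w. if w \<in> C then bump_prod D k (w - z) else 0)"
    by (rule Henstock_Kurzweil_Integration.integral_restrict_UNIV[symmetric])
  also have "(\<lambda>w. if w \<in> C then bump_prod D k (w - z) else 0) = (\<lambda>w. bump_prod D k (w - z))"
    using bump_prod_outside[OF D, of _ z] assms(2) by (auto simp: subset_iff fun_eq_iff)
  also have "integral UNIV (\<lambda>w. bump_prod D k (w - z)) = (\<integral>w. bump_prod D k (w - z) \<partial>lborel)"
    using i by (rule integral_lborel)
  also have "\<dots> = (\<integral>w. bump_prod D k w \<partial>lborel)"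
    using lborel_integral_translate[of "bump_prod D k" "- z"] continuous_bump_prod[OF D continuous_on_id, of UNIV k]
    by (simp add: borel_measurable_continuous_onI)
  finally show ?thesis .
qed

lemma bump_prod_mass_pos:
  assumes D: "bump_seq \<epsilon> D" and \<epsilon>: "\<epsilon> > 0"
  shows "(\<integral>w. bump_prod D (\<lambda>_::'a::euclidean_space. 0) w \<partial>lborel) > 0"
proof -
  let ?C = "cbox (0 - \<epsilon> *\<^sub>R One) (0 + \<epsilon> *\<^sub>R (One::'a))"
  let ?f = "\<lambda>w::'a. bump_prod D (\<lambda>_. 0) (w - 0)"
  have c: "continuous_on ?C ?f"
    by (intro continuous_intros continuous_bump_prod[OF D])
  have "0 \<in> ?C" using \<epsilon> unfolding cbox_around_iff by auto
  moreover have "box (0 - \<epsilon> *\<^sub>R One) (0 + \<epsilon> *\<^sub>R (One::'a)) \<noteq> {}"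
    using \<epsilon> by (auto simp: box_ne_empty inner_simps)
  moreover have "?f 0 > 0" using bump_prod_0_pos[OF D, where 'a='a] by simp
  ultimately have "integral ?C ?f \<noteq> 0"
    using integral_cbox_eq_0_iff[OF c] bump_prod_nonneg[OF D] less_irrefl by metis
  moreover have "integral ?C ?f \<ge> 0"
    using bump_prod_nonneg[OF D] by (intro integral_nonneg integrable_continuous c) auto
  ultimately show ?thesis
    unfolding bump_prod_mass[OF D order_refl] by (simp only: less_le simp_thms not_sym)
qed

text \<open>This is the heat equation for the mollified function. Each derivative in the centre
  raises an index and changes the sign, so the time derivative is minus the first term, while the
  second space derivatives are the terms of the sum. The distributional equation over the small
  cylinder carries over to \<open>cbox l u\<close>, since the bump vanishes off that
  cylinder.\<close>

lemma mollify_heat: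
  fixes h :: "'a::euclidean_space \<times> real \<Rightarrow> real"
  assumes D: "bump_seq \<epsilon> D" and \<epsilon>: "\<epsilon> > 0" and h: "continuous_on (cbox l u) h"
    and weak: "weak_solution 2 \<Omega> (\<lambda>z. ereal (h z))" and \<Omega>: "\<Omega> \<subseteq> cbox l u"
    and sub: "cbox (x0 - (2 * \<epsilon>) *\<^sub>R One) (x0 + (2 * \<epsilon>) *\<^sub>R One) \<times> {t0 - 2 * \<epsilon>..t0 + 2 * \<epsilon>} \<subseteq> \<Omega>"
  shows "mollify (cbox l u) D h ((\<lambda>_. 0)((0, 1) := 1)) (x0, t0)
    + (\<Sum>i\<in>Basis. mollify (cbox l u) D h ((\<lambda>_. 0)((i, 0) := 2)) (x0, t0)) = 0"
proof -
  define O' where "O' = box (x0 - (2 * \<epsilon>) *\<^sub>R One) (x0 + (2 * \<epsilon>) *\<^sub>R One) \<times> {t0 - 2 * \<epsilon><..<t0 + 2 * \<epsilon>}"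
  define F where "F w = h w * (bump_prod D ((\<lambda>_. 0)((0, 1) := 1)) (w - (x0, t0))
      + (\<Sum>i\<in>Basis. bump_prod D ((\<lambda>_. 0)((i, 0) := 2)) (w - (x0, t0))))" for w
  have 0: "(LINT w:O'|lebesgue. F w) = 0"
    unfolding O'_def F_def by (rule weak_solution_mollified[OF D \<epsilon> weak sub])
  have "O' \<subseteq> cbox (x0 - (2 * \<epsilon>) *\<^sub>R One) (x0 + (2 * \<epsilon>) *\<^sub>R One) \<times> {t0 - 2 * \<epsilon>..t0 + 2 * \<epsilon>}"
    unfolding O'_def using box_subset_cbox by fastforce
  then have sub': "O' \<subseteq> cbox l u" using sub \<Omega> by blast
  have c: "continuous_on (cbox l u) F"
    unfolding F_def by (intro continuous_intros h continuous_bump_prod[OF D])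
  have out: "F w = 0" if "w \<notin> O'" for w
  proof -
    have "w \<notin> cbox ((x0, t0) - \<epsilon> *\<^sub>R One) ((x0, t0) + \<epsilon> *\<^sub>R One)"
    proof
      assume "w \<in> cbox ((x0, t0) - \<epsilon> *\<^sub>R One) ((x0, t0) + \<epsilon> *\<^sub>R One)"
      then have *: "\<forall>b\<in>Basis. \<bar>(w - (x0, t0)) \<bullet> b\<bar> \<le> \<epsilon>" unfolding cbox_around_iff .
      obtain x t where w: "w = (x, t)" by (cases w)
      have "\<bar>(x - x0) \<bullet> i\<bar> < 2 * \<epsilon>" if "i \<in> Basis" for i
        using *[rule_format, of "(i, 0)"] that \<epsilon> by (simp add: w Basis_prod_def)
      moreover have "\<bar>t - t0\<bar> \<le> \<epsilon>"
        using *[rule_format, of "(0, 1)"] by (simp add: w Basis_prod_def)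
      ultimately have "w \<in> O'"
        using \<epsilon> unfolding O'_def w by (simp only: mem_Times_iff fst_conv snd_conv cbox_around_iff) auto
      then show False using that by simp
    qed
    then show ?thesis by (simp add: F_def bump_prod_outside[OF D])
  qed
  have ai: "F absolutely_integrable_on O'"
  proof (rule set_integrable_subset)
    show "F absolutely_integrable_on cbox l u" by (rule absolutely_integrable_continuous[OF c])
    have "open O'" by (auto simp: O'_def intro: open_Times)
    then show "O' \<in> sets lebesgue" by auto
  qed (rule sub')
  have "0 = integral O' F"
    using set_lebesgue_integral_eq_integral(2)[OF ai] 0 by simp
  also have "\<dots> = integral (cbox l u) F"
  proof -
    have "integral O' F = integral UNIV (\<lambda>w. if w \<in> O' then F w else 0)"
      by (rule Henstock_Kurzweil_Integration.integral_restrict_UNIV[symmetric])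
    also have "(\<lambda>w. if w \<in> O' then F w else 0) = (\<lambda>w. if w \<in> cbox l u then F w else 0)"
    proof
      fix w show "(if w \<in> O' then F w else 0) = (if w \<in> cbox l u then F w else 0)"
        using out[of w] sub' by auto
    qed
    also have "integral UNIV (\<lambda>w. if w \<in> cbox l u then F w else 0) = integral (cbox l u) F"
      by (rule Henstock_Kurzweil_Integration.integral_restrict_UNIV)
    finally show ?thesis .
  qed
  also have "\<dots> = mollify (cbox l u) D h ((\<lambda>_. 0)((0, 1) := 1)) (x0, t0)
    + (\<Sum>i\<in>Basis. mollify (cbox l u) D h ((\<lambda>_. 0)((i, 0) := 2)) (x0, t0))"
  proof -
    have i: "((\<lambda>w. h w * bump_prod D k (w - (x0, t0))) has_integral mollify (cbox l u) D h k (x0, t0)) (cbox l u)" for k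
      unfolding mollify_def
      by (intro integrable_integral integrable_continuous continuous_intros h continuous_bump_prod[OF D])
    have "(F has_integral mollify (cbox l u) D h ((\<lambda>_. 0)((0, 1) := 1)) (x0, t0)
        + (\<Sum>i\<in>Basis. mollify (cbox l u) D h ((\<lambda>_. 0)((i, 0) := 2)) (x0, t0))) (cbox l u)"
      unfolding F_def distrib_left sum_distrib_left
      by (intro has_integral_add has_integral_sum finite_Basis i)
    then show ?thesis by (rule integral_unique)
  qed
  finally show ?thesis by simp
qed

section \<open>Comparison of weak solutions with classical solutions\<close>

text \<open>\<open>c\<close> is the mass of the bump, so the mollification divided by
  \<open>c\<close> is a weighted mean of values of \<open>h\<close> on a cube around
  \<open>z\<close>.\<close>

lemma mollify_close:
  fixes z :: "'a::euclidean_space"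
  assumes D: "bump_seq \<epsilon> D" and h: "continuous_on (cbox l u) h"
    and sub: "cbox (z - \<epsilon> *\<^sub>R One) (z + \<epsilon> *\<^sub>R One) \<subseteq> cbox l u"
    and close: "\<And>w. w \<in> cbox (z - \<epsilon> *\<^sub>R One) (z + \<epsilon> *\<^sub>R One) \<Longrightarrow> \<bar>h w - h z\<bar> \<le> \<delta>"
  defines "c \<equiv> \<integral>w. bump_prod D (\<lambda>_::'a. 0) w \<partial>lborel"
  shows "\<bar>mollify (cbox l u) D h (\<lambda>_. 0) z - c * h z\<bar> \<le> \<delta> * c"
proof -
  let ?E = "\<lambda>w. bump_prod D (\<lambda>_. 0) (w - z)"
  have E: "(?E has_integral c) (cbox l u)"
  proof -
    have "?E integrable_on cbox l u"
      by (intro integrable_continuous continuous_intros continuous_bump_prod[OF D])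
    then show ?thesis
      using bump_prod_mass[OF D sub, of "\<lambda>_. 0"] by (simp add: has_integral_iff c_def)
  qed
  have "((\<lambda>w. h w * ?E w) has_integral mollify (cbox l u) D h (\<lambda>_. 0) z) (cbox l u)"
    unfolding mollify_def
    by (intro integrable_integral integrable_continuous continuous_intros h continuous_bump_prod[OF D])
  from has_integral_diff[OF this has_integral_mult_right[OF E, of "h z"]]
  have i: "((\<lambda>w. (h w - h z) * ?E w) has_integral (mollify (cbox l u) D h (\<lambda>_. 0) z - h z * c)) (cbox l u)"
    by (simp add: algebra_simps)
  have b: "\<bar>(h w - h z) * ?E w\<bar> \<le> \<delta> * ?E w" for w
  proof (cases "w \<in> cbox (z - \<epsilon> *\<^sub>R One) (z + \<epsilon> *\<^sub>R One)")
    case True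
    then show ?thesis
      using close bump_prod_nonneg[OF D, of "w - z"] by (simp add: abs_mult mult_right_mono)
  qed (simp add: bump_prod_outside[OF D])
  have "norm (integral (cbox l u) (\<lambda>w. (h w - h z) * ?E w)) \<le> integral (cbox l u) (\<lambda>w. \<delta> * ?E w)"
    by (rule integral_norm_bound_integral)
       (use i has_integral_mult_right[OF E, of \<delta>] b in \<open>auto simp: has_integral_iff\<close>)
  then show ?thesis
    using integral_unique[OF i] integral_unique[OF E]
    by (simp add: mult.commute)
qed

lemma has_dir_deriv_lincomb:
  assumes "has_dir_deriv f d b z" "has_dir_deriv g e b z"
  shows "has_dir_deriv (\<lambda>x. f x / c - g x) (d / c - e) b z"
  using DERIV_diff[OF DERIV_cdivide[OF assms(1)[unfolded has_dir_deriv_def], of c] assms(2)[unfolded has_dir_deriv_def]]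
  by (simp add: has_dir_deriv_def)

text \<open>A maximum of \<open>h - v\<close> cannot be examined by derivatives, as \<open>h\<close>
  need not have any. The mollification \<open>H\<close> of \<open>h\<close> satisfies the heat
  equation pointwise on a slightly smaller cylinder, where the classical maximum principle applies
  to it. Uniform continuity pays for the mollification and for the gap between the two
  cylinders.\<close>

lemma parabolic_le_classical:
  fixes a b :: "'a::euclidean_space" and h v :: "'a \<times> real \<Rightarrow> real"
  assumes h: "parabolic 2 (box a b \<times> {t1<..<t2}) h" and ch: "continuous_on (cbox a b \<times> {t1..t2}) h"
    and \<Omega>: "open \<Omega>" "cbox a b \<times> {t1..t2} \<subseteq> \<Omega>" and v: "heat_classical \<Omega> v"
    and bd: "\<And>z. z \<in> cbox a b \<times> {t1} \<union> frontier (box a b) \<times> {t1<..t2} \<Longrightarrow> h z \<le> v z"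
    and zs: "zs \<in> box a b \<times> {t1<..<t2}"
  shows "h zs \<le> v zs"
proof -
  obtain xs ts where zs': "zs = (xs, ts)" "xs \<in> box a b" "t1 < ts" "ts < t2" using zs by auto
  obtain D1 D2 Dt where cv: "continuous_on \<Omega> v"
    and Dv: "\<And>z. z \<in> \<Omega> \<Longrightarrow> has_dir_deriv v (Dt z) (0, 1) z"
    "\<And>z. z \<in> \<Omega> \<Longrightarrow> Dt z = (\<Sum>i\<in>Basis. D2 i z)"
    "\<And>z i. z \<in> \<Omega> \<Longrightarrow> i \<in> Basis \<Longrightarrow> has_dir_deriv v (D1 i z) (i, 0) z"
    "\<And>z i. z \<in> \<Omega> \<Longrightarrow> i \<in> Basis \<Longrightarrow> has_dir_deriv (D1 i) (D2 i z) (i, 0) z"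
    by (rule heat_classicalE[OF v]) (rule that)
  have ab: "a \<bullet> i < b \<bullet> i" if "i \<in> Basis" for i
    using zs'(2) that by (force simp: mem_box)
  define C where "C = cbox a b \<times> {t1..t2}"
  have C: "C = cbox (a, t1) (b, t2)" unfolding C_def by (auto simp: cbox_Pair_eq)
  have cC: "compact C" unfolding C by (rule compact_cbox)
  have chC: "continuous_on C h" using ch by (simp add: C_def)
  have cvC: "continuous_on C v" using cv \<Omega>(2) unfolding C_def by (rule continuous_on_subset)
  have weak: "weak_solution 2 (box a b \<times> {t1<..<t2}) (\<lambda>z. ereal (h z))"
    using h by (simp add: parabolic_def)
  have main: "h zs \<le> v zs + 4 * \<delta>" if \<delta>: "\<delta> > 0" for \<delta>
  proof -
    \<comment> \<open>The penalty \<open>\<kappa> * (t - t1)\<close> excludes a maximum off the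
      parabolic boundary and costs at most \<delta> over the whole cylinder.\<close>
    define \<kappa> where "\<kappa> = \<delta> / (t2 - t1)"
    have \<kappa>: "\<kappa> > 0" "\<kappa> * (t2 - t1) = \<delta>" using \<delta> zs' by (auto simp: \<kappa>_def)
    have "uniformly_continuous_on C h" "uniformly_continuous_on C (\<lambda>z. h z - v z)"
      using cC chC cvC by (auto intro!: compact_uniformly_continuous continuous_intros)
    then obtain r1 r2 where r: "r1 > 0" "r2 > 0"
      "\<And>z w. z \<in> C \<Longrightarrow> w \<in> C \<Longrightarrow> dist w z < r1 \<Longrightarrow> dist (h w) (h z) < \<delta>"
      "\<And>z w. z \<in> C \<Longrightarrow> w \<in> C \<Longrightarrow> dist w z < r2 \<Longrightarrow> dist (h w - v w) (h z - v z) < \<delta>"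
      using \<delta> unfolding uniformly_continuous_on_def by metis
    define N where "N = real (DIM('a \<times> real))"
    have N: "N \<ge> 1" by (simp add: N_def)
    define m0 where "m0 = Min ((\<lambda>i. min ((xs - a) \<bullet> i) ((b - xs) \<bullet> i)) ` Basis)"
    have m0: "m0 > 0"
      unfolding m0_def using zs'(2) by (subst Min_gr_iff) (auto simp: mem_box inner_simps)
    have m0': "(xs - a) \<bullet> i \<ge> m0" "(b - xs) \<bullet> i \<ge> m0" if "i \<in> Basis" for i
      unfolding m0_def using that by (auto intro!: Min.coboundedI[THEN order_trans])
    \<comment> \<open>The first bound keeps the mollifying cube within distance \<open>r1\<close>,
      its diagonal being estimated by the sum of the coordinates; the second keeps a shift by
      \<open>3 * \<epsilon>\<close> within \<open>r2\<close>; the others keep \<open>zs\<close>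
      inside \<open>C'\<close>.\<close>
    define \<epsilon> where "\<epsilon> = Min {r1 / (2 * N), r2 / 4, m0 / 4, (ts - t1) / 4, (t2 - ts) / 4}"
    have "\<epsilon> > 0" unfolding \<epsilon>_def using r m0 zs' N by (subst Min_gr_iff) auto
    have \<epsilon>: "\<epsilon> \<le> r1 / (2 * N)" "\<epsilon> \<le> r2 / 4" "\<epsilon> \<le> m0 / 4" "\<epsilon> \<le> (ts - t1) / 4" "\<epsilon> \<le> (t2 - ts) / 4"
      unfolding \<epsilon>_def by (rule Min_le; simp)+
    have \<epsilon>N: "\<epsilon> * N < r1"
    proof -
      have "\<epsilon> * N \<le> r1 / (2 * N) * N" using \<epsilon>(1) N by (intro mult_right_mono) auto
      also have "\<dots> = r1 / 2" using N by simp
      finally show ?thesis using r(1) by simp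
    qed
    obtain D where D: "bump_seq \<epsilon> D" using ex_bump_seq[OF \<open>\<epsilon> > 0\<close>] by blast
    define c where "c = (\<integral>w. bump_prod D (\<lambda>_::'a \<times> real. 0) w \<partial>lborel)"
    have c: "c > 0" unfolding c_def by (rule bump_prod_mass_pos[OF D \<open>\<epsilon> > 0\<close>])
    define H where "H = mollify C D h"
    \<comment> \<open>The margin \<open>3 * \<epsilon>\<close> exceeds the
      \<open>2 * \<epsilon>\<close> that \<open>mollify_heat\<close> requires inside the open
      cylinder.\<close>
    define C' where "C' = cbox (a + (3 * \<epsilon>) *\<^sub>R One) (b - (3 * \<epsilon>) *\<^sub>R One) \<times> {t1 + 3 * \<epsilon>..t2 - 3 * \<epsilon>}"
    have memC': "(x, t) \<in> C' \<longleftrightarrow> (\<forall>i\<in>Basis. a \<bullet> i + 3 * \<epsilon> \<le> x \<bullet> i \<and> x \<bullet> i \<le> b \<bullet> i - 3 * \<epsilon>)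
        \<and> t1 + 3 * \<epsilon> \<le> t \<and> t \<le> t2 - 3 * \<epsilon>" for x t
      by (auto simp: C'_def mem_box inner_simps)
    have memC: "(x, t) \<in> C \<longleftrightarrow> (\<forall>i\<in>Basis. a \<bullet> i \<le> x \<bullet> i \<and> x \<bullet> i \<le> b \<bullet> i) \<and> t1 \<le> t \<and> t \<le> t2" for x t
      by (auto simp: C_def mem_box)
    have C'C: "C' \<subseteq> C" using \<open>\<epsilon> > 0\<close> by (fastforce simp: memC memC')
    have cC': "compact C'" unfolding C'_def by (intro compact_Times compact_cbox compact_Icc)
    have zsC': "zs \<in> C'"
      using m0' \<epsilon> \<open>\<epsilon> > 0\<close> by (fastforce simp: zs' memC' inner_simps)
    have ball: "cbox (z - \<epsilon> *\<^sub>R One) (z + \<epsilon> *\<^sub>R One) \<subseteq> C" if "z \<in> C'" for z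
    proof
      fix w assume "w \<in> cbox (z - \<epsilon> *\<^sub>R One) (z + \<epsilon> *\<^sub>R One)"
      then have *: "\<forall>b\<in>Basis. \<bar>(w - z) \<bullet> b\<bar> \<le> \<epsilon>" unfolding cbox_around_iff .
      obtain x t y s where z: "z = (x, t)" and w: "w = (y, s)" by (cases z; cases w)
      have "\<bar>(y - x) \<bullet> i\<bar> \<le> \<epsilon>" if "i \<in> Basis" for i
        using *[rule_format, of "(i, 0)"] that by (simp add: z w Basis_prod_def)
      moreover have "\<bar>s - t\<bar> \<le> \<epsilon>"
        using *[rule_format, of "(0, 1)"] by (simp add: z w Basis_prod_def)
      ultimately show "w \<in> C"
        using that \<open>\<epsilon> > 0\<close> unfolding z w memC memC' by (fastforce simp: inner_simps abs_le_iff)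
    qed
    have close: "\<bar>H (\<lambda>_. 0) z / c - h z\<bar> \<le> \<delta>" if z: "z \<in> C'" for z
    proof -
      have "\<bar>mollify (cbox (a, t1) (b, t2)) D h (\<lambda>_. 0) z - c * h z\<bar> \<le> \<delta> * c"
        unfolding c_def
      proof (rule mollify_close[OF D])
        show "continuous_on (cbox (a, t1) (b, t2)) h" using chC by (simp add: C)
        show "cbox (z - \<epsilon> *\<^sub>R One) (z + \<epsilon> *\<^sub>R One) \<subseteq> cbox (a, t1) (b, t2)" using ball[OF z] by (simp add: C)
        fix w assume w: "w \<in> cbox (z - \<epsilon> *\<^sub>R One) (z + \<epsilon> *\<^sub>R One)"
        then have "\<forall>b\<in>Basis. \<bar>(w - z) \<bullet> b\<bar> \<le> \<epsilon>" unfolding cbox_around_iff .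
        then have "(\<Sum>b\<in>Basis. \<bar>(w - z) \<bullet> b\<bar>) \<le> (\<Sum>b\<in>(Basis :: ('a \<times> real) set). \<epsilon>)"
          by (intro sum_mono) auto
        then have "dist w z \<le> N * \<epsilon>"
          using norm_le_l1[of "w - z"] by (simp add: dist_norm N_def)
        then have "dist (h w) (h z) < \<delta>"
          using ball[OF z] w C'C z \<epsilon>N by (intro r(3)) (auto simp: mult.commute)
        then show "\<bar>h w - h z\<bar> \<le> \<delta>" by (simp add: dist_real_def)
      qed
      then have "\<bar>(H (\<lambda>_. 0) z - c * h z) / c\<bar> \<le> \<delta>"
        using c by (simp add: H_def C abs_divide divide_le_eq)
      moreover have "(H (\<lambda>_. 0) z - c * h z) / c = H (\<lambda>_. 0) z / c - h z"
        using c by (simp add: diff_divide_distrib)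
      ultimately show ?thesis by simp
    qed
    have chC2: "continuous_on (cbox (a, t1) (b, t2)) h" using chC by (simp add: C)
    have cH: "continuous_on UNIV (H k)" for k
      unfolding H_def C by (rule mollify_continuous[OF D chC2])
    have dH: "has_dir_deriv (H k) (- H (k(e := Suc (k e))) z) e z" if "e \<in> Basis" for k e z
      unfolding H_def C by (rule mollify_dir_deriv[OF D chC2 that])
    define m where "m z = H (\<lambda>_. 0) z / c - (v z + \<kappa> * (snd z - t1))" for z
    have cm: "continuous_on C' m"
      unfolding m_def using c
      by (auto intro!: continuous_intros continuous_on_subset[OF cH] continuous_on_subset[OF cvC C'C])
    have "C' \<noteq> {}" using zsC' by blast
    then obtain z1 where z1: "z1 \<in> C'" "\<And>z. z \<in> C' \<Longrightarrow> m z \<le> m z1"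
      using continuous_attains_sup[OF cC' _ cm] by blast
    obtain x1 s1 where z1': "z1 = (x1, s1)" by (cases z1)
    \<comment> \<open>A maximum on the parabolic boundary of \<open>C'\<close> has a point of the
      parabolic boundary of the original cylinder within distance \<open>r2\<close>, and there
      \<open>h \<le> v\<close>.\<close>
    have bdry: "m z1 \<le> 2 * \<delta>" if w: "w \<in> C" "h w \<le> v w" "dist z1 w < r2" for w
    proof -
      have "dist (h z1 - v z1) (h w - v w) < \<delta>"
        using w z1(1) C'C by (intro r(4)) auto
      then have "h z1 - v z1 \<le> \<delta>" using w(2) by (auto simp: dist_real_def)
      moreover have "\<kappa> * (s1 - t1) \<ge> 0"
        using z1(1) \<kappa>(1) \<open>\<epsilon> > 0\<close> by (auto simp: z1' memC')
      ultimately show ?thesis using close[OF z1(1)] by (auto simp: m_def z1' abs_le_iff)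
    qed
    have "m z1 \<le> 2 * \<delta>"
    proof (cases "s1 = t1 + 3 * \<epsilon>")
      case True
      show ?thesis
      proof (rule bdry)
        show "(x1, t1) \<in> C" using z1(1) \<open>\<epsilon> > 0\<close> zs' by (force simp: z1' memC memC')
        then show "h (x1, t1) \<le> v (x1, t1)" by (intro bd) (auto simp: C_def)
        have "dist z1 (x1, t1) = \<bar>s1 - t1\<bar>" by (simp add: z1' dist_Pair_Pair dist_real_def)
        then show "dist z1 (x1, t1) < r2" using True \<epsilon>(2) \<open>\<epsilon> > 0\<close> r(2) by auto
      qed
    next
      case s1: False
      show ?thesis
      proof (cases "\<exists>i\<in>Basis. x1 \<bullet> i = a \<bullet> i + 3 * \<epsilon> \<or> x1 \<bullet> i = b \<bullet> i - 3 * \<epsilon>")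
        case True
        then obtain i q where i: "i \<in> Basis" and q: "q = - 3 * \<epsilon> \<and> x1 \<bullet> i + q = a \<bullet> i \<or> q = 3 * \<epsilon> \<and> x1 \<bullet> i + q = b \<bullet> i"
          by force
        define y where "y = x1 + q *\<^sub>R i"
        have yj: "y \<bullet> j = (if j = i then x1 \<bullet> i + q else x1 \<bullet> j)" if "j \<in> Basis" for j
          using that i by (auto simp: y_def inner_simps inner_Basis)
        have yC: "(y, s1) \<in> C"
          using z1(1) \<open>\<epsilon> > 0\<close> q yj ab[OF i] unfolding z1' memC memC' by (fastforce split: if_splits)
        show ?thesis
        proof (rule bdry[OF yC])
          have "\<not> (a \<bullet> i < y \<bullet> i \<and> y \<bullet> i < b \<bullet> i)" using q yj[OF i] by auto
          then have "y \<notin> box a b" unfolding mem_box using i by blast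
          moreover have "y \<in> cbox a b" using yC by (auto simp: C_def)
          moreover have "box a b \<noteq> {}" using zs' by auto
          ultimately have "y \<in> frontier (box a b)" by (simp add: frontier_box)
          then show "h (y, s1) \<le> v (y, s1)"
            using z1(1) \<open>\<epsilon> > 0\<close> by (intro bd) (auto simp: z1' memC')
          have "dist x1 y = \<bar>q\<bar>" using i by (simp add: y_def dist_norm)
          then show "dist z1 (y, s1) < r2"
            using q \<epsilon>(2) \<open>\<epsilon> > 0\<close> r(2) by (auto simp: z1' dist_Pair_Pair)
        qed
      next
        case False
        have z1C: "(x1, s1) \<in> C'" using z1 z1' by simp
        have inn: "a \<bullet> i + 3 * \<epsilon> < x1 \<bullet> i \<and> x1 \<bullet> i < b \<bullet> i - 3 * \<epsilon>" if "i \<in> Basis" for i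
        proof -
          have "a \<bullet> i + 3 * \<epsilon> \<le> x1 \<bullet> i" "x1 \<bullet> i \<le> b \<bullet> i - 3 * \<epsilon>"
            using z1C that unfolding memC' by blast+
          moreover have "x1 \<bullet> i \<noteq> a \<bullet> i + 3 * \<epsilon>" "x1 \<bullet> i \<noteq> b \<bullet> i - 3 * \<epsilon>"
            using False that by blast+
          ultimately show ?thesis by linarith
        qed
        then have x1b: "x1 \<in> box (a + (3 * \<epsilon>) *\<^sub>R One) (b - (3 * \<epsilon>) *\<^sub>R One)"
          by (auto simp: mem_box inner_simps)
        have z1\<Omega>: "(x1, s1) \<in> \<Omega>" using z1C C'C \<Omega>(2) by (auto simp: C_def)
        have heat: "H ((\<lambda>_. 0)((0, 1) := 1)) z1 + (\<Sum>i\<in>Basis. H ((\<lambda>_. 0)((i, 0) := 2)) z1) = 0"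
          unfolding H_def C z1'
        proof (rule mollify_heat[OF D \<open>\<epsilon> > 0\<close> chC2 weak])
          show "box a b \<times> {t1<..<t2} \<subseteq> cbox (a, t1) (b, t2)"
            using box_subset_cbox[of a b] by (fastforce simp: cbox_Pair_eq)
          show "cbox (x1 - (2 * \<epsilon>) *\<^sub>R One) (x1 + (2 * \<epsilon>) *\<^sub>R One) \<times> {s1 - 2 * \<epsilon>..s1 + 2 * \<epsilon>} \<subseteq> box a b \<times> {t1<..<t2}"
            using inn z1C \<open>\<epsilon> > 0\<close> unfolding memC' by (fastforce simp: mem_box inner_simps)
        qed
        have sp: "- H ((\<lambda>_. 0)((0, 1) := 1)) z1 / c - (Dt z1 + \<kappa>) \<ge> 0"
        proof (rule first_deriv_nonneg_at_left_max)
          have "has_dir_deriv (\<lambda>z. v z + \<kappa> * (snd z - t1)) (Dt z1 + \<kappa>) (0, 1) z1"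
            using Dv(1)[OF z1\<Omega>] unfolding has_dir_deriv_def z1'
            by (auto intro!: derivative_eq_intros)
          moreover have "has_dir_deriv (H (\<lambda>_. 0)) (- H ((\<lambda>_. 0)((0, 1) := 1)) z1) (0, 1) z1"
            using dH[of "(0, 1)" "\<lambda>_. 0" z1] by (simp add: Basis_prod_def)
          ultimately have "has_dir_deriv m (- H ((\<lambda>_. 0)((0, 1) := 1)) z1 / c - (Dt z1 + \<kappa>)) (0, 1) z1"
            unfolding m_def[abs_def] by (intro has_dir_deriv_lincomb)
          then show "((\<lambda>s. m (z1 + s *\<^sub>R (0, 1))) has_real_derivative - H ((\<lambda>_. 0)((0, 1) := 1)) z1 / c - (Dt z1 + \<kappa>)) (at 0)"
            by (simp add: has_dir_deriv_def)
          have "m (z1 + s *\<^sub>R (0, 1)) \<le> m z1" if "t1 + 3 * \<epsilon> - s1 < s" "s < 0" for s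
            using that z1C by (intro z1(2)) (auto simp: z1' memC')
          moreover have "t1 + 3 * \<epsilon> - s1 < 0" using s1 z1C by (auto simp: memC')
          ultimately show "\<forall>\<^sub>F s in at_left 0. m (z1 + s *\<^sub>R (0, 1)) \<le> m (z1 + 0 *\<^sub>R (0, 1))"
            unfolding eventually_at_left_field by (intro exI[of _ "t1 + 3 * \<epsilon> - s1"]) (auto simp: zero_prod_def[symmetric])
        qed
        have xp: "H ((\<lambda>_. 0)((i, 0) := 2)) z1 / c - D2 i z1 \<le> 0" if i: "i \<in> Basis" for i
        proof -
          have bi: "(i, 0::real) \<in> Basis" using i by (simp add: Basis_prod_def)
          define m1 where "m1 z = - H ((\<lambda>_. 0)((i, 0) := 1)) z / c - D1 i z" for z
          have d1: "has_dir_deriv m (m1 z) (i, 0) z" if "z \<in> \<Omega>" for z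
          proof -
            have "has_dir_deriv (\<lambda>z. v z + \<kappa> * (snd z - t1)) (D1 i z) (i, 0) z"
              using Dv(3)[OF that i] unfolding has_dir_deriv_def
              by (auto intro!: derivative_eq_intros)
            moreover have "has_dir_deriv (H (\<lambda>_. 0)) (- H ((\<lambda>_. 0)((i, 0) := 1)) z) (i, 0) z"
              using dH[OF bi, of "\<lambda>_. 0" z] by simp
            ultimately show ?thesis unfolding m_def[abs_def] m1_def by (intro has_dir_deriv_lincomb)
          qed
          have "has_dir_deriv (\<lambda>z. - H ((\<lambda>_. 0)((i, 0) := 1)) z) (H ((\<lambda>_. 0)((i, 0) := 2)) z1) (i, 0) z1"
            using DERIV_minus[OF dH[OF bi, of "(\<lambda>_. 0)((i, 0) := 1)" z1, unfolded has_dir_deriv_def]]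
            by (simp add: has_dir_deriv_def numeral_2_eq_2)
          then have d2: "has_dir_deriv m1 (H ((\<lambda>_. 0)((i, 0) := 2)) z1 / c - D2 i z1) (i, 0) z1"
            unfolding m1_def[abs_def] using Dv(4)[OF z1\<Omega> i] unfolding z1'
            by (rule has_dir_deriv_lincomb)
          show ?thesis
          proof (rule second_deriv_nonpos_at_max)
            have "\<forall>\<^sub>F s in nhds 0. z1 + s *\<^sub>R (i, 0) \<in> \<Omega>"
              using eventually_line[OF \<Omega>(1)] z1\<Omega> z1' by blast
            then show "\<forall>\<^sub>F s in nhds 0. ((\<lambda>s. m (z1 + s *\<^sub>R (i, 0))) has_real_derivative m1 (z1 + s *\<^sub>R (i, 0))) (at s)"
              by eventually_elim (intro has_dir_deriv_line d1)
            show "((\<lambda>s. m1 (z1 + s *\<^sub>R (i, 0))) has_real_derivative H ((\<lambda>_. 0)((i, 0) := 2)) z1 / c - D2 i z1) (at 0)"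
              using d2 by (simp add: has_dir_deriv_def)
            have "\<forall>\<^sub>F s in nhds 0. x1 + s *\<^sub>R i \<in> box (a + (3 * \<epsilon>) *\<^sub>R One) (b - (3 * \<epsilon>) *\<^sub>R One)"
              by (rule eventually_line[OF open_box x1b])
            then show "\<forall>\<^sub>F s in nhds 0. m (z1 + s *\<^sub>R (i, 0)) \<le> m (z1 + 0 *\<^sub>R (i, 0))"
            proof eventually_elim
              case (elim s)
              then have "z1 + s *\<^sub>R (i, 0) \<in> C'"
                using z1C box_subset_cbox by (fastforce simp: C'_def z1')
              then show ?case using z1(2) by (simp add: zero_prod_def[symmetric])
            qed
          qed
        qed
        \<comment> \<open>By the heat equations for \<open>H\<close> and \<open>v\<close>, the
          second derivative tests bound the time derivative of \<open>m\<close> at \<open>z1\<close>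
          by \<open>- \<kappa>\<close>, against \<open>sp\<close>.\<close>
        have "(\<Sum>i\<in>Basis. H ((\<lambda>_. 0)((i, 0) := 2)) z1 / c) \<le> (\<Sum>i\<in>Basis. D2 i z1)"
          using xp by (intro sum_mono) simp
        also have "\<dots> = Dt z1" using Dv(2)[OF z1\<Omega>] z1' by simp
        finally have "(\<Sum>i\<in>Basis. H ((\<lambda>_. 0)((i, 0) := 2)) z1) / c \<le> Dt z1"
          by (simp add: sum_divide_distrib)
        moreover have "(\<Sum>i\<in>Basis. H ((\<lambda>_. 0)((i, 0) := 2)) z1) = - H ((\<lambda>_. 0)((0, 1) := 1)) z1"
          using heat by linarith
        ultimately have False using sp \<kappa>(1) by simp
        then show ?thesis ..
      qed
    qed
    then have "m zs \<le> 2 * \<delta>" using z1(2)[OF zsC'] by linarith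
    moreover have "\<kappa> * (ts - t1) \<le> \<kappa> * (t2 - t1)" using \<kappa>(1) zs' by (intro mult_left_mono) auto
    ultimately show "h zs \<le> v zs + 4 * \<delta>"
      using close[OF zsC'] \<kappa>(2) by (auto simp: m_def zs' abs_le_iff)
  qed
  show ?thesis
  proof (rule field_le_epsilon)
    fix e :: real assume "e > 0"
    then show "h zs \<le> v zs + e" using main[of "e / 4"] by simp
  qed
qed

lemma heat_classical_superparabolic:
  fixes v :: "'a::euclidean_space \<times> real \<Rightarrow> real"
  assumes "open \<Theta>" "heat_classical \<Theta> v"
  shows "superparabolic 2 \<Theta> (\<lambda>z. ereal (v z))"
proof -
  have cv: "continuous_on \<Theta> v" using assms(2) by (simp add: heat_classical_def)
  have "openin (top_of_set \<Theta>) {z \<in> \<Theta>. c < ereal (v z)}" for c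
  proof -
    have "continuous_on \<Theta> (\<lambda>z. ereal (v z))" by (intro continuous_intros cv)
    then have "openin (top_of_set \<Theta>) (\<Theta> \<inter> (\<lambda>z. ereal (v z)) -` {c<..})"
      by (simp add: continuous_openin_preimage_gen)
    moreover have "\<Theta> \<inter> (\<lambda>z. ereal (v z)) -` {c<..} = {z \<in> \<Theta>. c < ereal (v z)}" by auto
    ultimately show ?thesis by simp
  qed
  moreover have "ereal (h z) \<le> ereal (v z)"
    if "box a b \<noteq> {}" "t1 < t2" "compactly_contained (box a b \<times> {t1<..<t2}) \<Theta>"
      "parabolic 2 (box a b \<times> {t1<..<t2}) h" "continuous_on (closure (box a b \<times> {t1<..<t2})) h"
      "\<forall>z \<in> closure (box a b) \<times> {t1} \<union> frontier (box a b) \<times> {t1<..t2}. ereal (h z) \<le> ereal (v z)"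
      "z \<in> box a b \<times> {t1<..<t2}" for a b t1 t2 h z
  proof -
    have cl: "closure (box a b \<times> {t1<..<t2}) = cbox a b \<times> {t1..t2}"
      using that(1,2) by (simp add: closure_Times closure_box)
    have "h z \<le> v z"
    proof (rule parabolic_le_classical[OF that(4) _ assms(1) _ assms(2) _ that(7)])
      show "cbox a b \<times> {t1..t2} \<subseteq> \<Theta>" using that(3) by (simp add: compactly_contained_def cl)
      show "continuous_on (cbox a b \<times> {t1..t2}) h" using that(5) by (simp add: cl)
      show "h w \<le> v w" if w: "w \<in> cbox a b \<times> {t1} \<union> frontier (box a b) \<times> {t1<..t2}" for w
        using bspec[OF \<open>\<forall>z \<in> closure (box a b) \<times> {t1} \<union> frontier (box a b) \<times> {t1<..t2}. ereal (h z) \<le> ereal (v z)\<close>, of w] w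
          \<open>box a b \<noteq> {}\<close> by (simp add: closure_box)
    qed
    then show ?thesis by simp
  qed
  moreover have "\<Theta> \<subseteq> closure {z \<in> \<Theta>. ereal (v z) \<noteq> \<infinity>}"
    using closure_subset[of \<Theta>] by simp
  ultimately show ?thesis
    unfolding superparabolic_def lower_semicontinuous_on_def by (intro conjI) (simp, blast+)
qed

section \<open>Comparison of superparabolic functions with classical solutions\<close>

lemma has_dir_deriv_add:
  assumes "has_dir_deriv f d b z" "has_dir_deriv g e b z"
  shows "has_dir_deriv (\<lambda>x. f x + g x) (d + e) b z"
  using DERIV_add[OF assms[unfolded has_dir_deriv_def]] by (simp add: has_dir_deriv_def)

lemma has_dir_deriv_cmult:
  assumes "has_dir_deriv f d b z"
  shows "has_dir_deriv (\<lambda>x. c * f x) (c * d) b z"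
  using DERIV_cmult[OF assms[unfolded has_dir_deriv_def]] by (simp add: has_dir_deriv_def)

lemma heat_classical_add:
  assumes v: "heat_classical \<Omega> v" and w: "heat_classical \<Omega> w"
  shows "heat_classical \<Omega> (\<lambda>z. v z + w z)"
proof -
  obtain D1 D2 Dt where c: "continuous_on \<Omega> v" "continuous_on \<Omega> Dt"
    "\<And>i. i \<in> Basis \<Longrightarrow> continuous_on \<Omega> (D1 i)" "\<And>i. i \<in> Basis \<Longrightarrow> continuous_on \<Omega> (D2 i)"
    and D: "\<And>z. z \<in> \<Omega> \<Longrightarrow> has_dir_deriv v (Dt z) (0, 1) z"
    "\<And>z. z \<in> \<Omega> \<Longrightarrow> Dt z = (\<Sum>i\<in>Basis. D2 i z)"
    "\<And>z i. z \<in> \<Omega> \<Longrightarrow> i \<in> Basis \<Longrightarrow> has_dir_deriv v (D1 i z) (i, 0) z"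
    "\<And>z i. z \<in> \<Omega> \<Longrightarrow> i \<in> Basis \<Longrightarrow> has_dir_deriv (D1 i) (D2 i z) (i, 0) z"
    by (rule heat_classicalE[OF v]) (rule that)
  obtain E1 E2 Et where c': "continuous_on \<Omega> w" "continuous_on \<Omega> Et"
    "\<And>i. i \<in> Basis \<Longrightarrow> continuous_on \<Omega> (E1 i)" "\<And>i. i \<in> Basis \<Longrightarrow> continuous_on \<Omega> (E2 i)"
    and E: "\<And>z. z \<in> \<Omega> \<Longrightarrow> has_dir_deriv w (Et z) (0, 1) z"
    "\<And>z. z \<in> \<Omega> \<Longrightarrow> Et z = (\<Sum>i\<in>Basis. E2 i z)"
    "\<And>z i. z \<in> \<Omega> \<Longrightarrow> i \<in> Basis \<Longrightarrow> has_dir_deriv w (E1 i z) (i, 0) z"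
    "\<And>z i. z \<in> \<Omega> \<Longrightarrow> i \<in> Basis \<Longrightarrow> has_dir_deriv (E1 i) (E2 i z) (i, 0) z"
    by (rule heat_classicalE[OF w]) (rule that)
  show ?thesis
  proof (rule heat_classicalI[of _ _ "\<lambda>z. Dt z + Et z" "\<lambda>i z. D1 i z + E1 i z" "\<lambda>i z. D2 i z + E2 i z"])
    show "Dt z + Et z = (\<Sum>i\<in>Basis. D2 i z + E2 i z)" if "z \<in> \<Omega>" for z
      using D(2) E(2) that by (simp add: sum.distrib)
  qed (auto intro!: continuous_intros has_dir_deriv_add c c' D(1,3,4) E(1,3,4))
qed

lemma heat_classical_cmult:
  assumes v: "heat_classical \<Omega> v"
  shows "heat_classical \<Omega> (\<lambda>z. k * v z)"
proof -
  obtain D1 D2 Dt where c: "continuous_on \<Omega> v" "continuous_on \<Omega> Dt"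
    "\<And>i. i \<in> Basis \<Longrightarrow> continuous_on \<Omega> (D1 i)" "\<And>i. i \<in> Basis \<Longrightarrow> continuous_on \<Omega> (D2 i)"
    and D: "\<And>z. z \<in> \<Omega> \<Longrightarrow> has_dir_deriv v (Dt z) (0, 1) z"
    "\<And>z. z \<in> \<Omega> \<Longrightarrow> Dt z = (\<Sum>i\<in>Basis. D2 i z)"
    "\<And>z i. z \<in> \<Omega> \<Longrightarrow> i \<in> Basis \<Longrightarrow> has_dir_deriv v (D1 i z) (i, 0) z"
    "\<And>z i. z \<in> \<Omega> \<Longrightarrow> i \<in> Basis \<Longrightarrow> has_dir_deriv (D1 i) (D2 i z) (i, 0) z"
    by (rule heat_classicalE[OF v]) (rule that)
  show ?thesis
  proof (rule heat_classicalI[of _ _ "\<lambda>z. k * Dt z" "\<lambda>i z. k * D1 i z" "\<lambda>i z. k * D2 i z"])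
    show "k * Dt z = (\<Sum>i\<in>Basis. k * D2 i z)" if "z \<in> \<Omega>" for z
      using D(2) that by (simp add: sum_distrib_left)
  qed (auto intro!: continuous_intros has_dir_deriv_cmult c D(1,3,4))
qed

lemma heat_classical_const: "heat_classical \<Omega> (\<lambda>_. k)"
  by (rule heat_classicalI[of _ _ "\<lambda>_. 0" "\<lambda>_ _. 0" "\<lambda>_ _. 0"]) (auto intro: has_dir_deriv_const)

text \<open>Subtracted with a small factor, this polynomial bends a touching solution down on the
  sides of a small box without spoiling the equation.\<close>

lemma heat_classical_polynomial:
  fixes x0 :: "'a::euclidean_space"
  shows "heat_classical \<Omega> (\<lambda>z. (norm (fst z - x0))\<^sup>2 + 2 * DIM('a) * (snd z - t0))"
proof (rule heat_classicalI[of _ _ "\<lambda>_. 2 * DIM('a)" "\<lambda>i z. 2 * ((fst z - x0) \<bullet> i)" "\<lambda>_ _. 2"])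
  show "has_dir_deriv (\<lambda>z. (norm (fst z - x0))\<^sup>2 + 2 * DIM('a) * (snd z - t0)) (2 * DIM('a)) (0, 1) z" for z :: "'a \<times> real"
    unfolding has_dir_deriv_def by (auto intro!: derivative_eq_intros)
  fix z :: "'a \<times> real" and i :: 'a
  assume i: "i \<in> Basis"
  have "(norm (fst z + s *\<^sub>R i - x0))\<^sup>2 = (norm (fst z - x0))\<^sup>2 + 2 * ((fst z - x0) \<bullet> i) * s + s\<^sup>2" for s
    using i unfolding power2_norm_eq_inner
    by (simp add: inner_simps power2_eq_square algebra_simps inner_commute)
  then show "has_dir_deriv (\<lambda>z. (norm (fst z - x0))\<^sup>2 + 2 * DIM('a) * (snd z - t0)) (2 * ((fst z - x0) \<bullet> i)) (i, 0) z"
    unfolding has_dir_deriv_def by (auto intro!: derivative_eq_intros)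
  show "has_dir_deriv (\<lambda>z. 2 * ((fst z - x0) \<bullet> i)) 2 (i, 0) z"
    using i unfolding has_dir_deriv_def by (auto intro!: derivative_eq_intros simp: inner_simps)
qed (auto intro!: continuous_intros)

lemma lower_semicontinuous_onD:
  assumes "lower_semicontinuous_on S u" "open S" "z \<in> S" "c < u z"
  shows "\<forall>\<^sub>F w in nhds z. w \<in> S \<and> c < u w"
proof -
  have "open {z \<in> S. c < u z}"
    using assms(1,2) by (auto simp: lower_semicontinuous_on_def openin_open_eq)
  then show ?thesis
    using eventually_nhds_in_open[of "{z \<in> S. c < u z}" z] assms by auto
qed

text \<open>Compactness argument behind the existence of a minimum: at every point of \<open>closure A\<close> some
  value of \<open>M\<close> is strictly undercut nearby, unless a minimum exists.\<close>

lemma attains_inf_by_barrier: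
  fixes M :: "'a::topological_space \<Rightarrow> ereal"
  assumes K: "compact K" "A \<subseteq> K" and zs: "zs \<in> A"
    and lsc: "\<And>\<xi> c. \<xi> \<in> A \<Longrightarrow> c < M \<xi> \<Longrightarrow> \<forall>\<^sub>F z in nhds \<xi>. z \<in> A \<longrightarrow> c < M z"
    and bd: "\<And>\<xi>. \<xi> \<in> K - A \<Longrightarrow> \<forall>\<^sub>F z in nhds \<xi>. z \<in> A \<longrightarrow> M zs < M z"
  shows "\<exists>z0\<in>A. \<forall>z\<in>A. M z0 \<le> M z"
proof (rule ccontr)
  assume no: "\<not> ?thesis"
  have "\<exists>N z'. open N \<and> \<xi> \<in> N \<and> z' \<in> A \<and> (\<forall>z\<in>N. z \<in> A \<longrightarrow> M z' < M z)" if "\<xi> \<in> K" for \<xi>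
  proof (cases "\<xi> \<in> A")
    case True
    then obtain z' where "z' \<in> A" "M z' < M \<xi>" using no by (auto simp: not_le)
    then show ?thesis using lsc[OF True, of "M z'"] unfolding eventually_nhds by blast
  next
    case False
    then show ?thesis using bd[of \<xi>] that zs unfolding eventually_nhds by blast
  qed
  then obtain N z' where N: "\<And>\<xi>. \<xi> \<in> K \<Longrightarrow> open (N \<xi>)" "\<And>\<xi>. \<xi> \<in> K \<Longrightarrow> \<xi> \<in> N \<xi>"
    "\<And>\<xi>. \<xi> \<in> K \<Longrightarrow> z' \<xi> \<in> A" "\<And>\<xi> z. \<xi> \<in> K \<Longrightarrow> z \<in> N \<xi> \<Longrightarrow> z \<in> A \<Longrightarrow> M (z' \<xi>) < M z"
    by metis
  \<comment> \<open>Among the finitely many undercutting values that belong to a subcover, the least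
    one would itself be undercut.\<close>
  obtain F where F: "F \<subseteq> K" "finite F" "K \<subseteq> (\<Union>\<xi>\<in>F. N \<xi>)"
    by (rule compactE_image[OF K(1), of K N]) (use N(1,2) in auto)
  have "F \<noteq> {}" using F zs K(2) by auto
  then have "Min ((M \<circ> z') ` F) \<in> (M \<circ> z') ` F" using F(2) by (intro Min_in) auto
  then obtain \<xi> where \<xi>: "\<xi> \<in> F" "Min ((M \<circ> z') ` F) = M (z' \<xi>)" by auto
  then have z: "z' \<xi> \<in> A" using N(3) F(1) by auto
  then obtain \<zeta> where \<zeta>: "\<zeta> \<in> F" "z' \<xi> \<in> N \<zeta>" using F(3) K(2) by blast
  then have "M (z' \<zeta>) < M (z' \<xi>)" using N(4) z F(1) by blast
  moreover have "M (z' \<xi>) \<le> M (z' \<zeta>)"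
    unfolding \<xi>(2)[symmetric] using \<zeta>(1) F(2) by (intro Min_le) auto
  ultimately show False by simp
qed

text \<open>Before \<open>t0\<close> the function \<open>u\<close> lies above the shifted solution
  \<open>v + (U0 - v (x0, t0))\<close> by at least \<kappa> times the elapsed time. This room allows
  the shifted solution to be raised by a constant \<open>c\<close> and bent down by the caloric
  polynomial while staying below \<open>u\<close> on the parabolic boundary of a small box.
  Superparabolicity then puts \<open>u (x0, t0)\<close> above \<open>U0 + c\<close>.\<close>

lemma touching_contradiction:
  fixes v :: "'a::euclidean_space \<times> real \<Rightarrow> real" and u :: "'a \<times> real \<Rightarrow> ereal"
  assumes \<Theta>: "open \<Theta>" and u: "superparabolic 2 \<Theta> u" and v: "heat_classical \<Theta> v"
    and A: "open A" "A \<subseteq> \<Theta>" and z0: "(x0, t0) \<in> A" and \<kappa>: "\<kappa> > 0"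
    and U0: "u (x0, t0) = ereal U0"
    and touch: "\<And>x s. (x, t0 + s) \<in> A \<Longrightarrow> ereal (v (x, t0 + s) + (U0 - v (x0, t0)) - P s) \<le> u (x, t0 + s)"
    and P: "\<And>s. s \<le> 0 \<Longrightarrow> P s \<le> \<kappa> * s" "P 0 = 0" "isCont P 0"
  shows False
proof -
  define n where "n = real (DIM('a))"
  have n: "n \<ge> 1" by (simp add: n_def)
  define \<eta> where "\<eta> = \<kappa> / (4 * n)"
  have \<eta>: "\<eta> > 0" "2 * n * \<eta> = \<kappa> / 2" using \<kappa> n by (auto simp: \<eta>_def)
  obtain e where e: "e > 0" "ball (x0, t0) e \<subseteq> A" using A(1) z0 open_contains_ball by blast
  define r where "r = e / (2 * (n + 1))"
  have r: "r > 0" using e n by (simp add: r_def)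
  have inA: "(x, t) \<in> A" if x: "x \<in> cbox (x0 - r *\<^sub>R One) (x0 + r *\<^sub>R One)" and t: "\<bar>t - t0\<bar> \<le> r" for x t
  proof -
    have "norm (x - x0) \<le> (\<Sum>i\<in>Basis. \<bar>(x - x0) \<bullet> i\<bar>)" by (rule norm_le_l1)
    also have "\<dots> \<le> (\<Sum>i\<in>(Basis::'a set). r)"
      using x unfolding cbox_around_iff by (intro sum_mono) auto
    finally have "dist x0 x \<le> n * r" by (simp add: n_def dist_norm norm_minus_commute)
    moreover have "dist (x0, t0) (x, t) \<le> dist x0 x + dist t0 t"
      unfolding dist_Pair_Pair by (rule sqrt_sum_squares_le_sum) auto
    ultimately have "dist (x0, t0) (x, t) \<le> (n + 1) * r"
      using t by (simp add: dist_real_def algebra_simps abs_minus_commute)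
    also have "\<dots> = e / 2" using n by (simp add: r_def divide_simps)
    finally show ?thesis using e by (auto simp: subset_iff)
  qed
  \<comment> \<open>On the sides the polynomial gains at least \<open>\<eta> * r\<^sup>2\<close>;
    one half absorbs \<open>P\<close> shortly after \<open>t0\<close>, the other half absorbs
    \<open>c\<close>.\<close>
  obtain d where d: "d > 0" "\<And>s. \<bar>s\<bar> < d \<Longrightarrow> \<bar>P s\<bar> < \<eta> * r\<^sup>2 / 2"
    using P(3)[unfolded continuous_at_eps_delta, rule_format, of "\<eta> * r\<^sup>2 / 2"] \<eta> r P(2)
    by (auto simp: dist_real_def)
  \<comment> \<open>The box must extend beyond \<open>t0\<close>, since the comparison in
    \<open>superparabolic\<close> reaches only the open box.\<close>
  define \<sigma> where "\<sigma> = min r (d / 2)"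
  have \<sigma>: "\<sigma> > 0" "\<sigma> \<le> r" "\<sigma> < d" using r d by (auto simp: \<sigma>_def)
  define c where "c = min (\<kappa> * r / 2) (\<eta> * r\<^sup>2 / 2)"
  have c: "c > 0" "c \<le> \<kappa> * r / 2" "c \<le> \<eta> * r\<^sup>2 / 2" using \<kappa> \<eta> r by (auto simp: c_def)
  define h where "h z = (v z + (U0 - v (x0, t0) + c)) + (- \<eta>) * ((norm (fst z - x0))\<^sup>2 + 2 * DIM('a) * (snd z - t0))" for z
  have h_eq: "h (x, t0 + s) = v (x, t0 + s) + (U0 - v (x0, t0)) + (c - \<eta> * (norm (x - x0))\<^sup>2 - \<kappa> / 2 * s)" for x s
  proof -
    have "\<eta> * (2 * DIM('a) * s) = (2 * n * \<eta>) * s" by (simp add: n_def)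
    then show ?thesis unfolding h_def by (simp add: \<eta>(2) distrib_left)
  qed
  have hc: "heat_classical \<Theta> h"
    unfolding h_def
    by (intro heat_classical_add heat_classical_cmult heat_classical_const heat_classical_polynomial v)
  let ?B = "box (x0 - r *\<^sub>R One) (x0 + r *\<^sub>R One)" and ?C = "cbox (x0 - r *\<^sub>R One) (x0 + r *\<^sub>R One)"
  let ?Q = "?B \<times> {t0 - r<..<t0 + \<sigma>}"
  have x0B: "x0 \<in> ?B" using r unfolding cbox_around_iff by simp
  have clB: "closure ?B = ?C" using x0B by (intro closure_box) auto
  have clQ: "closure ?Q = ?C \<times> {t0 - r..t0 + \<sigma>}"
    using r \<sigma> by (simp add: closure_Times clB)
  have sub: "closure ?Q \<subseteq> \<Theta>"
  proof
    fix z assume z: "z \<in> closure ?Q"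
    obtain x t where xt: "z = (x, t)" by (cases z)
    have "x \<in> ?C" "\<bar>t - t0\<bar> \<le> r" using z \<sigma> unfolding clQ xt by auto
    then show "z \<in> \<Theta>" using inA A(2) xt by blast
  qed
  have cc: "compactly_contained ?Q \<Theta>"
    using sub unfolding compactly_contained_def clQ by (auto intro: compact_Times)
  have Q\<Theta>: "?Q \<subseteq> \<Theta>" by (rule subset_trans[OF closure_subset sub])
  have par: "parabolic 2 ?Q h"
    by (rule heat_classical_imp_parabolic[OF heat_classical_subset[OF hc Q\<Theta>]])
  have ch: "continuous_on (closure ?Q) h"
  proof -
    have "continuous_on \<Theta> h" using hc by (simp add: heat_classical_def)
    then show ?thesis using sub by (rule continuous_on_subset)
  qed
  have bd: "ereal (h z) \<le> u z" if z: "z \<in> closure ?B \<times> {t0 - r} \<union> frontier ?B \<times> {t0 - r<..t0 + \<sigma>}" for z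
  proof -
    define x s where "x = fst z" and "s = snd z - t0"
    have zx: "z = (x, t0 + s)" by (simp add: x_def s_def)
    have xC: "x \<in> ?C" using z x0B by (auto simp: zx clB frontier_box split: if_splits)
    have s: "- r \<le> s" "s \<le> \<sigma>" using z r \<sigma> by (auto simp: zx)
    have zA: "(x, t0 + s) \<in> A" using s \<sigma> by (intro inA xC) auto
    have "c - \<eta> * (norm (x - x0))\<^sup>2 - \<kappa> / 2 * s \<le> - P s"
    proof (cases "s = - r")
      case True
      have "\<eta> * (norm (x - x0))\<^sup>2 \<ge> 0" using \<eta> by simp
      moreover have "P s \<le> \<kappa> * s" using True r by (intro P) auto
      ultimately show ?thesis using c(2) True by (simp add: field_simps)
    next
      case False
      then have "x \<notin> ?B" using z x0B by (auto simp: zx frontier_box split: if_splits)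
      then obtain i where i: "i \<in> Basis" "\<bar>(x - x0) \<bullet> i\<bar> \<ge> r" unfolding cbox_around_iff by force
      then have "norm (x - x0) \<ge> r" using Basis_le_norm[OF i(1), of "x - x0"] by linarith
      then have "\<eta> * (norm (x - x0))\<^sup>2 \<ge> \<eta> * r\<^sup>2" using \<eta> r by (intro mult_left_mono power_mono) auto
      moreover have "- \<kappa> / 2 * s \<le> \<eta> * r\<^sup>2 / 2 - P s"
      proof (cases "s \<le> 0")
        case True
        then have "P s \<le> \<kappa> * s" by (rule P)
        moreover have "\<kappa> * s \<le> 0" using \<kappa> True by (simp add: mult_le_0_iff)
        moreover have "\<eta> * r\<^sup>2 \<ge> 0" using \<eta> by simp
        ultimately show ?thesis by (simp add: field_simps)
      next
        case False
        then have "\<kappa> * s \<ge> 0" using \<kappa> by simp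
        then show ?thesis using d(2)[of s] False s \<sigma> by simp
      qed
      ultimately show ?thesis using c(3) by simp
    qed
    then have "h (x, t0 + s) \<le> v (x, t0 + s) + (U0 - v (x0, t0)) - P s" unfolding h_eq by simp
    then have "ereal (h (x, t0 + s)) \<le> ereal (v (x, t0 + s) + (U0 - v (x0, t0)) - P s)" by simp
    also note touch[OF zA]
    finally show ?thesis unfolding zx .
  qed
  have "ereal (h z) \<le> u z" if "z \<in> ?Q" for z
  proof -
    have "?B \<noteq> {}" "t0 - r < t0 + \<sigma>" using x0B r \<sigma> by auto
    then show ?thesis
      using u cc par ch bd that unfolding superparabolic_def by blast
  qed
  moreover have "(x0, t0) \<in> ?Q" using x0B r \<sigma> by auto
  ultimately have "ereal (h (x0, t0)) \<le> u (x0, t0)" by blast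
  then show False using U0 c(1) h_eq[of x0 0] by simp
qed

text \<open>If \<open>u\<close> fell below \<open>v\<close> at \<open>zs\<close>, the penalized
  difference \<open>M\<close> would have a minimum in \<open>A\<close>. The term
  \<open>\<omega> / (T1 - t)\<close> of \<open>p\<close> keeps it away from the time level
  \<open>T1\<close>, so boundary points after \<open>T1\<close> never enter; the linear term
  provides the strict gain that \<open>touching_contradiction\<close> turns into a contradiction.
  The boundary hypothesis is stated jointly for \<open>u\<close> and \<open>v\<close>, as neither
  needs to have a limit at the boundary.\<close>

lemma superparabolic_ge_classical:
  fixes v :: "'a::euclidean_space \<times> real \<Rightarrow> real" and u :: "'a \<times> real \<Rightarrow> ereal"
  assumes \<Theta>: "open \<Theta>" "bounded \<Theta>" and u: "superparabolic 2 \<Theta> u" and v: "heat_classical \<Theta> v"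
    and bd: "\<And>\<xi> e. \<xi> \<in> frontier \<Theta> \<Longrightarrow> snd \<xi> < T \<Longrightarrow> e > 0 \<Longrightarrow>
       \<forall>\<^sub>F z in at \<xi> within \<Theta>. ereal (v z - e) \<le> u z"
    and zs: "zs \<in> \<Theta>" "snd zs < T"
  shows "ereal (v zs) \<le> u zs"
proof (rule ccontr)
  assume "\<not> ?thesis"
  then have less: "u zs < ereal (v zs)" by simp
  have lsc: "lower_semicontinuous_on \<Theta> u" and ninf: "\<And>z. z \<in> \<Theta> \<Longrightarrow> u z \<noteq> -\<infinity>"
    using u by (auto simp: superparabolic_def)
  obtain Us where Us: "u zs = ereal Us" using less ninf[OF zs(1)] by (cases "u zs") auto
  define g where "g = (v zs - Us) / 2"
  have g: "g > 0" "v zs - Us = 2 * g" using less Us by (auto simp: g_def)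
  have cv: "continuous_on \<Theta> v" using v by (simp add: heat_classical_def)
  \<comment> \<open>Strictly before \<open>T\<close>, so that frontier points on the level
    \<open>T1\<close> itself still satisfy the boundary hypothesis.\<close>
  define T1 where "T1 = (snd zs + T) / 2"
  have T1: "snd zs < T1" "T1 < T" using zs by (auto simp: T1_def)
  obtain R0 where R0: "\<And>z. z \<in> \<Theta> \<Longrightarrow> norm z \<le> R0" using \<Theta>(2) by (auto simp: bounded_iff)
  define R where "R = max R0 0 + 1"
  have R: "snd z + R > 0" if "z \<in> \<Theta>" for z
    using R0[OF that] norm_snd_le[of "snd z" "fst z"] by (auto simp: R_def)
  \<comment> \<open>\<kappa> and \<omega> make each term of \<open>p\<close> equal to
    \<open>g / 3\<close> at \<open>zs\<close>, hence
    \<open>M zs = - 2 * g + 2 * g / 3 < - g\<close>.\<close>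
  define \<kappa> where "\<kappa> = g / (3 * (snd zs + R))"
  define \<omega> where "\<omega> = g * (T1 - snd zs) / 3"
  have \<kappa>: "\<kappa> > 0" using g R[OF zs(1)] by (simp add: \<kappa>_def)
  have \<omega>: "\<omega> > 0" using g T1 by (simp add: \<omega>_def)
  define p where "p t = \<kappa> * (t + R) + \<omega> / (T1 - t)" for t
  have ps: "p (snd zs) < g"
  proof -
    have "\<kappa> * (snd zs + R) = g / 3" using R[OF zs(1)] by (simp add: \<kappa>_def divide_simps)
    moreover have "\<omega> / (T1 - snd zs) = g / 3" using T1 by (simp add: \<omega>_def del: right_diff_distrib_numeral)
    ultimately show ?thesis using g by (simp add: p_def)
  qed
  have ppos: "p (snd z) > 0" if "z \<in> \<Theta>" "snd z < T1" for z
    using R[OF that(1)] that \<kappa> \<omega> by (auto simp: p_def intro!: add_pos_pos)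
  define A where "A = \<Theta> \<inter> {z. snd z < T1}"
  have opA: "open A" unfolding A_def by (intro open_Int \<Theta> open_Collect_less continuous_intros)
  have A\<Theta>: "A \<subseteq> \<Theta>" by (auto simp: A_def)
  have zsA: "zs \<in> A" using zs T1 by (simp add: A_def)
  define M where "M z = u z + ereal (p (snd z) - v z)" for z
  have Ms: "M zs < ereal (- g)" using g ps by (simp add: M_def Us)
  have cpA: "continuous_on A (\<lambda>z. p (snd z) - v z)"
    unfolding p_def using continuous_on_subset[OF cv A\<Theta>]
    by (auto intro!: continuous_intros simp: A_def)
  have "\<exists>z0\<in>A. \<forall>z\<in>A. M z0 \<le> M z"
  proof (rule attains_inf_by_barrier[OF _ closure_subset zsA])
    show "compact (closure A)" using bounded_subset[OF \<Theta>(2) A\<Theta>] by (simp add: compact_closure)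
    show "\<forall>\<^sub>F z in nhds \<xi>. z \<in> A \<longrightarrow> c < M z" if \<xi>: "\<xi> \<in> A" and c: "c < M \<xi>" for \<xi> c
    proof (cases c)
      case (real c')
      have "ereal (c' - (p (snd \<xi>) - v \<xi>)) < u \<xi>"
        using c unfolding M_def real by (cases "u \<xi>") auto
      then obtain b where "ereal (c' - (p (snd \<xi>) - v \<xi>)) < b" "b < u \<xi>" using dense by blast
      then obtain b' where b: "c' - (p (snd \<xi>) - v \<xi>) < b'" "ereal b' < u \<xi>" by (cases b) auto
      have "\<forall>\<^sub>F z in nhds \<xi>. z \<in> \<Theta> \<and> ereal b' < u z"
        by (rule lower_semicontinuous_onD[OF lsc \<Theta>(1) _ b(2)]) (use \<xi> A\<Theta> in auto)
      moreover have "\<forall>\<^sub>F z in nhds \<xi>. p (snd z) - v z > c' - b'"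
      proof -
        have "isCont (\<lambda>z. p (snd z) - v z) \<xi>" using cpA opA \<xi> continuous_on_eq_continuous_at by blast
        then have "((\<lambda>z. p (snd z) - v z) \<longlongrightarrow> p (snd \<xi>) - v \<xi>) (nhds \<xi>)"
          using tendsto_at_iff_tendsto_nhds[of "\<lambda>z. p (snd z) - v z" \<xi>] by (simp add: continuous_at)
        then show ?thesis by (rule order_tendstoD) (use b in auto)
      qed
      ultimately show ?thesis
      proof eventually_elim
        case (elim z)
        then show ?case unfolding M_def real by (cases "u z") auto
      qed
    next
      case PInf
      then show ?thesis using c by simp
    next
      case MInf
      have "M z \<noteq> -\<infinity>" if "z \<in> A" for z
        using ninf[of z] that A\<Theta> unfolding M_def by (cases "u z") auto
      then have "c < M z" if "z \<in> A" for z using that MInf by (cases "M z") auto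
      then show ?thesis by (intro always_eventually) blast
    qed
    show "\<forall>\<^sub>F z in nhds \<xi>. z \<in> A \<longrightarrow> M zs < M z" if \<xi>: "\<xi> \<in> closure A - A" for \<xi>
    proof -
      have sT: "snd \<xi> \<le> T1"
      proof -
        have "closure A \<subseteq> {z. snd z \<le> T1}"
          by (rule closure_minimal) (auto simp: A_def intro!: closed_Collect_le continuous_intros)
        then show ?thesis using \<xi> by auto
      qed
      \<comment> \<open>As \<open>p\<close> is positive, an error of \<open>g\<close> in the
        boundary inequality still leaves \<open>M\<close> above its value at
        \<open>zs\<close>.\<close>
      have key: "M zs < M z" if "ereal (v z - g) \<le> u z" "z \<in> A" for z
      proof -
        have "ereal (- g) \<le> M z"
          using that ppos[of z] unfolding M_def A_def by (cases "u z") auto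
        then show ?thesis using Ms by simp
      qed
      show ?thesis
      proof (cases "\<xi> \<in> \<Theta>")
        case False
        then have "\<xi> \<in> frontier \<Theta>"
          using \<xi> closure_mono[OF A\<Theta>] \<Theta>(1) by (auto simp: frontier_def interior_open)
        then have "\<forall>\<^sub>F z in at \<xi> within \<Theta>. ereal (v z - g) \<le> u z"
          using bd[of \<xi> g] sT T1 g by auto
        then have "\<forall>\<^sub>F z in nhds \<xi>. z \<noteq> \<xi> \<longrightarrow> z \<in> \<Theta> \<longrightarrow> ereal (v z - g) \<le> u z"
          by (simp add: eventually_at_filter)
        then show ?thesis
        proof eventually_elim
          case (elim z)
          show ?case using key[of z] elim A\<Theta> \<xi> by auto
        qed
      next
        case True
        then have s\<xi>: "snd \<xi> = T1" using \<xi> sT by (auto simp: A_def)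
        \<comment> \<open>Near a point of \<Theta> at level \<open>T1\<close>, semicontinuity bounds
          \<open>u\<close> below by \<open>b\<close> and continuity bounds \<open>v\<close> above by
          \<open>v \<xi> + 1\<close>, while the singular term of \<open>p\<close> outgrows the
          difference.\<close>
        obtain b where b: "ereal b < u \<xi>" using ninf[OF True] lt_ex by (cases "u \<xi>") auto
        have "\<forall>\<^sub>F z in nhds \<xi>. z \<in> \<Theta> \<and> ereal b < u z"
          by (rule lower_semicontinuous_onD[OF lsc \<Theta>(1) True b])
        moreover have "\<forall>\<^sub>F z in nhds \<xi>. v z < v \<xi> + 1"
        proof -
          have "isCont v \<xi>" using cv \<Theta>(1) True continuous_on_eq_continuous_at by blast
          then have "(v \<longlongrightarrow> v \<xi>) (nhds \<xi>)"
            using tendsto_at_iff_tendsto_nhds[of v \<xi>] by (simp add: continuous_at)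
          then show ?thesis by (rule order_tendstoD) simp
        qed
        moreover have "\<forall>\<^sub>F z in nhds \<xi>. snd z > T1 - \<omega> / (\<bar>v \<xi> + 1 - b\<bar> + 1)"
        proof -
          have "(snd \<longlongrightarrow> snd \<xi>) (nhds \<xi>)" by (intro tendsto_intros filterlim_ident)
          then show ?thesis
            by (rule order_tendstoD) (use \<omega> in \<open>simp add: s\<xi> divide_pos_pos add_nonneg_pos\<close>)
        qed
        ultimately show ?thesis
        proof eventually_elim
          case (elim z)
          have "v z - b \<le> p (snd z)" if "z \<in> A"
          proof -
            have "T1 - snd z > 0" using that by (simp add: A_def)
            moreover have "(T1 - snd z) * (\<bar>v \<xi> + 1 - b\<bar> + 1) < \<omega>"
              using elim by (simp add: field_simps add_nonneg_pos pos_divide_less_eq less_divide_eq)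
            ultimately have "\<omega> / (T1 - snd z) > \<bar>v \<xi> + 1 - b\<bar> + 1" by (simp add: field_simps)
            moreover have "\<kappa> * (snd z + R) > 0" using R[of z] \<kappa> elim by simp
            ultimately show ?thesis using elim unfolding p_def by linarith
          qed
          then have "z \<in> A \<longrightarrow> ereal 0 \<le> M z" using elim unfolding M_def by (cases "u z") auto
          moreover have "M zs < ereal 0" using less_trans[OF Ms, of "ereal 0"] g by simp
          ultimately show ?case by (blast intro: less_le_trans)
        qed
      qed
    qed
  qed
  then obtain x0 t0 where z0: "(x0, t0) \<in> A" "\<And>z. z \<in> A \<Longrightarrow> M (x0, t0) \<le> M z" by auto
  have "M (x0, t0) < ereal (- g)" using z0(2)[OF zsA] Ms by simp
  then obtain U0 where U0: "u (x0, t0) = ereal U0"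
    using ninf[of "(x0, t0)"] z0(1) A\<Theta> unfolding M_def by (cases "u (x0, t0)") auto
  define P where "P s = p (t0 + s) - p t0" for s
  have t0: "t0 < T1" using z0 by (simp add: A_def)
  show False
  proof (rule touching_contradiction[OF \<Theta>(1) u v opA A\<Theta> z0(1) \<kappa> U0])
    show "ereal (v (x, t0 + s) + (U0 - v (x0, t0)) - P s) \<le> u (x, t0 + s)" if "(x, t0 + s) \<in> A" for x s
      using z0(2)[OF that] unfolding M_def P_def U0 by (cases "u (x, t0 + s)") auto
    show "P s \<le> \<kappa> * s" if "s \<le> 0" for s
    proof -
      have "\<omega> / (T1 - (t0 + s)) \<le> \<omega> / (T1 - t0)"
        using that t0 \<omega> by (intro divide_left_mono mult_pos_pos) auto
      then show ?thesis by (simp add: P_def p_def algebra_simps)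
    qed
    show "P 0 = 0" by (simp add: P_def)
    show "isCont P 0" unfolding P_def p_def using t0 by (auto intro!: continuous_intros)
  qed
qed

section \<open>Heat potentials of measures on the time axis\<close>

text \<open>Up to a constant, \<open>gk (n / 2) (\<bar>x\<bar>\<^sup>2) s\<close> is the heat kernel at \<open>(x, s)\<close>.\<close>

definition gk :: "real \<Rightarrow> real \<Rightarrow> real \<Rightarrow> real" where
  "gk m q s = (if s > 0 then s powr (- m) * exp (- q / (4 * s)) else 0)"

lemma gk_nonneg: "gk m q s \<ge> 0"
  by (simp add: gk_def)

text \<open>A single term of the exponential series; it yields explicit constants for all Gaussian
  estimates below.\<close>

lemma power_le_fact_exp:
  fixes y :: real
  assumes "y \<ge> 0"
  shows "y ^ n \<le> fact n * exp y"
proof -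
  have "(\<Sum>k\<in>{n}. y ^ k /\<^sub>R fact k) \<le> (\<Sum>k. y ^ k /\<^sub>R fact k)"
    by (rule sum_le_suminf) (use assms summable_exp_generic[of y] in auto)
  then have "y ^ n / fact n \<le> exp y"
    by (simp add: exp_def divide_inverse mult.commute)
  then show ?thesis by (simp add: field_simps)
qed

text \<open>The exponential contributes the power \<open>N + 1\<close> of \<open>s\<close>, one more
  than the singular factor can take away, so a bound linear in \<open>s\<close> remains.\<close>

lemma gk_tendsto_0:
  assumes "q > 0"
  shows "(gk m q \<longlongrightarrow> 0) (at 0)"
proof -
  define N where "N = nat \<lceil>\<bar>m\<bar>\<rceil>"
  have N: "real N \<ge> m" unfolding N_def by linarith
  define c where "c = q / 4"
  have c: "c > 0" using assms by (simp add: c_def)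
  define K where "K = fact (N + 1) / c ^ (N + 1)"
  have bound: "norm (gk m q s) \<le> K * \<bar>s\<bar>" if s: "0 < s" "s < 1" for s
  proof -
    have "s powr (- m) \<le> s powr (- real N)"
      using s N by (intro powr_mono') auto
    also have "\<dots> = 1 / s ^ N" using s by (simp add: powr_minus powr_realpow divide_inverse)
    finally have 1: "s powr (- m) \<le> 1 / s ^ N" .
    have "(c / s) ^ (N + 1) \<le> fact (N + 1) * exp (c / s)"
      using c s by (intro power_le_fact_exp) auto
    then have "exp (- (c / s)) \<le> fact (N + 1) * (s / c) ^ (N + 1)"
      using c s by (simp add: exp_minus field_simps)
    then have "s powr (- m) * exp (- (c / s)) \<le> 1 / s ^ N * (fact (N + 1) * (s / c) ^ (N + 1))"
      using 1 s by (intro mult_mono) auto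
    also have "\<dots> = K * s" using s c by (simp add: K_def field_simps)
    finally show ?thesis using s by (simp add: gk_def c_def)
  qed
  have "((\<lambda>s. K * \<bar>s\<bar>) \<longlongrightarrow> 0) (at 0)"
    by (auto intro!: tendsto_eq_intros)
  moreover have "\<forall>\<^sub>F s in at 0. norm (gk m q s) \<le> K * \<bar>s\<bar>"
    unfolding eventually_at
  proof (intro exI[of _ 1] conjI ballI impI)
    fix s :: real assume "s \<noteq> 0 \<and> dist s 0 < 1"
    moreover have "K \<ge> 0" using c by (simp add: K_def)
    ultimately show "norm (gk m q s) \<le> K * \<bar>s\<bar>"
      using bound[of s] by (cases "s > 0") (auto simp: gk_def mult_nonneg_nonpos)
  qed simp
  ultimately show ?thesis by (rule Lim_null_comparison[rotated])
qed

lemma gk_antimono: "q \<le> q' \<Longrightarrow> gk m q' s \<le> gk m q s"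
  by (auto simp: gk_def intro!: mult_left_mono divide_right_mono)

text \<open>At \<open>s = 0\<close> the nearby values are dominated by those with
  \<open>q / 2\<close> in place of \<open>q\<close>, because the kernel decreases in
  \<open>q\<close>; the limit in one variable then suffices.\<close>

lemma continuous_gk_pair: "continuous_on ({0<..} \<times> UNIV) (\<lambda>(q, s). gk m q s)"
proof -
  have "isCont (\<lambda>z. gk m (fst z) (snd z)) (q, s)" if q: "q > 0" for q s
  proof -
    consider "s > 0" | "s < 0" | "s = 0" by linarith
    then show ?thesis
    proof cases
      case 1
      have "\<forall>\<^sub>F z in nhds (q, s). snd z > 0"
        using eventually_nhds_in_open[of "{z. snd z > 0}" "(q, s)"] 1
        by (simp add: open_Collect_less continuous_intros)
      then have ev: "\<forall>\<^sub>F z in nhds (q, s). gk m (fst z) (snd z) = snd z powr (- m) * exp (- fst z / (4 * snd z))"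
        by eventually_elim (simp add: gk_def)
      have "isCont (\<lambda>z. snd z powr (- m) * exp (- fst z / (4 * snd z))) (q, s)"
        using 1 by (auto intro!: continuous_intros)
      then show ?thesis using isCont_cong[OF ev] by simp
    next
      case 2
      have "\<forall>\<^sub>F z in nhds (q, s). snd z < 0"
        using eventually_nhds_in_open[of "{z. snd z < 0}" "(q, s)"] 2
        by (simp add: open_Collect_less continuous_intros)
      then have ev: "\<forall>\<^sub>F z in nhds (q, s). gk m (fst z) (snd z) = 0"
        by eventually_elim (simp add: gk_def)
      show ?thesis using isCont_cong[OF ev] by simp
    next
      case 3
      have "\<forall>\<^sub>F z in nhds (q, s). fst z > q / 2"
        using eventually_nhds_in_open[of "{z. fst z > q / 2}" "(q, s)"] q
        by (simp add: open_Collect_less continuous_intros)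
      then have ev: "\<forall>\<^sub>F z in at (q, s). norm (gk m (fst z) (snd z)) \<le> gk m (q / 2) (snd z)"
        unfolding eventually_at_filter
        by eventually_elim (simp add: gk_nonneg gk_antimono)
      have g0: "gk m (q / 2) 0 = 0" by (simp add: gk_def)
      have "(gk m (q / 2) \<longlongrightarrow> 0) (nhds 0)"
        using gk_tendsto_0[of "q / 2" m] q g0 tendsto_at_iff_tendsto_nhds[of "gk m (q / 2)" 0] by simp
      moreover have "filterlim snd (nhds 0) (at (q, s))"
        using 3 by (auto intro!: tendsto_eq_intros)
      ultimately have "((\<lambda>z. gk m (q / 2) (snd z)) \<longlongrightarrow> 0) (at (q, s))"
        by (rule filterlim_compose)
      from Lim_null_comparison[OF ev this] show ?thesis
        using 3 by (simp add: isCont_def gk_def)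
    qed
  qed
  then show ?thesis
    by (auto simp: split_beta intro!: continuous_at_imp_continuous_on)
qed

lemma continuous_gk:
  assumes "continuous_on A f" "continuous_on A g" "\<And>x. x \<in> A \<Longrightarrow> f x > 0"
  shows "continuous_on A (\<lambda>x. gk m (f x) (g x))"
  using continuous_on_compose2[OF continuous_gk_pair[of m], of A "\<lambda>x. (f x, g x)"] assms
  by (auto intro!: continuous_intros)

lemma gk_deriv_q: "((\<lambda>q. gk m q s) has_real_derivative - gk (m + 1) q s / 4) (at q)"
proof (cases "s > 0")
  case True
  have pw: "s powr (- (m + 1)) = s powr (- m) / s"
    using True powr_diff[of s "- m" 1] by simp
  have "((\<lambda>q. s powr (- m) * exp (- q / (4 * s))) has_real_derivative
      s powr (- m) * (exp (- q / (4 * s)) * (- 1 / (4 * s)))) (at q)"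
    using True by (auto intro!: derivative_eq_intros)
  moreover have "s powr (- m) * (exp (- q / (4 * s)) * (- 1 / (4 * s))) = - gk (m + 1) q s / 4"
    unfolding gk_def pw using True by simp
  moreover have "(\<lambda>q. gk m q s) = (\<lambda>q. s powr (- m) * exp (- q / (4 * s)))"
    using True by (simp add: gk_def)
  ultimately show ?thesis by (simp only:)
qed (simp add: gk_def[abs_def])

text \<open>At \<open>s = 0\<close> the difference quotient is \<open>gk (m + 1) q\<close>, which
  tends to 0. So off the axis the kernel, extended by 0 to the past of its source, is differentiable
  across the source time, and its derivatives are again kernels with larger
  \<open>m\<close>.\<close>

lemma gk_deriv_s:
  assumes q: "q > 0"
  shows "((\<lambda>s. gk m q s) has_real_derivative - m * gk (m + 1) q s + q / 4 * gk (m + 2) q s) (at s)"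
proof -
  consider "s > 0" | "s < 0" | "s = 0" by linarith
  then show ?thesis
  proof cases
    case 1
    have p: "s powr (- (m + 1)) = s powr (- m) / s" "s powr (- (m + 2)) = s powr (- m) / s\<^sup>2"
      using 1 powr_diff[of s "- m" 1] powr_diff[of s "- m" 2] powr_realpow[of s 2] by simp_all
    have "((\<lambda>s. s powr (- m) * exp (- q / (4 * s))) has_real_derivative
        s powr (- m) * (exp (- q / (4 * s)) * (q / (4 * s\<^sup>2))) + (- m) * s powr (- m - 1) * exp (- q / (4 * s))) (at s)"
      using 1 by (auto intro!: derivative_eq_intros simp: power2_eq_square field_simps)
    moreover have "s powr (- m) * (exp (- q / (4 * s)) * (q / (4 * s\<^sup>2))) + (- m) * s powr (- m - 1) * exp (- q / (4 * s))
        = - m * gk (m + 1) q s + q / 4 * gk (m + 2) q s"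
      using 1 powr_diff[of s "- m" 1] unfolding gk_def p by (simp add: field_simps)
    moreover have "\<forall>\<^sub>F x in nhds s. gk m q x = x powr (- m) * exp (- q / (4 * x))"
      by (rule eventually_mono[OF eventually_nhds_in_open[of "{0<..}" s]]) (use 1 in \<open>auto simp: gk_def\<close>)
    ultimately show ?thesis
      by (subst DERIV_cong_ev[OF refl _ refl]) auto
  next
    case 2
    have "\<forall>\<^sub>F x in nhds s. gk m q x = 0"
      by (rule eventually_mono[OF eventually_nhds_in_open[of "{..<0}" s]]) (use 2 in \<open>auto simp: gk_def\<close>)
    then show ?thesis
      using 2 by (subst DERIV_cong_ev[OF refl _ refl]) (auto simp: gk_def)
  next
    case 3
    have "(\<lambda>h. (gk m q (0 + h) - gk m q 0) / h) = gk (m + 1) q"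
    proof
      fix h :: real
      show "(gk m q (0 + h) - gk m q 0) / h = gk (m + 1) q h"
        using powr_diff[of h "- m" 1] by (auto simp: gk_def)
    qed
    then have "((\<lambda>s. gk m q s) has_real_derivative 0) (at 0)"
      unfolding DERIV_def using gk_tendsto_0[OF q, of "m + 1"] by simp
    moreover have "- m * gk (m + 1) q s + q / 4 * gk (m + 2) q s = 0"
      using 3 by (simp add: gk_def)
    ultimately show ?thesis using 3 by simp
  qed
qed

text \<open>The source at \<open>(0, - \<tau>)\<close> has weight \<open>a \<tau>\<close>. The set
  where \<open>fst z \<noteq> 0\<close> is invariant under translations in time, so regularity of
  \<open>K\<close> there passes to the superposition.\<close>

definition time_potential :: "real \<Rightarrow> real \<Rightarrow> (real \<Rightarrow> real) \<Rightarrow> ('a::euclidean_space \<times> real \<Rightarrow> real) \<Rightarrow> 'a \<times> real \<Rightarrow> real" where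
  "time_potential \<tau>0 \<tau>1 a K z = integral {\<tau>0..\<tau>1} (\<lambda>\<tau>. a \<tau> * K (z + (0, \<tau>)))"

context
  fixes a :: "real \<Rightarrow> real" and \<tau>0 \<tau>1 :: real and S :: "('a::euclidean_space \<times> real) set"
  assumes a: "continuous_on {\<tau>0..\<tau>1} a"
  defines "S \<equiv> {z. fst z \<noteq> 0}"
begin

lemma open_fst_nonzero: "open S"
  unfolding S_def by (intro open_Collect_neq continuous_intros)

lemma continuous_time_potential:
  assumes K: "continuous_on S K"
  shows "continuous_on S (time_potential \<tau>0 \<tau>1 a K)"
proof -
  have "continuous_on (S \<times> cbox \<tau>0 \<tau>1) (\<lambda>(z, \<tau>). a \<tau> * K (z + (0, \<tau>)))"
    unfolding split_beta
    by (intro continuous_intros continuous_on_compose2[OF K] continuous_on_compose2[OF a])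
       (auto simp: S_def)
  from integral_continuous_on_param[OF this] show ?thesis
    by (simp add: time_potential_def[abs_def])
qed

lemma time_potential_integrable:
  assumes K: "continuous_on S K" and z: "z \<in> S"
  shows "(\<lambda>\<tau>. a \<tau> * K (z + (0, \<tau>))) integrable_on {\<tau>0..\<tau>1}"
  by (intro integrable_continuous_real continuous_intros continuous_on_compose2[OF K] a)
     (use z in \<open>auto simp: S_def\<close>)

lemma time_potential_dir_deriv:
  assumes K: "continuous_on S K" "continuous_on S K'" and d: "\<And>z. z \<in> S \<Longrightarrow> has_dir_deriv K (K' z) b z"
    and z: "z \<in> S"
  shows "has_dir_deriv (time_potential \<tau>0 \<tau>1 a K) (time_potential \<tau>0 \<tau>1 a K' z) b z"
proof -
  obtain \<delta> where \<delta>: "\<delta> > 0" "\<And>s. \<bar>s\<bar> < \<delta> \<Longrightarrow> z + s *\<^sub>R b \<in> S"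
    using eventually_line[OF open_fst_nonzero z, of b] by (auto simp: eventually_nhds_metric dist_real_def)
  let ?U = "ball (0::real) \<delta>"
  have inS: "z + s *\<^sub>R b + (0, \<tau>) \<in> S" if "s \<in> ?U" for s \<tau>
    using \<delta>(2)[of s] that by (auto simp: S_def dist_real_def)
  have "((\<lambda>s. integral (cbox \<tau>0 \<tau>1) (\<lambda>\<tau>. a \<tau> * K (z + s *\<^sub>R b + (0, \<tau>)))) has_real_derivative
     integral (cbox \<tau>0 \<tau>1) (\<lambda>\<tau>. a \<tau> * K' (z + 0 *\<^sub>R b + (0, \<tau>)))) (at 0 within ?U)"
  proof (rule leibniz_rule_field_derivative)
    show "((\<lambda>s. a \<tau> * K (z + s *\<^sub>R b + (0, \<tau>))) has_real_derivative a \<tau> * K' (z + s *\<^sub>R b + (0, \<tau>))) (at s within ?U)"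
      if "s \<in> ?U" for s \<tau>
    proof -
      have "has_dir_deriv K (K' (z + s *\<^sub>R b + (0, \<tau>))) b ((z + (0, \<tau>)) + s *\<^sub>R b)"
        using d[OF inS[OF that, of \<tau>]] by (simp add: ac_simps)
      from DERIV_cmult[OF has_dir_deriv_line[OF this], of "a \<tau>"] show ?thesis
        by (auto simp: ac_simps intro: has_field_derivative_at_within)
    qed
    show "(\<lambda>\<tau>. a \<tau> * K (z + s *\<^sub>R b + (0, \<tau>))) integrable_on cbox \<tau>0 \<tau>1" if "s \<in> ?U" for s
      using time_potential_integrable[OF K(1), of "z + s *\<^sub>R b"] \<delta>(2)[of s] that
      by (simp add: dist_real_def)
    show "continuous_on (?U \<times> cbox \<tau>0 \<tau>1) (\<lambda>(s, \<tau>). a \<tau> * K' (z + s *\<^sub>R b + (0, \<tau>)))"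
      unfolding split_beta
      by (intro continuous_intros continuous_on_compose2[OF K(2)] continuous_on_compose2[OF a])
         (use inS in auto)
  qed (use \<delta> in auto)
  moreover have "at 0 within ?U = at (0::real)" using \<delta> by (intro at_within_open) auto
  ultimately show ?thesis by (simp add: has_dir_deriv_def time_potential_def)
qed

lemma heat_classical_time_potential:
  assumes "heat_classical S K"
  shows "heat_classical S (time_potential \<tau>0 \<tau>1 a K)"
proof -
  obtain D1 D2 Dt where c: "continuous_on S K" "continuous_on S Dt"
    "\<And>i. i \<in> Basis \<Longrightarrow> continuous_on S (D1 i)" "\<And>i. i \<in> Basis \<Longrightarrow> continuous_on S (D2 i)"
    and D: "\<And>z. z \<in> S \<Longrightarrow> has_dir_deriv K (Dt z) (0, 1) z"
    "\<And>z. z \<in> S \<Longrightarrow> Dt z = (\<Sum>i\<in>Basis. D2 i z)"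
    "\<And>z i. z \<in> S \<Longrightarrow> i \<in> Basis \<Longrightarrow> has_dir_deriv K (D1 i z) (i, 0) z"
    "\<And>z i. z \<in> S \<Longrightarrow> i \<in> Basis \<Longrightarrow> has_dir_deriv (D1 i) (D2 i z) (i, 0) z"
    by (rule heat_classicalE[OF assms]) (rule that)
  let ?T = "time_potential \<tau>0 \<tau>1 a"
  show ?thesis
  proof (rule heat_classicalI[of _ _ "?T Dt" "\<lambda>i. ?T (D1 i)" "\<lambda>i. ?T (D2 i)"])
    show "?T Dt z = (\<Sum>i\<in>Basis. ?T (D2 i) z)" if z: "z \<in> S" for z
    proof -
      have "a \<tau> * Dt (z + (0, \<tau>)) = (\<Sum>i\<in>Basis. a \<tau> * D2 i (z + (0, \<tau>)))" for \<tau>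
        using D(2)[of "z + (0, \<tau>)"] z by (simp add: S_def sum_distrib_left)
      then show ?thesis
        using time_potential_integrable[OF c(4) z] by (simp add: time_potential_def integral_sum)
    qed
  qed (auto intro!: continuous_time_potential time_potential_dir_deriv c D(1,3,4))
qed

end

text \<open>The exponent is \<open>DIM('a) / 2\<close> because the second derivatives contribute one
  term \<open>- 1 / 2\<close> for each dimension, which must add up to the factor \<open>- m\<close>
  of the time derivative.\<close>

lemma heat_classical_kernel:
  "heat_classical {z. fst z \<noteq> (0::'a::euclidean_space)} (\<lambda>z. gk (DIM('a) / 2) ((norm (fst z))\<^sup>2) (snd z))"
proof -
  define S where "S = {z. fst z \<noteq> (0::'a) \<and> snd z \<in> (UNIV :: real set)}"
  let ?m = "DIM('a) / 2"
  let ?g = "\<lambda>m z. gk m ((norm (fst z))\<^sup>2) (snd z)"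
  have cg: "continuous_on S (?g m)" for m
    by (intro continuous_gk continuous_intros) (auto simp: S_def)
  have dq: "has_dir_deriv (?g m) (- (fst z \<bullet> i) / 2 * ?g (m + 1) z) (i, 0) z" if i: "i \<in> Basis" for m i z
  proof -
    have e: "(norm (fst z + s *\<^sub>R i))\<^sup>2 = (norm (fst z))\<^sup>2 + 2 * (fst z \<bullet> i) * s + s\<^sup>2" for s
      using i unfolding power2_norm_eq_inner
      by (simp add: inner_simps power2_eq_square algebra_simps inner_commute)
    have "((\<lambda>s. (norm (fst z + s *\<^sub>R i))\<^sup>2) has_real_derivative 2 * (fst z \<bullet> i)) (at 0)"
      unfolding e by (auto intro!: derivative_eq_intros)
    moreover have "((\<lambda>q. gk m q (snd z)) has_real_derivative - gk (m + 1) ((norm (fst z))\<^sup>2) (snd z) / 4)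
        (at ((norm (fst z + 0 *\<^sub>R i))\<^sup>2))"
      using gk_deriv_q[of m "snd z" "(norm (fst z))\<^sup>2"] by simp
    ultimately have "((\<lambda>s. gk m ((norm (fst z + s *\<^sub>R i))\<^sup>2) (snd z)) has_real_derivative
        - gk (m + 1) ((norm (fst z))\<^sup>2) (snd z) / 4 * (2 * (fst z \<bullet> i))) (at 0)"
      by (rule DERIV_chain2[rotated])
    then show ?thesis
      by (simp add: has_dir_deriv_def mult.commute)
  qed
  have ds: "has_dir_deriv (?g m) (- m * ?g (m + 1) z + (norm (fst z))\<^sup>2 / 4 * ?g (m + 2) z) (0, 1) z"
    if "z \<in> S" for m z
  proof -
    have "has_dir_deriv (?g m) d (0, 1) z \<longleftrightarrow> ((\<lambda>s. gk m ((norm (fst z))\<^sup>2) s) has_real_derivative d) (at (snd z))" for d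
      using DERIV_shift[of "\<lambda>s. gk m ((norm (fst z))\<^sup>2) s" d 0 "snd z"]
      by (simp add: has_dir_deriv_def add.commute)
    then show ?thesis using gk_deriv_s[of "(norm (fst z))\<^sup>2" m "snd z"] that by (simp add: S_def)
  qed
  have "heat_classical S (?g ?m)"
  proof (rule heat_classicalI[of _ _ "\<lambda>z. - ?m * ?g (?m + 1) z + (norm (fst z))\<^sup>2 / 4 * ?g (?m + 2) z"
        "\<lambda>i z. - (fst z \<bullet> i) / 2 * ?g (?m + 1) z"
        "\<lambda>i z. - 1 / 2 * ?g (?m + 1) z + (fst z \<bullet> i)\<^sup>2 / 4 * ?g (?m + 2) z"])
    show "- ?m * ?g (?m + 1) z + (norm (fst z))\<^sup>2 / 4 * ?g (?m + 2) z =
        (\<Sum>i\<in>Basis. - 1 / 2 * ?g (?m + 1) z + (fst z \<bullet> i)\<^sup>2 / 4 * ?g (?m + 2) z)" for z :: "'a \<times> real"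
    proof -
      have "(norm (fst z))\<^sup>2 = (\<Sum>i\<in>Basis. (fst z \<bullet> i)\<^sup>2)"
        unfolding power2_norm_eq_inner by (subst euclidean_inner) (simp add: power2_eq_square)
      then show ?thesis
        by (simp add: sum.distrib sum_subtractf sum_distrib_right sum_divide_distrib sum_negf)
    qed
    show "has_dir_deriv (\<lambda>z. - (fst z \<bullet> i) / 2 * ?g (?m + 1) z)
        (- 1 / 2 * ?g (?m + 1) z + (fst z \<bullet> i)\<^sup>2 / 4 * ?g (?m + 2) z) (i, 0) z" if i: "i \<in> Basis" for i z
    proof -
      have "has_dir_deriv (\<lambda>z. - (fst z \<bullet> i) / 2) (- 1 / 2) (i, 0) z"
        using i unfolding has_dir_deriv_def by (auto intro!: derivative_eq_intros simp: inner_simps)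
      from has_dir_deriv_mult[OF this dq[OF i, of "?m + 1" z]] show ?thesis
        by (simp add: power2_eq_square algebra_simps)
    qed
    show "has_dir_deriv (?g ?m) (- ?m * ?g (?m + 1) z + (norm (fst z))\<^sup>2 / 4 * ?g (?m + 2) z) (0, 1) z"
      if "z \<in> S" for z by (rule ds[OF that])
    show "has_dir_deriv (?g ?m) (- (fst z \<bullet> i) / 2 * ?g (?m + 1) z) (i, 0) z" if "i \<in> Basis" for z i
      by (rule dq[OF that])
  qed (auto intro!: continuous_intros cg)
  then show ?thesis by (simp add: S_def)
qed

section \<open>Estimates for heat potentials\<close>

lemma powr_diff_one_mult_powr_minus:
  fixes s :: real
  assumes "s > 0"
  shows "s powr (m - 1) * s powr (- m) = 1 / s"
proof -
  have "s powr (m - 1) * s powr (- m) = s powr ((m - 1) + (- m))" by (rule powr_add[symmetric])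
  also have "(m - 1) + (- m) = - 1" by simp
  also have "s powr (- 1) = 1 / s" using assms powr_minus_divide[of s 1] by simp
  finally show ?thesis .
qed

text \<open>The factors come from bounding \<open>((1 + y) / 4) ^ n\<close> by
  \<open>fact n * exp ((1 + y) / 4)\<close>.\<close>

definition heat_const :: "nat \<Rightarrow> real" where
  "heat_const n = 4 ^ n * fact n * exp (1 / 4)"

lemma heat_const_pos: "heat_const n > 0"
  by (simp add: heat_const_def)

lemma heat_const_bound:
  assumes "y \<ge> 0" "r \<le> real n"
  shows "(1 + y) powr r * exp (- y / 4) \<le> heat_const n"
proof -
  have "(1 + y) powr r \<le> (1 + y) powr real n" using assms by (intro powr_mono) auto
  also have "\<dots> = 4 ^ n * ((1 + y) / 4) ^ n"
    using assms(1) by (simp add: powr_realpow power_divide)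
  also have "\<dots> \<le> 4 ^ n * (fact n * exp ((1 + y) / 4))"
    using assms(1) by (intro mult_left_mono power_le_fact_exp) auto
  also have "exp ((1 + y) / 4) = exp (1 / 4) * exp (y / 4)"
    by (simp add: add_divide_distrib exp_add)
  finally have "(1 + y) powr r * exp (- y / 4) \<le> 4 ^ n * (fact n * (exp (1 / 4) * exp (y / 4))) * exp (- y / 4)"
    by (intro mult_right_mono) auto
  also have "\<dots> = heat_const n"
    by (simp add: heat_const_def exp_minus field_simps)
  finally show ?thesis .
qed

text \<open>The majorant is chosen for its elementary primitive in \<open>s\<close>, an arctangent
  of \<open>sqrt (s / q)\<close>. In terms of \<open>y = q / s\<close> the estimate amounts to
  bounding \<open>y powr ((n - 3) / 2) * exp (- y / 4)\<close> by a multiple of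
  \<open>1 / (1 + y)\<close>; for \<open>n \<ge> 3\<close> the exponent is nonnegative, so that
  \<open>y\<close> may be replaced by \<open>1 + y\<close>.\<close>

lemma gk_bound_arctan:
  assumes q: "q > 0" and s: "s > 0" and n: "n \<ge> 3"
  shows "gk (real n / 2) q s \<le> heat_const n * q powr (1 - real n / 2) * (sqrt (q / s) / (s + q))"
proof -
  define y where "y = q / s"
  have y: "y > 0" "q = y * s" using q s by (auto simp: y_def)
  have "y powr ((n - 3) / 2) \<le> (1 + y) powr ((n - 3) / 2)"
    using y n by (intro powr_mono2) auto
  then have "y powr ((real n - 3) / 2) * exp (- y / 4) \<le> (1 + y) powr ((real n - 3) / 2) * exp (- y / 4)"
    using n by (intro mult_right_mono) (auto simp: of_nat_diff)
  also have "\<dots> = (1 + y) powr ((real n - 1) / 2) * exp (- y / 4) / (1 + y)"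
  proof -
    have "(1 + y) powr ((real n - 1) / 2) = (1 + y) powr ((real n - 3) / 2) * (1 + y)"
      using y powr_add[of "1 + y" "(real n - 3) / 2" 1] by (simp add: field_simps)
    then show ?thesis using y by simp
  qed
  also have "\<dots> \<le> heat_const n / (1 + y)"
    using y heat_const_bound[of y "(real n - 1) / 2" n] by (intro divide_right_mono) auto
  finally have *: "y powr ((real n - 3) / 2) * exp (- y / 4) \<le> heat_const n / (1 + y)" .
  have "q powr (real n / 2 - 1) * s powr (- (real n / 2)) = y powr ((real n - 3) / 2) * sqrt y / s"
  proof -
    have "q powr (real n / 2 - 1) = y powr (real n / 2 - 1) * s powr (real n / 2 - 1)"
      using y s by (simp add: powr_mult)
    moreover have "s powr (real n / 2 - 1) * s powr (- (real n / 2)) = 1 / s"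
      by (rule powr_diff_one_mult_powr_minus[OF s])
    moreover have "y powr (real n / 2 - 1) = y powr ((real n - 3) / 2) * sqrt y"
      using y powr_add[of y "(real n - 3) / 2" "1 / 2"] by (simp add: powr_half_sqrt field_simps)
    ultimately show ?thesis by (simp add: mult.assoc)
  qed
  then have "q powr (real n / 2 - 1) * gk (real n / 2) q s = (y powr ((real n - 3) / 2) * exp (- y / 4)) * (sqrt y / s)"
    using s by (simp add: gk_def y_def field_simps)
  also have "\<dots> \<le> heat_const n / (1 + y) * (sqrt y / s)"
    using * y s by (intro mult_right_mono) auto
  also have "\<dots> = heat_const n * (sqrt (q / s) / (s + q))"
    using y s by (simp add: field_simps)
  finally have le: "q powr (real n / 2 - 1) * gk (real n / 2) q s \<le> heat_const n * (sqrt (q / s) / (s + q))" .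
  have one: "q powr (1 - real n / 2) * q powr (real n / 2 - 1) = 1"
    using q powr_add[of q "1 - real n / 2" "real n / 2 - 1"] by simp
  have "gk (real n / 2) q s = q powr (1 - real n / 2) * (q powr (real n / 2 - 1) * gk (real n / 2) q s)"
    unfolding mult.assoc[symmetric] one by simp
  also have "\<dots> \<le> q powr (1 - real n / 2) * (heat_const n * (sqrt (q / s) / (s + q)))"
    by (rule mult_left_mono[OF le]) simp
  finally show ?thesis by (simp only: mult_ac)
qed

text \<open>With \<open>q = (norm x)\<^sup>2\<close> the right-hand side is a multiple of the
  Newtonian kernel, which arises from the heat kernel by integration in time. The bound is uniform
  in the time interval because the arctangent is bounded.\<close>

lemma gk_integral_bound:
  assumes q: "q > 0" and n: "n \<ge> 3" and ab: "\<alpha> \<le> \<beta>"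
  shows "integral {\<alpha>..\<beta>} (\<lambda>\<tau>. gk (real n / 2) q (\<tau> - T)) \<le> pi * heat_const n * q powr (1 - real n / 2)"
proof -
  define K where "K = heat_const n * q powr (1 - real n / 2)"
  have K: "K > 0" using q heat_const_pos by (simp add: K_def)
  \<comment> \<open>Clipping at 0 freezes the primitive before the time \<open>T\<close>, where the
    kernel vanishes; \<open>T\<close> itself is the one exceptional point of the fundamental
    theorem.\<close>
  define G where "G \<tau> = K * (2 * arctan (sqrt (max 0 (\<tau> - T) / q)))" for \<tau>
  define g where "g \<tau> = (if \<tau> > T then K * (sqrt (q / (\<tau> - T)) / ((\<tau> - T) + q)) else 0)" for \<tau>
  have "(g has_integral (G \<beta> - G \<alpha>)) {\<alpha>..\<beta>}"
  proof (rule fundamental_theorem_of_calculus_interior_strong[of "{T}"])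
    show "continuous_on {\<alpha>..\<beta>} G" unfolding G_def using q by (intro continuous_intros) auto
    fix \<tau> assume \<tau>: "\<tau> \<in> {\<alpha><..<\<beta>} - {T}"
    show "(G has_vector_derivative g \<tau>) (at \<tau>)"
    proof (cases "\<tau> > T")
      case True
      define r where "r = (\<tau> - T) / q"
      have r: "r > 0" "\<tau> - T = r * q" using True q by (auto simp: r_def)
      have "((\<lambda>\<tau>. (\<tau> - T) / q) has_real_derivative 1 / q) (at \<tau>)"
        using q by (auto intro!: derivative_eq_intros)
      moreover have "(sqrt has_real_derivative inverse (sqrt r) / 2) (at ((\<tau> - T) / q))"
        unfolding r_def[symmetric] by (rule DERIV_real_sqrt[OF r(1)])
      ultimately have "((\<lambda>\<tau>. sqrt ((\<tau> - T) / q)) has_real_derivative inverse (sqrt r) / 2 * (1 / q)) (at \<tau>)"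
        by (rule DERIV_chain2[rotated])
      moreover have "(arctan has_real_derivative inverse (1 + (sqrt r)\<^sup>2)) (at (sqrt ((\<tau> - T) / q)))"
        unfolding r_def[symmetric] by (rule DERIV_arctan)
      ultimately have "((\<lambda>\<tau>. arctan (sqrt ((\<tau> - T) / q))) has_real_derivative
          inverse (1 + (sqrt r)\<^sup>2) * (inverse (sqrt r) / 2 * (1 / q))) (at \<tau>)"
        by (rule DERIV_chain2[rotated])
      then have "((\<lambda>\<tau>. K * (2 * arctan (sqrt ((\<tau> - T) / q)))) has_real_derivative
          K * (2 * (inverse (1 + (sqrt r)\<^sup>2) * (inverse (sqrt r) / 2 * (1 / q))))) (at \<tau>)"
        by (intro DERIV_cmult)
      moreover have "K * (2 * (inverse (1 + (sqrt r)\<^sup>2) * (inverse (sqrt r) / 2 * (1 / q)))) = g \<tau>"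
      proof -
        define i where "i = inverse (sqrt r)"
        have "sqrt (q / (r * q)) = i" using q by (simp add: real_sqrt_divide inverse_eq_divide i_def)
        moreover have "r * q + q = (1 + r) * q" by (simp add: algebra_simps)
        ultimately have "g \<tau> = K * (i / ((1 + r) * q))"
          using True unfolding g_def r(2) by simp
        moreover have "(sqrt r)\<^sup>2 = r" using r by simp
        moreover have "K * (2 * (inverse (1 + r) * (i / 2 * (1 / q)))) = K * (i / ((1 + r) * q))"
          by (simp add: inverse_eq_divide)
        ultimately show ?thesis unfolding i_def by simp
      qed
      moreover have "\<forall>\<^sub>F x in nhds \<tau>. G x = K * (2 * arctan (sqrt ((x - T) / q)))"
        by (rule eventually_mono[OF eventually_nhds_in_open[of "{T<..}" \<tau>]]) (use True in \<open>auto simp: G_def\<close>)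
      ultimately have "(G has_real_derivative g \<tau>) (at \<tau>)"
        by (subst DERIV_cong_ev[OF refl _ refl]) auto
      then show ?thesis by (simp add: has_real_derivative_iff_has_vector_derivative)
    next
      case False
      then have "\<tau> < T" using \<tau> by auto
      have "\<forall>\<^sub>F x in nhds \<tau>. G x = 0"
        by (rule eventually_mono[OF eventually_nhds_in_open[of "{..<T}" \<tau>]]) (use \<open>\<tau> < T\<close> in \<open>auto simp: G_def\<close>)
      then have "(G has_real_derivative g \<tau>) (at \<tau>)"
        using False by (subst DERIV_cong_ev[OF refl _ refl]) (auto simp: g_def)
      then show ?thesis by (simp add: has_real_derivative_iff_has_vector_derivative)
    qed
  qed (use ab in auto)
  moreover have "(\<lambda>\<tau>. gk (real n / 2) q (\<tau> - T)) integrable_on {\<alpha>..\<beta>}"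
    by (intro integrable_continuous_real continuous_gk continuous_intros) (use q in auto)
  moreover have "gk (real n / 2) q (\<tau> - T) \<le> g \<tau>" for \<tau>
    using gk_bound_arctan[OF q _ n, of "\<tau> - T"] by (auto simp: g_def K_def gk_def)
  ultimately have "integral {\<alpha>..\<beta>} (\<lambda>\<tau>. gk (real n / 2) q (\<tau> - T)) \<le> G \<beta> - G \<alpha>"
    by (metis has_integral_integrable integral_le integral_unique)
  also have "G \<alpha> \<ge> 0" using K q by (auto simp: G_def intro!: mult_nonneg_nonneg)
  then have "G \<beta> - G \<alpha> \<le> G \<beta>" by simp
  also have "G \<beta> \<le> K * pi"
    unfolding G_def using K arctan_ubound[of "sqrt (max 0 (\<beta> - T) / q)"] by (intro mult_left_mono) auto
  finally show ?thesis by (simp add: K_def ac_simps)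
qed

definition heat_potential :: "real \<Rightarrow> real \<Rightarrow> (real \<Rightarrow> real) \<Rightarrow> 'a::euclidean_space \<times> real \<Rightarrow> real" where
  "heat_potential \<tau>0 \<tau>1 a = time_potential \<tau>0 \<tau>1 a (\<lambda>z. gk (DIM('a) / 2) ((norm (fst z))\<^sup>2) (snd z))"

lemma heat_potential_classical:
  assumes "continuous_on {\<tau>0..\<tau>1} a"
  shows "heat_classical {z. fst z \<noteq> (0::'a::euclidean_space)} (heat_potential \<tau>0 \<tau>1 a)"
  unfolding heat_potential_def
  by (rule heat_classical_time_potential[OF assms heat_classical_kernel])

context
  fixes a :: "real \<Rightarrow> real" and \<tau>0 \<tau>1 :: real and S0 :: real and W :: "'a::euclidean_space \<times> real \<Rightarrow> real"
    and x :: 'a and T q m :: real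
  assumes a: "continuous_on {\<tau>0..\<tau>1} a" and a_nonneg: "\<forall>\<tau>\<in>{\<tau>0..\<tau>1}. a \<tau> \<ge> 0"
    and \<tau>: "0 < \<tau>0" "\<tau>0 \<le> \<tau>1" and n: "DIM('a) \<ge> 3" and x: "x \<noteq> 0"
  defines "m \<equiv> real (DIM('a)) / 2"
    and "S0 \<equiv> integral {\<tau>0..\<tau>1} (\<lambda>\<tau>. a \<tau> * \<tau> powr (- m))"
    and "W \<equiv> heat_potential \<tau>0 \<tau>1 a"
    and "q \<equiv> (norm x)\<^sup>2"
begin

lemma source_nonneg: "\<tau> \<in> {\<tau>0..\<tau>1} \<Longrightarrow> a \<tau> \<ge> 0"
  using a_nonneg by blast

lemma heat_potential_eq: "W (x, - T) = integral {\<tau>0..\<tau>1} (\<lambda>\<tau>. a \<tau> * gk m q (\<tau> - T))"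
  by (simp add: W_def heat_potential_def time_potential_def m_def q_def)

lemma norm_squared_pos: "q > 0" using x by (simp add: q_def)

lemma continuous_integrand: "continuous_on {\<tau>0..\<tau>1} (\<lambda>\<tau>. a \<tau> * gk m q (\<tau> - T))"
  using norm_squared_pos by (intro continuous_intros a continuous_gk) auto

lemma continuous_kernel: "continuous_on {\<tau>0..\<tau>1} (\<lambda>\<tau>. gk m q (\<tau> - T))"
  using norm_squared_pos by (intro continuous_gk continuous_intros) auto

lemma continuous_mass_integrand: "continuous_on {\<tau>0..\<tau>1} (\<lambda>\<tau>. a \<tau> * \<tau> powr (- m))"
  using \<tau> by (intro continuous_intros a) auto

lemma heat_potential_integrable:
  "(\<lambda>\<tau>. a \<tau> * gk m q (\<tau> - T)) integrable_on {\<tau>0..\<tau>1}"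
  "(\<lambda>\<tau>. c * gk m q (\<tau> - T)) integrable_on {\<tau>0..\<tau>1}"
  "(\<lambda>\<tau>. c * (a \<tau> * \<tau> powr (- m))) integrable_on {\<tau>0..\<tau>1}"
  by (rule integrable_continuous_real[OF continuous_integrand]
      integrable_continuous_real[OF continuous_on_mult_left[OF continuous_kernel]]
      integrable_continuous_real[OF continuous_on_mult_left[OF continuous_mass_integrand]])+

lemma heat_potential_nonneg: "W (x, - T) \<ge> 0"
  unfolding heat_potential_eq using source_nonneg gk_nonneg
  by (intro integral_nonneg integrable_continuous_real continuous_integrand mult_nonneg_nonneg) auto

lemma heat_potential_eq_0: "\<tau>1 \<le> T \<Longrightarrow> W (x, - T) = 0"
  unfolding heat_potential_eq by (rule integral_unique, rule has_integral_is_0) (auto simp: gk_def)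

text \<open>Sources with \<open>\<tau> \<le> T\<close> have not acted by time \<open>- T\<close>.
  For those of intermediate age, \<open>A\<close> is taken out of the integral and the Newtonian
  bound is applied to the kernel; the oldest ones are compared with the integrand of
  \<open>S0\<close> term by term.\<close>

lemma heat_potential_le_near:
  assumes T: "T \<ge> 0" and L: "L > 1" and A: "A \<ge> 0"
    and near: "\<And>\<tau>. \<tau> \<in> {\<tau>0..\<tau>1} \<Longrightarrow> T < \<tau> \<Longrightarrow> \<tau> \<le> L * T \<Longrightarrow> a \<tau> \<le> A"
  shows "W (x, - T) \<le> A * (pi * heat_const (DIM('a)) * q powr (1 - m)) + (1 - 1 / L) powr (- m) * S0"
proof -
  let ?\<kappa> = "(1 - 1 / L) powr (- m)"
  have L': "1 - 1 / L > 0" using L by simp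
  have pw: "a \<tau> * gk m q (\<tau> - T) \<le> A * gk m q (\<tau> - T) + ?\<kappa> * (a \<tau> * \<tau> powr (- m))" if t: "\<tau> \<in> {\<tau>0..\<tau>1}" for \<tau>
  proof -
    have n2: "?\<kappa> * (a \<tau> * \<tau> powr (- m)) \<ge> 0" using source_nonneg[OF t] by auto
    consider "\<tau> \<le> T" | "T < \<tau>" "\<tau> \<le> L * T" | "T < \<tau>" "L * T < \<tau>" by linarith
    then show ?thesis
    proof cases
      case 1
      then show ?thesis using n2 by (simp add: gk_def)
    next
      case 2
      then have "a \<tau> * gk m q (\<tau> - T) \<le> A * gk m q (\<tau> - T)"
        using near[OF t] gk_nonneg by (intro mult_right_mono) auto
      then show ?thesis using n2 by simp
    next
      case 3
      have "T \<le> \<tau> / L" using 3 L by (simp add: field_simps)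
      then have le: "(1 - 1 / L) * \<tau> \<le> \<tau> - T" by (simp add: field_simps)
      have "gk m q (\<tau> - T) \<le> (\<tau> - T) powr (- m) * 1"
        using 3 norm_squared_pos unfolding gk_def by (auto intro!: mult_left_mono)
      also have "\<dots> \<le> ((1 - 1 / L) * \<tau>) powr (- m)"
        using le L' t \<tau> by (auto simp: m_def intro!: powr_mono2')
      also have "\<dots> = ?\<kappa> * \<tau> powr (- m)"
        by (rule powr_mult)
      finally have "a \<tau> * gk m q (\<tau> - T) \<le> a \<tau> * (?\<kappa> * \<tau> powr (- m))"
        using source_nonneg[OF t] by (intro mult_left_mono)
      moreover have "A * gk m q (\<tau> - T) \<ge> 0" using A gk_nonneg by simp
      ultimately show ?thesis by (simp add: ac_simps)
    qed
  qed
  have "W (x, - T) \<le> integral {\<tau>0..\<tau>1} (\<lambda>\<tau>. A * gk m q (\<tau> - T) + ?\<kappa> * (a \<tau> * \<tau> powr (- m)))"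
    unfolding heat_potential_eq
    by (rule integral_le[OF heat_potential_integrable(1) integrable_add[OF heat_potential_integrable(2,3)] pw])
  also have "\<dots> = A * integral {\<tau>0..\<tau>1} (\<lambda>\<tau>. gk m q (\<tau> - T)) + ?\<kappa> * S0"
    unfolding S0_def
    by (subst integral_add[OF heat_potential_integrable(2,3)]) simp
  also have "A * integral {\<tau>0..\<tau>1} (\<lambda>\<tau>. gk m q (\<tau> - T)) \<le> A * (pi * heat_const (DIM('a)) * q powr (1 - m))"
    unfolding m_def using norm_squared_pos n \<tau> A by (intro mult_left_mono gk_integral_bound)
  finally show ?thesis by simp
qed

lemma heat_potential_le_all:
  assumes A: "A \<ge> 0" and all: "\<And>\<tau>. \<tau> \<in> {\<tau>0..\<tau>1} \<Longrightarrow> a \<tau> \<le> A"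
  shows "W (x, - T) \<le> A * (pi * heat_const (DIM('a)) * q powr (1 - m))"
proof -
  have "W (x, - T) \<le> integral {\<tau>0..\<tau>1} (\<lambda>\<tau>. A * gk m q (\<tau> - T))"
    unfolding heat_potential_eq
    by (rule integral_le[OF heat_potential_integrable(1,2)]) (intro mult_right_mono all gk_nonneg)
  also have "\<dots> = A * integral {\<tau>0..\<tau>1} (\<lambda>\<tau>. gk m q (\<tau> - T))" by simp
  also have "\<dots> \<le> A * (pi * heat_const (DIM('a)) * q powr (1 - m))"
    unfolding m_def using norm_squared_pos n \<tau> A by (intro mult_left_mono gk_integral_bound)
  finally show ?thesis .
qed

text \<open>\<open>S0\<close> is the value of the potential at the origin. Observing at the earlier
  time \<open>- T\<close> only increases the power factor of the kernel, so all the loss is in the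
  exponential, whose denominator stays above \<open>2 * \<tau>0\<close>.\<close>

lemma heat_potential_ge_origin:
  assumes T: "0 \<le> T" "T \<le> \<tau>0 / 2"
  shows "W (x, - T) \<ge> exp (- q / (2 * \<tau>0)) * S0"
proof -
  have "exp (- q / (2 * \<tau>0)) * S0 = integral {\<tau>0..\<tau>1} (\<lambda>\<tau>. exp (- q / (2 * \<tau>0)) * (a \<tau> * \<tau> powr (- m)))"
    by (simp add: S0_def)
  also have "\<dots> \<le> W (x, - T)"
    unfolding heat_potential_eq
  proof (rule integral_le[OF heat_potential_integrable(3,1)])
    fix t assume t: "t \<in> {\<tau>0..\<tau>1}"
    have d: "t - T \<ge> \<tau>0 / 2" "t - T > 0" using t T \<tau> by auto
    have "t powr (- m) \<le> (t - T) powr (- m)" using d T by (intro powr_mono2') (auto simp: m_def)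
    moreover have "exp (- q / (2 * \<tau>0)) \<le> exp (- q / (4 * (t - T)))"
    proof -
      have "q / (4 * (t - T)) \<le> q / (2 * \<tau>0)" using d \<tau> norm_squared_pos by (intro divide_left_mono) auto
      then show ?thesis by simp
    qed
    ultimately have "exp (- q / (2 * \<tau>0)) * t powr (- m) \<le> exp (- q / (4 * (t - T))) * (t - T) powr (- m)"
      by (intro mult_mono) auto
    then have "a t * (exp (- q / (2 * \<tau>0)) * t powr (- m)) \<le> a t * (exp (- q / (4 * (t - T))) * (t - T) powr (- m))"
      using source_nonneg[OF t] by (intro mult_left_mono)
    then show "exp (- q / (2 * \<tau>0)) * (a t * t powr (- m)) \<le> a t * gk m q (t - T)"
      using d by (simp add: gk_def ac_simps)
  qed
  finally show ?thesis .
qed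

text \<open>The sources at times between \<open>q / 2\<close> and \<open>q\<close> before the
  observation suffice: there the kernel is at least \<open>q powr (- m) * exp (- (1 / 2))\<close>
  and the density at least \<open>q powr (m - 1)\<close>, on an interval of length
  \<open>q / 2\<close>.\<close>

lemma heat_potential_ge_tube:
  assumes T: "\<tau>0 \<le> T" "T + q \<le> \<tau>1"
    and a1: "\<And>\<tau>. \<tau> \<in> {T..T + q} \<Longrightarrow> a \<tau> \<ge> q powr (m - 1)"
  shows "W (x, - T) \<ge> exp (- (1 / 2)) / 2"
proof -
  have qq: "T + q / 2 \<le> T + q" using norm_squared_pos by simp
  have sub: "{T + q / 2..T + q} \<subseteq> {\<tau>0..\<tau>1}" using T norm_squared_pos by auto
  have c: "q powr (m - 1) * (q powr (- m) * exp (- (1 / 2))) = exp (- (1 / 2)) / q"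
  proof -
    have "q powr (m - 1) * q powr (- m) = 1 / q"
      by (rule powr_diff_one_mult_powr_minus[OF norm_squared_pos])
    then show ?thesis unfolding mult.assoc[symmetric] by simp
  qed
  have "exp (- (1 / 2)) / 2 = integral {T + q / 2..T + q} (\<lambda>_. exp (- (1 / 2)) / q)"
    using norm_squared_pos by (simp add: field_simps)
  also have "\<dots> \<le> integral {T + q / 2..T + q} (\<lambda>\<tau>. a \<tau> * gk m q (\<tau> - T))"
  proof (intro integral_le)
    show "(\<lambda>\<tau>. a \<tau> * gk m q (\<tau> - T)) integrable_on {T + q / 2..T + q}"
      by (rule integrable_continuous_real[OF continuous_on_subset[OF continuous_integrand sub]])
    fix t assume t: "t \<in> {T + q / 2..T + q}"
    have d: "t - T > 0" "t - T \<ge> q / 2" "t - T \<le> q" using t norm_squared_pos by auto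
    have "q powr (- m) \<le> (t - T) powr (- m)" using d by (intro powr_mono2') (auto simp: m_def)
    moreover have "exp (- (1 / 2)) \<le> exp (- q / (4 * (t - T)))"
      using d norm_squared_pos by (simp add: field_simps)
    ultimately have "q powr (- m) * exp (- (1 / 2)) \<le> gk m q (t - T)"
      using d unfolding gk_def by (auto intro!: mult_mono)
    moreover have "q powr (m - 1) \<le> a t" using t norm_squared_pos by (intro a1) auto
    ultimately have "q powr (m - 1) * (q powr (- m) * exp (- (1 / 2))) \<le> a t * gk m q (t - T)"
      using source_nonneg[of t] sub t by (intro mult_mono) auto
    then show "exp (- (1 / 2)) / q \<le> a t * gk m q (t - T)" unfolding c .
  qed auto
  also have "\<dots> \<le> W (x, - T)"
    unfolding heat_potential_eq
    by (intro integral_subset_le sub integrable_continuous_real[OF continuous_integrand]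
        integrable_continuous_real[OF continuous_on_subset[OF continuous_integrand sub]])
       (use source_nonneg gk_nonneg in auto)
  finally show ?thesis .
qed

text \<open>On the parabola, with \<open>y = T / (t - T)\<close>, the ratio of the kernel to its
  value at the origin is \<open>(1 + y) powr m * exp (- y / 4)\<close>: the Gaussian compensates for
  the singularity at \<open>t = T\<close>.\<close>

lemma heat_potential_le_diag:
  assumes "q = T"
  shows "W (x, - T) \<le> heat_const (DIM('a)) * S0"
proof -
  have T: "T > 0" using norm_squared_pos assms by simp
  have "W (x, - T) \<le> integral {\<tau>0..\<tau>1} (\<lambda>\<tau>. heat_const (DIM('a)) * (a \<tau> * \<tau> powr (- m)))"
    unfolding heat_potential_eq
  proof (rule integral_le[OF heat_potential_integrable(1,3)])
    fix t assume t: "t \<in> {\<tau>0..\<tau>1}"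
    have "gk m q (t - T) \<le> heat_const (DIM('a)) * t powr (- m)"
    proof (cases "t > T")
      case True
      define y where "y = T / (t - T)"
      have y: "y > 0" "t = (1 + y) * (t - T)" using True T by (auto simp: y_def field_simps)
      have "gk m q (t - T) = (t - T) powr (- m) * exp (- y / 4)"
        using True by (simp add: gk_def assms y_def)
      also have "(t - T) powr (- m) = (1 + y) powr m * t powr (- m)"
      proof -
        have "t powr (- m) = (1 + y) powr (- m) * (t - T) powr (- m)"
          using powr_mult[of "1 + y" "t - T" "- m"] unfolding y(2)[symmetric] .
        then show ?thesis
          using y by (simp add: mult.assoc[symmetric] powr_add[symmetric])
      qed
      also have "(1 + y) powr m * t powr (- m) * exp (- y / 4) = ((1 + y) powr m * exp (- y / 4)) * t powr (- m)"
        by simp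
      also have "\<dots> \<le> heat_const (DIM('a)) * t powr (- m)"
        using y by (intro mult_right_mono heat_const_bound) (auto simp: m_def)
      finally show ?thesis .
    qed (use heat_const_pos in \<open>simp add: gk_def less_imp_le\<close>)
    then have "a t * gk m q (t - T) \<le> a t * (heat_const (DIM('a)) * t powr (- m))"
      using source_nonneg[OF t] by (intro mult_left_mono)
    then show "a t * gk m q (t - T) \<le> heat_const (DIM('a)) * (a t * t powr (- m))"
      by (simp add: ac_simps)
  qed
  also have "\<dots> = heat_const (DIM('a)) * S0" by (simp add: S0_def)
  finally show ?thesis .
qed

end

section \<open>Monotone densities\<close>

text \<open>Averaging makes a monotone density continuous, as needed to differentiate its potential.\<close>

definition avg :: "(real \<Rightarrow> real) \<Rightarrow> real \<Rightarrow> real" where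
  "avg k \<tau> = integral {\<tau>..2 * \<tau>} k / \<tau>"

context
  fixes k :: "real \<Rightarrow> real"
  assumes mono: "mono k" and k0: "\<And>x. k x \<ge> 0"
begin

lemma k_integrable: "k integrable_on {a..b}"
  using mono by (intro integrable_on_mono_on) (auto simp: mono_def mono_on_def)

lemma avg_bounds:
  assumes "\<tau> > 0"
  shows "k \<tau> \<le> avg k \<tau>" "avg k \<tau> \<le> k (2 * \<tau>)"
proof -
  have "integral {\<tau>..2 * \<tau>} (\<lambda>_. k \<tau>) \<le> integral {\<tau>..2 * \<tau>} k"
    using mono by (intro integral_le k_integrable) (auto simp: mono_def)
  then show "k \<tau> \<le> avg k \<tau>" using assms by (simp add: avg_def field_simps)
  have "integral {\<tau>..2 * \<tau>} k \<le> integral {\<tau>..2 * \<tau>} (\<lambda>_. k (2 * \<tau>))"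
    using mono by (intro integral_le k_integrable) (auto simp: mono_def)
  then show "avg k \<tau> \<le> k (2 * \<tau>)" using assms by (simp add: avg_def field_simps)
qed

lemma avg_continuous:
  assumes "\<alpha> > 0"
  shows "continuous_on {\<alpha>..\<beta>} (avg k)"
proof -
  define F where "F x = integral {\<alpha>..x} k" for x
  have F: "continuous_on {\<alpha>..2 * \<beta>} F"
    unfolding F_def by (rule indefinite_integral_continuous_1[OF k_integrable])
  have eq: "(F (2 * \<tau>) - F \<tau>) / \<tau> = avg k \<tau>" if "\<tau> \<in> {\<alpha>..\<beta>}" for \<tau>
    using Henstock_Kurzweil_Integration.integral_combine[of \<alpha> \<tau> "2 * \<tau>" k] k_integrable that assms by (simp add: F_def avg_def)
  have "continuous_on {\<alpha>..\<beta>} (\<lambda>\<tau>. (F (2 * \<tau>) - F \<tau>) / \<tau>)"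
    by (intro continuous_intros continuous_on_compose2[OF F]) (use assms in auto)
  then show ?thesis by (rule continuous_on_eq) (use eq in auto)
qed

section \<open>Convergence and divergence of the integral of \<open>k \<tau> / \<tau>\<close> at
  0\<close>

lemma k_div_integrable:
  assumes "\<alpha> > 0"
  shows "(\<lambda>\<sigma>. k \<sigma> / \<sigma>) integrable_on {\<alpha>..\<beta>}"
proof -
  have m: "k \<in> borel_measurable borel" using mono by (rule borel_measurable_mono)
  have "set_integrable lborel {\<alpha>..\<beta>} (\<lambda>\<sigma>. k \<sigma> / \<sigma>)"
    unfolding set_integrable_def
  proof (rule integrableI_bounded_set_indicator[where B = "k \<beta> / \<alpha>"])
    show "AE x in lborel. x \<in> {\<alpha>..\<beta>} \<longrightarrow> norm (k x / x) \<le> k \<beta> / \<alpha>"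
    proof (intro AE_I2 impI)
      fix x assume "x \<in> {\<alpha>..\<beta>}"
      then have "k x / x \<le> k \<beta> / \<alpha>" "k x / x \<ge> 0"
        using assms mono k0 by (auto simp: mono_def intro!: frac_le)
      then show "norm (k x / x) \<le> k \<beta> / \<alpha>" by simp
    qed
  qed (use m in \<open>auto simp: emeasure_lborel_Icc_eq\<close>)
  then show ?thesis by (rule set_borel_integral_eq_integral)
qed

lemma integral_le_nn_integral:
  assumes "0 < \<alpha>"
  shows "ennreal (integral {\<alpha>..1} (\<lambda>\<sigma>. k \<sigma> / \<sigma>)) \<le> (\<integral>\<^sup>+ \<tau>\<in>{0<..1}. ennreal (k \<tau> / \<tau>) \<partial>lborel)"
proof -
  have "((\<lambda>\<sigma>. k \<sigma> / \<sigma>) has_integral integral {\<alpha>..1} (\<lambda>\<sigma>. k \<sigma> / \<sigma>)) {\<alpha>..1}"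
    by (rule integrable_integral[OF k_div_integrable[OF assms]])
  from nn_integral_has_integral_lebesgue'[OF _ this]
  have "ennreal (integral {\<alpha>..1} (\<lambda>\<sigma>. k \<sigma> / \<sigma>)) = (\<integral>\<^sup>+ \<tau>. ennreal (k \<tau> / \<tau>) * indicator {\<alpha>..1} \<tau> \<partial>lborel)"
    using assms k0 by simp
  also have "\<dots> \<le> (\<integral>\<^sup>+ \<tau>. ennreal (k \<tau> / \<tau>) * indicator {0<..1} \<tau> \<partial>lborel)"
    using assms by (intro nn_integral_mono mult_left_mono) (auto simp: indicator_def)
  finally show ?thesis .
qed

lemma nn_integral_le_of_integrals:
  assumes "\<And>\<alpha>. 0 < \<alpha> \<Longrightarrow> integral {\<alpha>..1} (\<lambda>\<sigma>. k \<sigma> / \<sigma>) \<le> B"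
  shows "(\<integral>\<^sup>+ \<tau>\<in>{0<..1}. ennreal (k \<tau> / \<tau>) \<partial>lborel) \<le> ennreal B"
proof -
  have m: "k \<in> borel_measurable borel" using mono by (rule borel_measurable_mono)
  define I where "I j = {1 / real (Suc j)..(1::real)}" for j
  have incI: "incseq I"
  proof (rule incseq_SucI)
    fix j show "I j \<le> I (Suc j)" by (auto simp: I_def field_simps intro: order_trans[rotated])
  qed
  have UI: "(\<Union>j. I j) = {0<..1}"
  proof
    show "(\<Union>j. I j) \<subseteq> {0<..1}"
    proof
      fix x assume "x \<in> (\<Union>j. I j)"
      then obtain j where "1 / real (Suc j) \<le> x" "x \<le> 1" by (auto simp: I_def)
      moreover have "0 < 1 / real (Suc j)" by simp
      ultimately have "0 < x" "x \<le> 1" by linarith+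
      then show "x \<in> {0<..1}" by simp
    qed
    show "{0<..1} \<subseteq> (\<Union>j. I j)"
    proof
      fix x :: real assume "x \<in> {0<..1}"
      then obtain j where "inverse (real (Suc j)) < x" using reals_Archimedean by auto
      then show "x \<in> (\<Union>j. I j)" using \<open>x \<in> {0<..1}\<close> by (auto simp: I_def inverse_eq_divide intro!: exI[of _ j])
    qed
  qed
  have "(\<integral>\<^sup>+ \<tau>. ennreal (k \<tau> / \<tau>) * indicator {0<..1} \<tau> \<partial>lborel)
      = (\<integral>\<^sup>+ \<tau>. (SUP j. ennreal (k \<tau> / \<tau>) * indicator (I j) \<tau>) \<partial>lborel)"
  proof (rule nn_integral_cong)
    fix \<tau>
    show "ennreal (k \<tau> / \<tau>) * indicator {0<..1} \<tau> = (SUP j. ennreal (k \<tau> / \<tau>) * indicator (I j) \<tau>)"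
    proof (rule antisym)
      show "ennreal (k \<tau> / \<tau>) * indicator {0<..1} \<tau> \<le> (SUP j. ennreal (k \<tau> / \<tau>) * indicator (I j) \<tau>)"
      proof (cases "\<tau> \<in> {0<..1}")
        case True
        then obtain j where "\<tau> \<in> I j" using UI by blast
        then show ?thesis using True by (intro SUP_upper2[of j]) auto
      qed simp
      show "(SUP j. ennreal (k \<tau> / \<tau>) * indicator (I j) \<tau>) \<le> ennreal (k \<tau> / \<tau>) * indicator {0<..1} \<tau>"
        using UI by (intro SUP_least mult_left_mono indicator_leI) auto
    qed
  qed
  also have "\<dots> = (SUP j. \<integral>\<^sup>+ \<tau>. ennreal (k \<tau> / \<tau>) * indicator (I j) \<tau> \<partial>lborel)"
  proof (rule nn_integral_monotone_convergence_SUP)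
    show "incseq (\<lambda>j \<tau>. ennreal (k \<tau> / \<tau>) * indicator (I j) \<tau>)"
      using incI by (auto simp: incseq_def le_fun_def intro!: mult_left_mono indicator_leI)
    show "(\<lambda>\<tau>. ennreal (k \<tau> / \<tau>) * indicator (I j) \<tau>) \<in> borel_measurable lborel" for j
      using m by (auto simp: I_def)
  qed
  also have "\<dots> \<le> ennreal B"
  proof (rule SUP_least)
    fix j
    have p: "0 < 1 / real (Suc j)" by simp
    have "((\<lambda>\<sigma>. k \<sigma> / \<sigma>) has_integral integral (I j) (\<lambda>\<sigma>. k \<sigma> / \<sigma>)) (I j)"
      unfolding I_def by (rule integrable_integral[OF k_div_integrable[OF p]])
    moreover have "0 \<le> k x / x" if "x \<in> I j" for x
    proof -
      have "1 / real (Suc j) \<le> x" using that by (simp add: I_def)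
      then have "0 \<le> x" using p by linarith
      then show ?thesis using k0 by simp
    qed
    ultimately have "(\<integral>\<^sup>+ \<tau>. ennreal (k \<tau> / \<tau>) * indicator (I j) \<tau> \<partial>lborel) = ennreal (integral (I j) (\<lambda>\<sigma>. k \<sigma> / \<sigma>))"
      by (rule nn_integral_has_integral_lebesgue'[rotated])
    also have "\<dots> \<le> ennreal B" unfolding I_def by (intro ennreal_leI assms p)
    finally show "(\<integral>\<^sup>+ \<tau>. ennreal (k \<tau> / \<tau>) * indicator (I j) \<tau> \<partial>lborel) \<le> ennreal B" .
  qed
  finally show ?thesis .
qed

text \<open>The integral over \<open>{\<beta>..1}\<close> is finite. If the integrals over all
  \<open>{\<alpha>..\<beta>}\<close> stayed below \<open>B\<close>, the whole integral would be
  finite too.\<close>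

lemma divergent_integral:
  assumes inf: "(\<integral>\<^sup>+ \<tau>\<in>{0<..1}. ennreal (k \<tau> / \<tau>) \<partial>lborel) = \<infinity>" and \<beta>: "0 < \<beta>" "\<beta> \<le> 1"
  shows "\<exists>\<alpha>. 0 < \<alpha> \<and> \<alpha> < \<beta> \<and> B \<le> integral {\<alpha>..\<beta>} (\<lambda>\<sigma>. k \<sigma> / \<sigma>)"
proof (rule ccontr)
  let ?f = "\<lambda>\<sigma>. k \<sigma> / \<sigma>"
  assume "\<not> ?thesis"
  then have less: "integral {\<alpha>..\<beta>} ?f < B" if "0 < \<alpha>" "\<alpha> < \<beta>" for \<alpha> using that by force
  have nn: "integral {\<alpha>..\<gamma>} ?f \<ge> 0" if "0 < \<alpha>" for \<alpha> \<gamma>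
    using that k0 by (intro integral_nonneg k_div_integrable) auto
  have "integral {\<alpha>..1} ?f \<le> \<bar>B\<bar> + integral {\<beta>..1} ?f" if \<alpha>: "0 < \<alpha>" for \<alpha>
  proof (cases "\<alpha> < \<beta>")
    case True
    then have "integral {\<alpha>..1} ?f = integral {\<alpha>..\<beta>} ?f + integral {\<beta>..1} ?f"
      using \<beta> \<alpha> by (intro Henstock_Kurzweil_Integration.integral_combine[symmetric] k_div_integrable) auto
    then show ?thesis using less[OF \<alpha> True] by simp
  next
    case False
    then have "integral {\<alpha>..1} ?f \<le> integral {\<beta>..1} ?f"
      using \<beta> \<alpha> k0 by (intro integral_subset_le k_div_integrable) auto
    then show ?thesis by simp
  qed
  from nn_integral_le_of_integrals[OF this] show False using inf by (simp add: top_unique)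
qed

text \<open>The total \<open>r\<close> bounds the integrals over all \<open>{\<alpha>..1}\<close>,
  and some \<open>{\<beta>..1}\<close> comes within \<open>e\<close> of it; what lies between
  \<alpha> and \<beta> is then at most \<open>e\<close>, for all \<alpha> at once.\<close>

lemma convergent_integral:
  assumes fin: "(\<integral>\<^sup>+ \<tau>\<in>{0<..1}. ennreal (k \<tau> / \<tau>) \<partial>lborel) \<noteq> \<infinity>" and e: "e > 0"
  shows "\<exists>\<beta>. 0 < \<beta> \<and> \<beta> \<le> 1 \<and> (\<forall>\<alpha>. 0 < \<alpha> \<longrightarrow> \<alpha> \<le> \<beta> \<longrightarrow> integral {\<alpha>..\<beta>} (\<lambda>\<sigma>. k \<sigma> / \<sigma>) \<le> e)"
proof -
  let ?f = "\<lambda>\<sigma>. k \<sigma> / \<sigma>" and ?n = "\<integral>\<^sup>+ \<tau>\<in>{0<..1}. ennreal (k \<tau> / \<tau>) \<partial>lborel"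
  obtain r where r: "?n = ennreal r" "r \<ge> 0" using fin by (cases ?n) auto
  have le: "integral {\<alpha>..1} ?f \<le> r" if "0 < \<alpha>" for \<alpha>
    using integral_le_nn_integral[OF that] r by (simp add: ennreal_le_iff)
  have "\<exists>\<beta>>0. integral {\<beta>..1} ?f > r - e"
  proof (rule ccontr)
    assume no: "\<not> ?thesis"
    then have "?n \<le> ennreal (r - e)" by (intro nn_integral_le_of_integrals) force
    moreover have "r - e \<ge> 0" using no[simplified, rule_format, of 1] by simp
    ultimately show False using r e by (simp add: ennreal_le_iff)
  qed
  then obtain \<beta>0 where \<beta>0: "\<beta>0 > 0" "integral {\<beta>0..1} ?f > r - e" by blast
  define \<beta> where "\<beta> = min \<beta>0 1"
  have \<beta>: "0 < \<beta>" "\<beta> \<le> 1" using \<beta>0 by (auto simp: \<beta>_def)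
  have "integral {\<beta>0..1} ?f \<le> integral {\<beta>..1} ?f"
    using \<beta>0 \<beta> k0 by (intro integral_subset_le k_div_integrable) (auto simp: \<beta>_def)
  then have gt: "integral {\<beta>..1} ?f > r - e" using \<beta>0 by simp
  have "integral {\<alpha>..\<beta>} ?f \<le> e" if "0 < \<alpha>" "\<alpha> \<le> \<beta>" for \<alpha>
  proof -
    have "integral {\<alpha>..\<beta>} ?f + integral {\<beta>..1} ?f = integral {\<alpha>..1} ?f"
      using that \<beta> by (intro Henstock_Kurzweil_Integration.integral_combine k_div_integrable) auto
    then show ?thesis using le[OF that(1)] gt by simp
  qed
  then show ?thesis using \<beta> by blast
qed

text \<open>Dilations preserve d\<tau>/\<tau>, so only the limits of integration move.\<close>

lemma integral_scaled:
  assumes "c > 0" "\<alpha> > 0" "\<alpha> \<le> \<beta>"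
  shows "(\<lambda>\<tau>. k (c * \<tau>) / \<tau>) integrable_on {\<alpha>..\<beta>}"
    "integral {\<alpha>..\<beta>} (\<lambda>\<tau>. k (c * \<tau>) / \<tau>) = integral {c * \<alpha>..c * \<beta>} (\<lambda>\<sigma>. k \<sigma> / \<sigma>)"
proof -
  have "((\<lambda>\<sigma>. k \<sigma> / \<sigma>) has_integral integral {c * \<alpha>..c * \<beta>} (\<lambda>\<sigma>. k \<sigma> / \<sigma>)) {c * \<alpha>..c * \<beta>}"
    using assms by (intro integrable_integral k_div_integrable) auto
  from has_integral_stretch_real[OF this, of c]
  have "((\<lambda>\<tau>. k (c * \<tau>) / (c * \<tau>)) has_integral (1 / c) *\<^sub>R integral {c * \<alpha>..c * \<beta>} (\<lambda>\<sigma>. k \<sigma> / \<sigma>)) {\<alpha>..\<beta>}"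
    using assms by (simp add: image_divide_atLeastAtMost)
  from has_integral_mult_right[OF this, of c]
  have "((\<lambda>\<tau>. k (c * \<tau>) / \<tau>) has_integral integral {c * \<alpha>..c * \<beta>} (\<lambda>\<sigma>. k \<sigma> / \<sigma>)) {\<alpha>..\<beta>}"
    using assms by simp
  then show "(\<lambda>\<tau>. k (c * \<tau>) / \<tau>) integrable_on {\<alpha>..\<beta>}"
    "integral {\<alpha>..\<beta>} (\<lambda>\<tau>. k (c * \<tau>) / \<tau>) = integral {c * \<alpha>..c * \<beta>} (\<lambda>\<sigma>. k \<sigma> / \<sigma>)"
    by (auto simp: has_integral_iff)
qed

text \<open>The density \<open>\<tau>\<^sup>m\<^sup>-\<^sup>1 k(c \<tau>)\<close> with \<open>k\<close> averaged; for \<open>k = \<rho>\<^sup>n\<^sup>-\<^sup>2\<close> and \<open>m = n / 2\<close> it is comparable to the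
  Newtonian capacity \<open>(\<tau>\<^sup>1\<^sup>/\<^sup>2 \<rho>)\<^sup>n\<^sup>-\<^sup>2\<close> of the time slice of the complement of \<open>Phi \<rho>\<close>.\<close>

definition density :: "real \<Rightarrow> real \<Rightarrow> real \<Rightarrow> real" where
  "density m c \<tau> = \<tau> powr (m - 1) * avg k (c * \<tau>)"

lemma density_continuous:
  assumes "c > 0" "\<alpha> > 0"
  shows "continuous_on {\<alpha>..\<beta>} (density m c)"
proof -
  have "continuous_on {\<alpha>..\<beta>} (\<lambda>\<tau>. avg k (c * \<tau>))"
    by (rule continuous_on_compose2[OF avg_continuous[of "c * \<alpha>" "c * \<beta>"]])
       (use assms in \<open>auto intro!: continuous_intros\<close>)
  then show ?thesis
    unfolding density_def[abs_def] using assms by (intro continuous_intros) auto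
qed

lemma density_bounds:
  assumes "c > 0" "\<tau> > 0"
  shows "density m c \<tau> \<ge> 0" "\<tau> powr (m - 1) * k (c * \<tau>) \<le> density m c \<tau>"
    "density m c \<tau> \<le> \<tau> powr (m - 1) * k (2 * c * \<tau>)"
proof -
  have b: "k (c * \<tau>) \<le> avg k (c * \<tau>)" "avg k (c * \<tau>) \<le> k (2 * c * \<tau>)"
    using avg_bounds[of "c * \<tau>"] assms by (auto simp: mult.assoc)
  then show "\<tau> powr (m - 1) * k (c * \<tau>) \<le> density m c \<tau>"
    "density m c \<tau> \<le> \<tau> powr (m - 1) * k (2 * c * \<tau>)"
    unfolding density_def by (auto intro!: mult_left_mono)
  show "density m c \<tau> \<ge> 0"
    unfolding density_def using order_trans[OF k0 b(1)] by (intro mult_nonneg_nonneg) auto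
qed

text \<open>The powers of \<tau> combine to \<open>1 / \<tau>\<close>, which brings back the
  integral of the criterion. The two bounds differ by the dilation factor 2 that averaging
  introduces.\<close>

lemma density_integral_bounds:
  assumes c: "c > 0" and \<alpha>: "\<alpha> > 0" "\<alpha> \<le> \<beta>"
  shows "integral {c * \<alpha>..c * \<beta>} (\<lambda>\<sigma>. k \<sigma> / \<sigma>) \<le> integral {\<alpha>..\<beta>} (\<lambda>\<tau>. density m c \<tau> * \<tau> powr (- m))"
    "integral {\<alpha>..\<beta>} (\<lambda>\<tau>. density m c \<tau> * \<tau> powr (- m)) \<le> integral {2 * c * \<alpha>..2 * c * \<beta>} (\<lambda>\<sigma>. k \<sigma> / \<sigma>)"
proof -
  have i: "(\<lambda>\<tau>. density m c \<tau> * \<tau> powr (- m)) integrable_on {\<alpha>..\<beta>}"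
    using \<alpha> by (intro integrable_continuous_real continuous_intros density_continuous c) auto
  have p: "\<tau> powr (m - 1) * x * \<tau> powr (- m) = x / \<tau>" if "\<tau> > 0" for \<tau> x :: real
  proof -
    have "\<tau> powr (m - 1) * \<tau> powr (- m) = 1 / \<tau>"
      by (rule powr_diff_one_mult_powr_minus[OF that])
    then have "x * (\<tau> powr (m - 1) * \<tau> powr (- m)) = x / \<tau>" by simp
    then show ?thesis by (simp only: mult_ac)
  qed
  have "k (c * \<tau>) / \<tau> \<le> density m c \<tau> * \<tau> powr (- m)" if "\<tau> \<in> {\<alpha>..\<beta>}" for \<tau>
  proof -
    have "\<tau> > 0" using that \<alpha> by auto
    from mult_right_mono[OF density_bounds(2)[OF c this, of m], of "\<tau> powr (- m)"] p[OF this]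
    show ?thesis by simp
  qed
  then have "integral {\<alpha>..\<beta>} (\<lambda>\<tau>. k (c * \<tau>) / \<tau>) \<le> integral {\<alpha>..\<beta>} (\<lambda>\<tau>. density m c \<tau> * \<tau> powr (- m))"
    by (intro integral_le i integral_scaled assms)
  then show "integral {c * \<alpha>..c * \<beta>} (\<lambda>\<sigma>. k \<sigma> / \<sigma>) \<le> integral {\<alpha>..\<beta>} (\<lambda>\<tau>. density m c \<tau> * \<tau> powr (- m))"
    by (simp add: integral_scaled[OF assms])
  have "density m c \<tau> * \<tau> powr (- m) \<le> k (2 * c * \<tau>) / \<tau>" if "\<tau> \<in> {\<alpha>..\<beta>}" for \<tau>
  proof -
    have "\<tau> > 0" using that \<alpha> by auto
    from mult_right_mono[OF density_bounds(3)[OF c this, of m], of "\<tau> powr (- m)"] p[OF this]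
    show ?thesis by simp
  qed
  moreover have c2: "2 * c > 0" using c by simp
  ultimately have "integral {\<alpha>..\<beta>} (\<lambda>\<tau>. density m c \<tau> * \<tau> powr (- m)) \<le> integral {\<alpha>..\<beta>} (\<lambda>\<tau>. k (2 * c * \<tau>) / \<tau>)"
    by (intro integral_le i integral_scaled \<alpha>)
  then show "integral {\<alpha>..\<beta>} (\<lambda>\<tau>. density m c \<tau> * \<tau> powr (- m)) \<le> integral {2 * c * \<alpha>..2 * c * \<beta>} (\<lambda>\<sigma>. k \<sigma> / \<sigma>)"
    by (simp add: integral_scaled[OF c2 \<alpha>])
qed

end

section \<open>The boundary point\<close>

lemma Phi_iff:
  "(x, t) \<in> Phi \<rho> \<longleftrightarrow> -1 < t \<and> t < 0 \<and> sqrt (- t) * \<rho> (- t) < norm x \<and> norm x < \<rho> 1"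
  by (auto simp: Phi_def powr_half_sqrt)

lemma Phi_fst_nonzero:
  assumes "\<And>\<tau>. \<tau> \<in> {0<..1} \<Longrightarrow> \<rho> \<tau> > 0"
  shows "Phi \<rho> \<subseteq> {z. fst z \<noteq> (0::'a::euclidean_space)}"
proof clarsimp
  fix t assume "(0::'a, t) \<in> Phi \<rho>"
  then have "-1 < t" "t < 0" "sqrt (- t) * \<rho> (- t) < 0" by (auto simp: Phi_iff)
  moreover have "\<rho> (- t) > 0" using \<open>-1 < t\<close> \<open>t < 0\<close> by (intro assms) auto
  ultimately show False by (simp add: mult_less_0_iff)
qed

lemma bounded_Phi: "bounded (Phi \<rho> :: ('a::euclidean_space \<times> real) set)"
proof -
  have "Phi \<rho> \<subseteq> (cball 0 (\<rho> 1) \<times> {-1..0} :: ('a \<times> real) set)"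
    by (auto simp: Phi_iff)
  then show ?thesis using bounded_Times[OF bounded_cball bounded_closed_interval] bounded_subset by blast
qed

lemma power2_powr_half_dim:
  fixes q :: real
  assumes "x \<ge> 0" "n \<ge> 3"
  shows "(x\<^sup>2) powr (real n / 2 - 1) = x ^ (n - 2)"
proof (cases "x = 0")
  case True
  then show ?thesis using assms by simp
next
  case False
  then have "x > 0" using assms by simp
  then have x2: "x\<^sup>2 = x powr 2" by simp
  have "(x\<^sup>2) powr (real n / 2 - 1) = x powr (2 * (real n / 2 - 1))"
    unfolding x2 by (rule powr_powr)
  also have "2 * (real n / 2 - 1) = real (n - 2)" using assms by (simp add: of_nat_diff)
  finally show ?thesis using \<open>x > 0\<close> by (simp add: powr_realpow)
qed

locale tube =
  fixes \<rho> :: "real \<Rightarrow> real" and n :: nat and ty :: "'a::euclidean_space itself"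
  assumes n_def: "n = DIM('a)" and n3: "n \<ge> 3"
    and \<rho>pos: "\<And>\<tau>. \<tau> \<in> {0<..1} \<Longrightarrow> \<rho> \<tau> > 0" and \<rho>mono: "mono_on {0<..1} \<rho>"
    and \<rho>0: "(\<rho> \<longlongrightarrow> 0) (at_right 0)" and opn: "open (Phi \<rho> :: ('a \<times> real) set)"
begin

text \<open>Extension by 0 to the left and by a constant beyond 1 makes the power of \<rho> monotone
  on the whole line, as the averaging construction requires.\<close>

definition k :: "real \<Rightarrow> real" where
  "k \<tau> = (if \<tau> \<le> 0 then 0 else \<rho> (min \<tau> 1) ^ (n - 2))"

definition m :: real where "m = real n / 2"

lemma \<rho>le: "0 < s \<Longrightarrow> s \<le> t \<Longrightarrow> t \<le> 1 \<Longrightarrow> \<rho> s \<le> \<rho> t"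
  using \<rho>mono by (auto simp: mono_on_def)

lemma Phi_sub: "Phi \<rho> \<subseteq> {z. fst z \<noteq> (0::'a)}"
  by (rule Phi_fst_nonzero) (rule \<rho>pos)

lemma k_nonneg: "k \<tau> \<ge> 0"
proof (cases "\<tau> \<le> 0")
  case False
  then have "\<rho> (min \<tau> 1) > 0" by (intro \<rho>pos) auto
  then show ?thesis by (simp add: k_def)
qed (simp add: k_def)

lemma k_mono: "mono k"
proof (rule monoI)
  fix s t :: real assume "s \<le> t"
  show "k s \<le> k t"
  proof (cases "s \<le> 0")
    case True
    then have "k s = 0" by (simp add: k_def)
    then show ?thesis using k_nonneg by simp
  next
    case False
    then have "\<rho> (min s 1) \<le> \<rho> (min t 1)" using \<open>s \<le> t\<close> by (intro \<rho>le) auto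
    moreover have "0 \<le> \<rho> (min s 1)" using \<rho>pos[of "min s 1"] False by auto
    ultimately show ?thesis using False \<open>s \<le> t\<close> by (auto simp: k_def intro!: power_mono)
  qed
qed

lemma k_eq: "0 < \<tau> \<Longrightarrow> \<tau> \<le> 1 \<Longrightarrow> k \<tau> = \<rho> \<tau> ^ (n - 2)"
  by (simp add: k_def)

lemma k_integral_eq:
  "(\<integral>\<^sup>+ \<tau>\<in>{0<..1}. ennreal (\<rho> \<tau> ^ (n - 2) / \<tau>) \<partial>lborel) = (\<integral>\<^sup>+ \<tau>\<in>{0<..1}. ennreal (k \<tau> / \<tau>) \<partial>lborel)"
  by (intro nn_integral_cong) (auto simp: indicator_def k_eq)

text \<open>The right-hand side is, up to a constant, the capacity of the ball of radius
  \<open>sqrt T * \<rho> T\<close> that is removed at time \<open>- T\<close>.\<close>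

lemma tube_power:
  assumes "0 < T" "T \<le> 1"
  shows "T powr (m - 1) * k T = (sqrt T * \<rho> T) ^ (n - 2)"
proof -
  have "T powr (m - 1) = sqrt T ^ (n - 2)"
    using power2_powr_half_dim[of "sqrt T" n] assms n3 by (simp add: m_def)
  then show ?thesis using assms by (simp add: k_eq power_mult_distrib)
qed

lemma norm_powr: "((norm (x::'a))\<^sup>2) powr (m - 1) = norm x ^ (n - 2)"
  using power2_powr_half_dim[of "norm x" n] n3 by (simp add: m_def)

lemma m_ge: "m \<ge> 3 / 2" using n3 by (simp add: m_def)

lemmas dens_cont = density_continuous[OF k_mono k_nonneg]
lemmas dens_bounds = density_bounds[OF k_mono k_nonneg]
lemmas dens_integral = density_integral_bounds[OF k_mono k_nonneg]

definition D :: "real \<Rightarrow> real \<Rightarrow> real" where "D c = density k m c"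

definition W :: "real \<Rightarrow> real \<Rightarrow> real \<Rightarrow> 'a \<times> real \<Rightarrow> real" where
  "W \<tau>0 \<tau>1 c = heat_potential \<tau>0 \<tau>1 (D c)"

definition mass :: "real \<Rightarrow> real \<Rightarrow> real \<Rightarrow> real" where
  "mass \<tau>0 \<tau>1 c = integral {\<tau>0..\<tau>1} (\<lambda>\<tau>. D c \<tau> * \<tau> powr (- m))"

lemma D_cont: "0 < c \<Longrightarrow> 0 < \<tau>0 \<Longrightarrow> continuous_on {\<tau>0..\<tau>1} (D c)"
  unfolding D_def by (rule dens_cont)

lemma D_nonneg: "0 < c \<Longrightarrow> 0 < \<tau>0 \<Longrightarrow> \<forall>\<tau>\<in>{\<tau>0..\<tau>1}. D c \<tau> \<ge> 0"
  unfolding D_def by (intro ballI dens_bounds) auto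

lemma dim3: "DIM('a) \<ge> 3" using n3 n_def by simp

lemma W_classical: "0 < c \<Longrightarrow> 0 < \<tau>0 \<Longrightarrow> heat_classical {z. fst z \<noteq> (0::'a)} (W \<tau>0 \<tau>1 c)"
  unfolding W_def by (intro heat_potential_classical D_cont)

text \<open>\<open>b\<close> is 1 minus the potential divided by \<open>N\<close>, an upper bound
  for it on the region. A potential of a finite segment cannot reach its supremum bound exactly, so
  the barrier depends on the tolerance \<epsilon>; regularity is deduced from the whole
  family.\<close>

lemma barrier:
  assumes inf: "(\<integral>\<^sup>+ \<tau>\<in>{0<..1}. ennreal (k \<tau> / \<tau>) \<partial>lborel) = \<infinity>"
    and \<epsilon>: "0 < \<epsilon>" "\<epsilon> < 1" and \<eta>: "\<eta> > 0"
  shows "\<exists>b. heat_classical {z. fst z \<noteq> (0::'a)} b \<and> (\<forall>z\<in>Phi \<rho>. 0 \<le> b z) \<and>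
    (\<forall>z\<in>Phi \<rho>. \<eta> \<le> norm (fst z) \<or> snd z \<le> - \<eta> \<longrightarrow> 1 - \<epsilon> \<le> b z) \<and>
    (\<forall>\<^sub>F z in at (0, 0) within Phi \<rho>. b z \<le> \<epsilon>)"
proof -
  \<comment> \<open>With \<open>1 - 1 / L = s\<close> the old sources cost the factor
    \<open>s powr (- m) = 1 / (1 - \<epsilon> / 2)\<close>, which leaves the gap \<gamma> below the
    admissible \<open>1 / (1 - \<epsilon>)\<close>.\<close>
  define s where "s = (1 - \<epsilon> / 2) powr (1 / m)"
  have s: "0 < s" "s < 1"
    using \<epsilon> m_ge powr_less_mono2[of "1 / m" "1 - \<epsilon> / 2" 1] by (auto simp: s_def)
  have sm: "s powr (- m) = 1 / (1 - \<epsilon> / 2)"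
    using \<epsilon> m_ge by (simp add: s_def powr_powr powr_minus_divide)
  define L where "L = 1 / (1 - s)"
  have L: "L > 1" "1 - 1 / L = s" using s by (auto simp: L_def)
  \<comment> \<open>Averaging doubles the argument of \<open>k\<close>, so \<open>D c \<tau>\<close>
    involves \<open>k\<close> only up to \<open>\<tau> / L\<close>, which is at most
    \<open>T\<close> when \<open>\<tau> \<le> L * T\<close>.\<close>
  define c where "c = 1 / (2 * L)"
  have c: "c > 0" "2 * c = 1 / L" using L by (auto simp: c_def)
  \<comment> \<open>No source is older than \<eta>, so the potential vanishes at all times up to
    \<open>- \<eta>\<close>.\<close>
  define \<tau>1 where "\<tau>1 = min \<eta> 1"
  have \<tau>1: "0 < \<tau>1" "\<tau>1 \<le> \<eta>" "\<tau>1 \<le> 1" using \<eta> by (auto simp: \<tau>1_def)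
  define P where "P = pi * heat_const n"
  have P: "P > 0" using heat_const_pos by (simp add: P_def)
  define K1 where "K1 = L powr (m - 1) * P"
  define K2 where "K2 = k 1 * P * (\<eta>\<^sup>2) powr (1 - m)"
  have K: "K1 > 0" "K2 \<ge> 0" using P L \<eta> k_nonneg by (auto simp: K1_def K2_def)
  define \<gamma> where "\<gamma> = 1 / (1 - \<epsilon>) - 1 / (1 - \<epsilon> / 2)"
  have \<gamma>: "\<gamma> > 0" using \<epsilon> by (simp add: \<gamma>_def divide_strict_left_mono)
  \<comment> \<open>A mass above the first entry makes the potential at most
    \<open>\<epsilon> * N\<close> away from the origin; a mass above the second makes
    \<open>S\<close> exceed \<open>(1 - \<epsilon>) * N\<close>.\<close>
  define B where "B = max (K2 / \<epsilon>) (2 * (K1 + K2) / \<gamma>)"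
  have c\<tau>: "0 < c * \<tau>1" "c * \<tau>1 \<le> 1"
    using c \<tau>1 L by (auto simp: c_def field_simps)
  obtain \<alpha> where \<alpha>: "0 < \<alpha>" "\<alpha> < c * \<tau>1" "B \<le> integral {\<alpha>..c * \<tau>1} (\<lambda>\<sigma>. k \<sigma> / \<sigma>)"
    using divergent_integral[OF k_mono k_nonneg inf c\<tau>] by blast
  define \<tau>0 where "\<tau>0 = \<alpha> / c"
  have \<tau>0: "0 < \<tau>0" "\<tau>0 \<le> \<tau>1" "c * \<tau>0 = \<alpha>" using \<alpha> c by (auto simp: \<tau>0_def field_simps)
  define S where "S = mass \<tau>0 \<tau>1 c"
  have SB: "S \<ge> B"
    using \<alpha>(3) dens_integral(1)[OF c(1) \<tau>0(1,2), of m] by (simp add: S_def mass_def D_def \<tau>0(3))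
  have "B > 0" using K \<gamma> by (auto simp: B_def less_max_iff_disj)
  then have S: "S > 0" using SB by simp
  define \<kappa> where "\<kappa> = 1 / (1 - \<epsilon> / 2)"
  have \<kappa>: "\<kappa> \<ge> 1" using \<epsilon> by (simp add: \<kappa>_def)
  define N where "N = K1 + K2 + \<kappa> * S"
  have N: "N > 0" using K \<kappa> S by (simp add: N_def add_pos_nonneg add_nonneg_pos)
  have "1 * S \<le> \<kappa> * S" using \<kappa> S by (intro mult_right_mono) auto
  then have NS: "S \<le> N" using K by (simp add: N_def)
  let ?W = "W \<tau>0 \<tau>1 c"
  note hyp = D_cont[OF c(1) \<tau>0(1)] D_nonneg[OF c(1) \<tau>0(1)] \<tau>0(1,2) dim3
  have Wnn: "?W (x, - T) \<ge> 0" if "x \<noteq> 0" for x T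
    unfolding W_def by (rule heat_potential_nonneg[OF hyp that])
  have Dle: "D c \<tau> \<le> \<tau> powr (m - 1) * k (\<tau> / L)" if "\<tau> > 0" for \<tau>
    using dens_bounds(3)[OF c(1) that, of m] by (simp add: D_def c(2))
  have Wle: "?W (x, - T) \<le> N" if z: "(x, - T) \<in> Phi \<rho>" for x T
  proof -
    have x: "x \<noteq> 0" using Phi_sub z by force
    have T: "0 < T" "T < 1" "sqrt T * \<rho> T < norm x" using z by (auto simp: Phi_iff)
    \<comment> \<open>Dominates the density of the sources of age at most \<open>L * T\<close>,
      because \<open>(x, - T)\<close> lies outside the tube. Multiplied by the Newtonian kernel it
      no longer depends on \<open>x\<close> and leaves \<open>K1\<close>.\<close>
    define A where "A = L powr (m - 1) * ((norm x)\<^sup>2) powr (m - 1)"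
    have "?W (x, - T) \<le> A * (pi * heat_const (DIM('a)) * ((norm x)\<^sup>2) powr (1 - real DIM('a) / 2))
        + (1 - 1 / L) powr (- (real DIM('a) / 2)) * integral {\<tau>0..\<tau>1} (\<lambda>\<tau>. D c \<tau> * \<tau> powr (- (real DIM('a) / 2)))"
      unfolding W_def
    proof (rule heat_potential_le_near[OF hyp x])
      show "0 \<le> T" "1 < L" "0 \<le> A" using T L by (auto simp: A_def)
      fix \<tau> assume \<tau>: "\<tau> \<in> {\<tau>0..\<tau>1}" "T < \<tau>" "\<tau> \<le> L * T"
      then have "\<tau> > 0" using T by simp
      have "D c \<tau> \<le> \<tau> powr (m - 1) * k (\<tau> / L)" by (rule Dle[OF \<open>\<tau> > 0\<close>])
      also have "\<dots> \<le> (L * T) powr (m - 1) * k T"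
      proof (intro mult_mono powr_mono2)
        show "k (\<tau> / L) \<le> k T" using \<tau> L by (intro monoD[OF k_mono]) (simp add: field_simps)
      qed (use \<tau> \<open>\<tau> > 0\<close> m_ge k_nonneg in auto)
      also have "\<dots> = L powr (m - 1) * (T powr (m - 1) * k T)" by (simp add: powr_mult)
      also have "\<dots> = L powr (m - 1) * (sqrt T * \<rho> T) ^ (n - 2)" using T by (simp add: tube_power)
      also have "\<dots> \<le> L powr (m - 1) * norm x ^ (n - 2)"
        using T \<rho>pos[of T] by (intro mult_left_mono power_mono) auto
      also have "\<dots> = A" by (simp add: A_def norm_powr)
      finally show "D c \<tau> \<le> A" .
    qed
    also have "(1 - 1 / L) powr (- (real DIM('a) / 2)) = \<kappa>"
      using sm L(2) by (simp add: m_def \<kappa>_def flip: n_def)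
    also have "integral {\<tau>0..\<tau>1} (\<lambda>\<tau>. D c \<tau> * \<tau> powr (- (real DIM('a) / 2))) = S"
      by (simp add: S_def mass_def m_def flip: n_def)
    also have "A * (pi * heat_const (DIM('a)) * ((norm x)\<^sup>2) powr (1 - real DIM('a) / 2)) = K1"
    proof -
      have "((norm x)\<^sup>2) powr (m - 1) * ((norm x)\<^sup>2) powr (1 - m) = 1"
        using x powr_add[of "(norm x)\<^sup>2" "m - 1" "1 - m"] by simp
      then have "L powr (m - 1) * P * (((norm x)\<^sup>2) powr (m - 1) * ((norm x)\<^sup>2) powr (1 - m)) = K1"
        by (simp add: K1_def)
      then show ?thesis by (simp add: A_def P_def m_def mult_ac flip: n_def)
    qed
    finally show ?thesis using K by (simp add: N_def)
  qed
  have Wfar: "?W (x, - T) \<le> K2" if x: "x \<noteq> 0" and far: "\<eta> \<le> norm x \<or> \<eta> \<le> T" for x T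
    using far
  proof
    assume "\<eta> \<le> T"
    then have "?W (x, - T) = 0"
      unfolding W_def using \<tau>1 by (intro heat_potential_eq_0[OF hyp x]) auto
    then show ?thesis using K by simp
  next
    assume nx: "\<eta> \<le> norm x"
    have "?W (x, - T) \<le> k 1 * (pi * heat_const (DIM('a)) * ((norm x)\<^sup>2) powr (1 - real DIM('a) / 2))"
      unfolding W_def
    proof (rule heat_potential_le_all[OF hyp x k_nonneg])
      fix \<tau> assume \<tau>: "\<tau> \<in> {\<tau>0..\<tau>1}"
      then have p: "0 < \<tau>" "\<tau> \<le> 1" using \<tau>0 \<tau>1 by auto
      have "\<tau> / L \<le> 1" using p L by (simp add: field_simps)
      then have "\<tau> powr (m - 1) * k (\<tau> / L) \<le> 1 * k 1"
        using p m_ge k_nonneg by (intro mult_mono powr_le1 monoD[OF k_mono]) auto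
      then show "D c \<tau> \<le> k 1" using Dle[OF p(1)] by simp
    qed
    also have "\<dots> = k 1 * P * ((norm x)\<^sup>2) powr (1 - m)" by (simp add: P_def m_def flip: n_def)
    also have "\<dots> \<le> K2"
      unfolding K2_def using nx \<eta> P k_nonneg m_ge
      by (intro mult_left_mono powr_mono2') (auto intro!: power_mono)
    finally show ?thesis .
  qed
  define b where "b z = 1 + (- (1 / N)) * ?W z" for z
  have "heat_classical {z. fst z \<noteq> (0::'a)} b"
    unfolding b_def
    by (intro heat_classical_add heat_classical_const heat_classical_cmult W_classical c \<tau>0)
  moreover have "\<forall>z\<in>Phi \<rho>. 0 \<le> b z"
  proof
    fix z :: "'a \<times> real" assume "z \<in> Phi \<rho>"
    then show "0 \<le> b z" using Wle[of "fst z" "- snd z"] N by (simp add: b_def)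
  qed
  moreover have "\<forall>z\<in>Phi \<rho>. \<eta> \<le> norm (fst z) \<or> snd z \<le> - \<eta> \<longrightarrow> 1 - \<epsilon> \<le> b z"
  proof (intro ballI impI)
    fix z :: "'a \<times> real" assume z: "z \<in> Phi \<rho>" and far: "\<eta> \<le> norm (fst z) \<or> snd z \<le> - \<eta>"
    have "fst z \<noteq> 0" using Phi_sub z by auto
    then have "?W z \<le> K2" using Wfar[of "fst z" "- snd z"] far by auto
    also have "K2 \<le> \<epsilon> * B" using \<epsilon> by (simp add: B_def field_simps max_def)
    also have "\<dots> \<le> \<epsilon> * N" using \<epsilon> SB NS by (intro mult_left_mono) auto
    finally have "?W z / N \<le> \<epsilon>" using N by (simp add: divide_le_eq)
    then show "1 - \<epsilon> \<le> b z" by (simp add: b_def)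
  qed
  moreover have "\<forall>\<^sub>F z in at (0, 0) within Phi \<rho>. b z \<le> \<epsilon>"
  proof -
    \<comment> \<open>\<open>\<theta> * S\<close> is the value that the potential has to reach for
      \<open>b \<le> \<epsilon>\<close>. As \<theta> is below 1, continuity of the Gaussian factor
      at the origin suffices.\<close>
    define \<theta> where "\<theta> = (1 - \<epsilon>) * (\<kappa> + (K1 + K2) / S)"
    have "(K1 + K2) / S < \<gamma>"
    proof -
      have "2 * (K1 + K2) / \<gamma> \<le> S" using SB by (simp add: B_def)
      then have "2 * (K1 + K2) \<le> S * \<gamma>" using \<gamma> by (simp add: divide_le_eq)
      moreover have "K1 + K2 < 2 * (K1 + K2)" using K by simp
      ultimately have "K1 + K2 < S * \<gamma>" by (rule less_le_trans[rotated])
      then show ?thesis using S by (simp add: divide_less_eq mult.commute)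
    qed
    then have "\<theta> < (1 - \<epsilon>) * (\<kappa> + \<gamma>)" unfolding \<theta>_def using \<epsilon> by (intro mult_strict_left_mono) auto
    also have "\<dots> = 1" using \<epsilon> by (simp add: \<kappa>_def \<gamma>_def)
    finally have \<theta>: "\<theta> < 1" .
    have \<theta>N: "\<theta> * S = (1 - \<epsilon>) * N" using S by (simp add: \<theta>_def N_def field_simps)
    have "((\<lambda>z::'a \<times> real. exp (- (norm (fst z))\<^sup>2 / (2 * \<tau>0))) \<longlongrightarrow> exp (- (norm (fst (0::'a, 0::real)))\<^sup>2 / (2 * \<tau>0))) (at (0, 0) within Phi \<rho>)"
      using \<tau>0 by (intro tendsto_intros) auto
    then have "\<forall>\<^sub>F z in at (0::'a, 0) within Phi \<rho>. exp (- (norm (fst z))\<^sup>2 / (2 * \<tau>0)) > \<theta>"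
      by (rule order_tendstoD) (use \<theta> in simp)
    moreover have "(snd \<longlongrightarrow> snd (0::'a, 0::real)) (at (0::'a, 0) within Phi \<rho>)"
      using tendsto_snd[OF tendsto_ident_at[of "(0::'a, 0::real)" "Phi \<rho>"]] by simp
    then have "\<forall>\<^sub>F z in at (0::'a, 0) within Phi \<rho>. snd z > - \<tau>0 / 2"
      by (rule order_tendstoD) (use \<tau>0 in simp)
    moreover have "\<forall>\<^sub>F z in at (0::'a, 0) within Phi \<rho>. z \<in> Phi \<rho>"
      by (simp add: eventually_at_filter)
    ultimately show ?thesis
    proof eventually_elim
      case (elim z)
      have x: "fst z \<noteq> 0" using Phi_sub elim by auto
      have T: "0 \<le> - snd z" "- snd z \<le> \<tau>0 / 2" using elim Phi_iff[of "fst z" "snd z" \<rho>] by auto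
      have "exp (- (norm (fst z))\<^sup>2 / (2 * \<tau>0)) * S \<le> ?W (fst z, - (- snd z))"
        using heat_potential_ge_origin[OF hyp x T] by (simp add: W_def S_def mass_def m_def flip: n_def)
      moreover have "\<theta> * S \<le> exp (- (norm (fst z))\<^sup>2 / (2 * \<tau>0)) * S"
        using elim S by (intro mult_right_mono) auto
      ultimately have "(1 - \<epsilon>) * N \<le> ?W z" using \<theta>N by simp
      then have "1 - \<epsilon> \<le> ?W z / N" using N by (simp add: le_divide_eq)
      then show ?case by (simp add: b_def)
    qed
  qed
  ultimately show ?thesis by blast
qed

section \<open>Regularity and irregularity of the origin\<close>

lemma compact_frontier: "compact (frontier (Phi \<rho> :: ('a \<times> real) set))"
  using bounded_Phi by (rule compact_frontier_bounded)

lemma small_\<rho>: "\<epsilon> > 0 \<Longrightarrow> \<exists>T0. 0 < T0 \<and> T0 \<le> 1 \<and> (\<forall>T. 0 < T \<longrightarrow> T \<le> T0 \<longrightarrow> \<rho> T < \<epsilon>)"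
proof -
  assume "\<epsilon> > 0"
  then have "\<forall>\<^sub>F T in at_right 0. \<rho> T < \<epsilon>" using order_tendstoD(2)[OF \<rho>0] by blast
  then obtain d where "d > 0" "\<And>T. 0 < T \<Longrightarrow> T < d \<Longrightarrow> \<rho> T < \<epsilon>"
    by (auto simp: eventually_at_right_field)
  then show ?thesis by (intro exI[of _ "min (d / 2) 1"]) auto
qed

text \<open>Where \<open>\<rho> T < 1\<close> the parabola runs outside the tube. It shows that the
  origin is a limit point of the region, and it is the path along which the Perron solution will
  miss its boundary value.\<close>

lemma parabola_in_Phi:
  obtains T0 e where "0 < T0" "T0 \<le> 1" "norm (e::'a) = 1"
    "\<And>T. 0 < T \<Longrightarrow> T \<le> T0 \<Longrightarrow> (sqrt T *\<^sub>R e, - T) \<in> Phi \<rho>"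
proof -
  obtain T0 where T0: "0 < T0" "T0 \<le> 1" "\<And>T. 0 < T \<Longrightarrow> T \<le> T0 \<Longrightarrow> \<rho> T < 1"
    using small_\<rho>[of 1] by auto
  obtain e :: 'a where e: "norm e = 1" using vector_choose_size[of 1] by auto
  have r1: "\<rho> 1 > 0" by (rule \<rho>pos) auto
  define T1 where "T1 = min (T0 / 2) ((\<rho> 1)\<^sup>2 / 2)"
  have T1: "0 < T1" "T1 \<le> T0" "T1 < 1" "T1 < (\<rho> 1)\<^sup>2" using T0 r1 by (auto simp: T1_def min_def)
  have "(sqrt T *\<^sub>R e, - T) \<in> Phi \<rho>" if "0 < T" "T \<le> T1" for T
  proof -
    have "sqrt T < \<rho> 1" using that T1 r1 by (intro real_less_lsqrt) auto
    moreover have "sqrt T * \<rho> T < sqrt T * 1" using that T0(3)[of T] T1 by (intro mult_strict_left_mono) auto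
    ultimately show ?thesis using that T1 e by (simp add: Phi_iff)
  qed
  then show thesis using that[of T1 e] T1 e by auto
qed

lemma parabola_tendsto:
  assumes "\<And>T. 0 < T \<Longrightarrow> T \<le> T0 \<Longrightarrow> (sqrt T *\<^sub>R e, - T) \<in> Phi \<rho>" "0 < T0"
  shows "filterlim (\<lambda>T. (sqrt T *\<^sub>R (e::'a), - T)) (at (0, 0) within Phi \<rho>) (at_right 0)"
  unfolding filterlim_at
proof
  show "\<forall>\<^sub>F T in at_right 0. (sqrt T *\<^sub>R e, - T) \<in> Phi \<rho> \<and> (sqrt T *\<^sub>R e, - T) \<noteq> (0, 0)"
    unfolding eventually_at_right_field using assms by (intro exI[of _ T0]) auto
  show "((\<lambda>T. (sqrt T *\<^sub>R e, - T)) \<longlongrightarrow> (0, 0)) (at_right 0)"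
    by (auto intro!: tendsto_eq_intros)
qed

lemma origin_frontier: "(0, 0) \<in> frontier (Phi \<rho> :: ('a \<times> real) set)"
proof -
  obtain T0 e where T0: "0 < T0" "T0 \<le> 1" "norm (e::'a) = 1"
    "\<And>T. 0 < T \<Longrightarrow> T \<le> T0 \<Longrightarrow> (sqrt T *\<^sub>R e, - T) \<in> Phi \<rho>"
    using parabola_in_Phi by blast
  have "at (0::'a, 0::real) within Phi \<rho> \<noteq> bot"
  proof
    assume "at (0::'a, 0::real) within Phi \<rho> = bot"
    then have "filterlim (\<lambda>T. (sqrt T *\<^sub>R e, - T)) bot (at_right 0)"
      using parabola_tendsto[OF T0(4,1)] by simp
    then show False by (simp add: filterlim_def bot_unique filtermap_bot_iff)
  qed
  then have "(0, 0) islimpt (Phi \<rho> :: ('a \<times> real) set)" by (simp add: trivial_limit_within)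
  then have "(0, 0) \<in> closure (Phi \<rho> :: ('a \<times> real) set)" by (simp add: closure_def)
  moreover have "(0, 0) \<notin> (Phi \<rho> :: ('a \<times> real) set)" by (simp add: Phi_iff)
  ultimately show ?thesis using opn by (simp add: frontier_def interior_open)
qed

text \<open>\<open>f0 + e / 2 + G * b\<close> belongs to the upper class, and
  \<open>f0 - e / 2 - G * b\<close> lies below each of its members. Both follow from
  \<open>near\<close>, an inequality for \<open>b\<close> inside the region close to a frontier
  point, so that \<open>b\<close> needs no boundary values.\<close>

lemma divergent_imp_regular:
  assumes inf: "(\<integral>\<^sup>+ \<tau>\<in>{0<..1}. ennreal (k \<tau> / \<tau>) \<partial>lborel) = \<infinity>"
  shows "regular_point 2 (Phi \<rho> :: ('a \<times> real) set) (0, 0)"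
  unfolding regular_point_def
proof (intro conjI allI impI origin_frontier)
  fix f :: "'a \<times> real \<Rightarrow> real" assume f: "continuous_on (frontier (Phi \<rho>)) f"
  let ?\<Phi> = "Phi \<rho> :: ('a \<times> real) set"
  let ?F = "at (0::'a, 0::real) within ?\<Phi>"
  define f0 where "f0 = f (0, 0)"
  have "bounded (f ` frontier ?\<Phi>)"
    by (intro compact_imp_bounded compact_continuous_image f compact_frontier)
  then obtain M0 where M0: "\<And>\<xi>. \<xi> \<in> frontier ?\<Phi> \<Longrightarrow> \<bar>f \<xi>\<bar> \<le> M0" by (auto simp: bounded_iff)
  define M where "M = \<bar>M0\<bar> + 1"
  have M: "M > 0" "\<And>\<xi>. \<xi> \<in> frontier ?\<Phi> \<Longrightarrow> \<bar>f \<xi>\<bar> \<le> M" using M0 by (force simp: M_def)+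
  have main: "\<forall>\<^sub>F z in ?F. ereal (f0 - e) \<le> upper_perron 2 ?\<Phi> f z \<and> upper_perron 2 ?\<Phi> f z \<le> ereal (f0 + e)"
    if e: "e > 0" for e
  proof -
    obtain \<delta> where \<delta>: "\<delta> > 0" "\<And>\<xi>. \<xi> \<in> frontier ?\<Phi> \<Longrightarrow> dist \<xi> (0, 0) < \<delta> \<Longrightarrow> dist (f \<xi>) f0 < e / 2"
      using f[unfolded continuous_on_iff, rule_format, OF origin_frontier, of "e / 2"] e by (auto simp: f0_def)
    \<comment> \<open>\<open>G\<close> is chosen so that \<open>G * b\<close> reaches the
      oscillation bound \<open>2 * M\<close> of \<open>f\<close> where
      \<open>b \<ge> 1 - \<epsilon>\<close>. Since \<open>\<epsilon> \<le> 1 / 2\<close> gives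
      \<open>G \<le> 4 * M\<close>, the second entry makes \<open>G * \<epsilon>\<close> at most
      \<open>e / 2\<close> near the origin.\<close>
    define \<epsilon> where "\<epsilon> = min (1 / 2) (e / (8 * M))"
    have \<epsilon>: "0 < \<epsilon>" "\<epsilon> < 1" "\<epsilon> \<le> 1 / 2" "\<epsilon> \<le> e / (8 * M)" using e M by (auto simp: \<epsilon>_def)
    define G where "G = 2 * M / (1 - \<epsilon>)"
    have G: "G > 0" "G * (1 - \<epsilon>) = 2 * M" using \<epsilon> M by (auto simp: G_def)
    have G\<epsilon>: "G * \<epsilon> \<le> e / 2"
    proof -
      have "G \<le> 4 * M" using \<epsilon> M by (simp add: G_def divide_le_eq algebra_simps)
      then have "G * \<epsilon> \<le> 4 * M * (e / (8 * M))" using \<epsilon> M G by (intro mult_mono) auto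
      then show ?thesis using M by simp
    qed
    obtain b where b: "heat_classical {z. fst z \<noteq> (0::'a)} b" "\<And>z. z \<in> ?\<Phi> \<Longrightarrow> 0 \<le> b z"
      "\<And>z. z \<in> ?\<Phi> \<Longrightarrow> \<delta> / 3 \<le> norm (fst z) \<or> snd z \<le> - (\<delta> / 3) \<Longrightarrow> 1 - \<epsilon> \<le> b z"
      "\<forall>\<^sub>F z in ?F. b z \<le> \<epsilon>"
      using barrier[OF inf \<epsilon>(1,2), of "\<delta> / 3"] \<delta>(1) by auto
    have bc: "heat_classical ?\<Phi> b"
      by (rule heat_classical_subset[OF b(1) Phi_sub])
    have near: "\<forall>\<^sub>F z in at \<xi> within ?\<Phi>. \<bar>f \<xi> - f0\<bar> \<le> e / 2 + G * b z" if \<xi>: "\<xi> \<in> frontier ?\<Phi>" for \<xi>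
    proof (cases "dist \<xi> (0, 0) < \<delta>")
      case True
      have "\<forall>\<^sub>F z in at \<xi> within ?\<Phi>. z \<in> ?\<Phi>" by (simp add: eventually_at_filter)
      then show ?thesis
      proof eventually_elim
        case (elim z)
        have "\<bar>f \<xi> - f0\<bar> < e / 2" using \<delta>(2)[OF \<xi> True] by (simp add: dist_real_def)
        moreover have "G * b z \<ge> 0" using G b(2)[OF elim] by simp
        ultimately show ?case by simp
      qed
    next
      case False
      have "\<forall>\<^sub>F z in at \<xi> within ?\<Phi>. z \<in> ?\<Phi> \<and> dist z \<xi> < \<delta> / 3"
        unfolding eventually_at using \<delta>(1) by (intro exI[of _ "\<delta> / 3"]) auto
      then show ?thesis
      proof eventually_elim
        case (elim z)
        \<comment> \<open>One third of \<delta> is lost between \<xi> and \<open>z\<close>; the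
          other two thirds force the space or the time coordinate of \<open>z\<close> to be at least
          \<open>\<delta> / 3\<close> in size.\<close>
        have "dist \<xi> (0, 0) \<le> dist z \<xi> + dist z (0, 0)" by (metis dist_commute dist_triangle)
        then have "norm z > 2 * (\<delta> / 3)" using False elim by (simp add: dist_norm zero_prod_def[symmetric])
        moreover have "norm z \<le> norm (fst z) + \<bar>snd z\<bar>"
          using norm_Pair_le[of "fst z" "snd z"] by simp
        moreover have "snd z < 0" using elim Phi_iff[of "fst z" "snd z" \<rho>] by simp
        ultimately have "\<delta> / 3 \<le> norm (fst z) \<or> snd z \<le> - (\<delta> / 3)" by linarith
        then have "1 - \<epsilon> \<le> b z" using b(3) elim by blast
        then have "G * (1 - \<epsilon>) \<le> G * b z" using G by (intro mult_left_mono) auto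
        then have "2 * M \<le> G * b z" using G by simp
        moreover have "\<bar>f \<xi> - f0\<bar> \<le> 2 * M" using M(2)[OF \<xi>] M(2)[OF origin_frontier] by (simp add: f0_def)
        ultimately show ?case using e by simp
      qed
    qed
    define up where "up z = (f0 + e / 2) + G * b z" for z
    define low where "low z = (f0 - e / 2) + (- G) * b z" for z
    have upc: "heat_classical ?\<Phi> up" and lowc: "heat_classical ?\<Phi> low"
      unfolding up_def low_def by (intro heat_classical_add heat_classical_const heat_classical_cmult bc)+
    have "(\<lambda>z. ereal (up z)) \<in> upper_class 2 ?\<Phi> f"
      unfolding upper_class_def
    proof (intro CollectI conjI ballI heat_classical_superparabolic opn upc)
      fix \<xi> assume "\<xi> \<in> frontier ?\<Phi>"
      from near[OF this] have "\<forall>\<^sub>F z in at \<xi> within ?\<Phi>. ereal (f \<xi>) \<le> ereal (up z)"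
        by eventually_elim (auto simp: up_def abs_le_iff)
      then show "ereal (f \<xi>) \<le> Liminf (at \<xi> within ?\<Phi>) (\<lambda>z. ereal (up z))"
        by (rule Liminf_bounded)
    qed
    then have up_le: "upper_perron 2 ?\<Phi> f z \<le> ereal (up z)" for z
      unfolding upper_perron_def by (rule INF_lower)
    have low_le: "ereal (low z) \<le> upper_perron 2 ?\<Phi> f z" if z: "z \<in> ?\<Phi>" for z
      unfolding upper_perron_def
    proof (rule INF_greatest)
      fix u assume u: "u \<in> upper_class 2 ?\<Phi> f"
      show "ereal (low z) \<le> u z"
      \<comment> \<open>The region lies before time 0, so comparison up to time 0 covers all of it
        and consults only frontier points with negative time.\<close>
      proof (rule superparabolic_ge_classical[OF opn bounded_Phi _ lowc, where T = 0])
        show "superparabolic 2 ?\<Phi> u" using u by (simp add: upper_class_def)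
        show "snd z < 0" using z Phi_iff[of "fst z" "snd z" \<rho>] by simp
        fix \<xi> e' assume \<xi>: "\<xi> \<in> frontier ?\<Phi>" "snd \<xi> < 0" and e': "e' > (0::real)"
        have "ereal (f \<xi> - e') < Liminf (at \<xi> within ?\<Phi>) u"
          by (rule less_le_trans[of _ "ereal (f \<xi>)"]) (use u \<xi> e' in \<open>auto simp: upper_class_def\<close>)
        then have "\<forall>\<^sub>F w in at \<xi> within ?\<Phi>. ereal (f \<xi> - e') < u w" by (rule less_LiminfD)
        with near[OF \<xi>(1)] show "\<forall>\<^sub>F w in at \<xi> within ?\<Phi>. ereal (low w - e') \<le> u w"
        proof eventually_elim
          case (elim w)
          then have "ereal (low w - e') \<le> ereal (f \<xi> - e')" by (auto simp: low_def abs_le_iff)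
          then show ?case by (rule order_trans) (use elim in \<open>simp add: less_imp_le\<close>)
        qed
      qed (rule z)
    qed
    have "\<forall>\<^sub>F z in ?F. z \<in> ?\<Phi>" by (simp add: eventually_at_filter)
    with b(4) show ?thesis
    proof eventually_elim
      case (elim z)
      have "G * b z \<le> G * \<epsilon>" using elim(1) G by (intro mult_left_mono) auto
      then have "G * b z \<le> e / 2" using G\<epsilon> by linarith
      then have "f0 - e \<le> low z" "up z \<le> f0 + e" by (auto simp: low_def up_def)
      then have "ereal (f0 - e) \<le> ereal (low z)" "ereal (up z) \<le> ereal (f0 + e)" by auto
      then show ?case
        using order_trans[OF _ low_le[OF elim(2)]] order_trans[OF up_le[of z]] by blast
    qed
  qed
  show "(upper_perron 2 ?\<Phi> f \<longlongrightarrow> ereal (f (0, 0))) ?F"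
  proof (rule order_tendstoI)
    fix y assume "y < ereal (f (0, 0))"
    then obtain r where "y < ereal r" "r < f0" using ereal_dense2 unfolding f0_def by force
    from main[of "f0 - r"] \<open>r < f0\<close> show "\<forall>\<^sub>F z in ?F. y < upper_perron 2 ?\<Phi> f z"
      by (auto elim!: eventually_mono intro: less_le_trans[OF \<open>y < ereal r\<close>])
  next
    fix y assume "ereal (f (0, 0)) < y"
    then obtain r where "ereal r < y" "f0 < r" using ereal_dense2 unfolding f0_def by force
    from main[of "r - f0"] \<open>f0 < r\<close> show "\<forall>\<^sub>F z in ?F. upper_perron 2 ?\<Phi> f z < y"
      by (auto elim!: eventually_mono intro: le_less_trans[OF _ \<open>ereal r < y\<close>])
  qed
qed

text \<open>\<open>1 - A * W\<close> is at most 1 everywhere off the axis, at most 0 on the tube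
  near the origin, and at least 1/2 on the parabola. The boundary function \<open>f\<close> vanishes
  at the origin and is at least 1 outside the ball of radius \<open>d\<close>, so it dominates
  \<open>1 - A * W\<close> at all frontier points before the cut-off time.\<close>

lemma convergent_imp_irregular:
  assumes fin: "(\<integral>\<^sup>+ \<tau>\<in>{0<..1}. ennreal (k \<tau> / \<tau>) \<partial>lborel) \<noteq> \<infinity>"
  shows "\<not> regular_point 2 (Phi \<rho> :: ('a \<times> real) set) (0, 0)"
proof
  let ?\<Phi> = "Phi \<rho> :: ('a \<times> real) set"
  let ?F = "at (0::'a, 0::real) within ?\<Phi>"
  assume reg: "regular_point 2 ?\<Phi> (0, 0)"
  \<comment> \<open>Normalizes the lower bound of \<open>heat_potential_ge_tube\<close> to 1;
    \<open>e0\<close> is then the mass for which the bound of \<open>heat_potential_le_diag\<close>,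
    times \<open>A\<close>, is 1/2.\<close>
  define A where "A = 2 * exp (1 / 2 :: real)"
  have A: "A > 0" "A * (exp (- (1 / 2)) / 2) = 1" by (auto simp: A_def exp_minus)
  define e0 where "e0 = 1 / (2 * A * heat_const n)"
  have e0: "e0 > 0" "A * (heat_const n * e0) = 1 / 2" using A heat_const_pos[of n] by (auto simp: e0_def)
  obtain \<beta> where \<beta>: "0 < \<beta>" "\<beta> \<le> 1" "\<And>\<alpha>. 0 < \<alpha> \<Longrightarrow> \<alpha> \<le> \<beta> \<Longrightarrow> integral {\<alpha>..\<beta>} (\<lambda>\<sigma>. k \<sigma> / \<sigma>) \<le> e0"
    using convergent_integral[OF k_mono k_nonneg fin e0(1)] by blast
  \<comment> \<open>Half of \<beta>, because averaging doubles the argument of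
    \<open>k\<close>.\<close>
  define \<tau>1 where "\<tau>1 = \<beta> / 2"
  have \<tau>1: "0 < \<tau>1" "2 * \<tau>1 = \<beta>" using \<beta> by (auto simp: \<tau>1_def)
  have massle: "mass \<tau>0 \<tau>1 1 \<le> e0" if "0 < \<tau>0" "\<tau>0 \<le> \<tau>1" for \<tau>0
    using dens_integral(2)[of 1 \<tau>0 \<tau>1 m] \<beta>(3)[of "2 * \<tau>0"] that \<tau>1 by (simp add: mass_def D_def)
  obtain T0 where T0: "0 < T0" "T0 \<le> 1" "\<And>T. 0 < T \<Longrightarrow> T \<le> T0 \<Longrightarrow> \<rho> T < 1"
    using small_\<rho>[of 1] by auto
  have r1: "\<rho> 1 > 0" by (rule \<rho>pos) auto
  \<comment> \<open>Frontier points in the ball of radius \<open>d\<close> and at negative time stay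
    clear of \<open>norm x = \<rho> 1\<close> and of the initial time, so they lie in the tube.
    There \<open>norm x \<le> sqrt T\<close>, and the sources up to age
    \<open>T + (norm x)\<^sup>2 \<le> 2 * d\<close> are still on the segment.\<close>
  define d where "d = min (min (T0 / 2) (\<rho> 1 / 2)) (\<tau>1 / 2)"
  have d: "d > 0" "d < T0" "d < 1" "d < \<rho> 1" "2 * d \<le> \<tau>1" using T0 r1 \<tau>1 by (auto simp: d_def min_def)
  define f where "f z = norm z / d" for z :: "'a \<times> real"
  have f_nonneg: "f z \<ge> 0" for z using d by (simp add: f_def)
  have low: "ereal (1 - A * W \<tau>0 \<tau>1 1 z) \<le> u z"
    if u: "u \<in> upper_class 2 ?\<Phi> f" and \<tau>0: "0 < \<tau>0" "\<tau>0 \<le> \<tau>1" and z: "z \<in> ?\<Phi>" "snd z < - \<tau>0" for u \<tau>0 z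
  proof -
    define v where "v z = 1 + (- A) * W \<tau>0 \<tau>1 1 z" for z
    have one: "(0::real) < 1" by simp
    have vc': "heat_classical {z. fst z \<noteq> (0::'a)} v"
      unfolding v_def by (intro heat_classical_add heat_classical_const heat_classical_cmult W_classical \<tau>0 one)
    have vc: "heat_classical ?\<Phi> v" by (rule heat_classical_subset[OF vc' Phi_sub])
    note hyp = D_cont[OF one \<tau>0(1)] D_nonneg[OF one \<tau>0(1)] \<tau>0 dim3
    have v1: "v (x, - T) \<le> 1" if "x \<noteq> 0" for x T
    proof -
      have "0 \<le> W \<tau>0 \<tau>1 1 (x, - T)" unfolding W_def by (rule heat_potential_nonneg[OF hyp that])
      then show ?thesis using A by (simp add: v_def)
    qed
    have key: "\<forall>\<^sub>F w in at \<xi> within ?\<Phi>. v w \<le> f \<xi> + e'"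
      if \<xi>: "\<xi> \<in> frontier ?\<Phi>" "snd \<xi> < - \<tau>0" and e': "e' > 0" for \<xi> e'
    proof (cases "norm \<xi> \<ge> d")
      case True
      have "\<forall>\<^sub>F w in at \<xi> within ?\<Phi>. w \<in> ?\<Phi>" by (simp add: eventually_at_filter)
      then show ?thesis
      proof eventually_elim
        case (elim w)
        then have "fst w \<noteq> 0" using Phi_sub by auto
        then have "v w \<le> 1" using v1[of "fst w" "- snd w"] by simp
        moreover have "f \<xi> \<ge> 1" using True d by (simp add: f_def)
        ultimately show ?case using e' by simp
      qed
    next
      case False
      obtain x T where xT: "\<xi> = (x, - T)" by (cases \<xi>) (metis add.inverse_inverse)
      have n\<xi>: "norm x < d" "\<bar>T\<bar> < d"
        using False norm_fst_le[of x "- T"] norm_snd_le[of "- T" x] by (auto simp: xT)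
      have T: "\<tau>0 < T" "0 < T" "T < d" using \<xi>(2) \<tau>0 n\<xi> by (auto simp: xT)
      have "\<xi> \<notin> ?\<Phi>" using \<xi>(1) opn by (simp add: frontier_def interior_open)
      then have xr: "norm x \<le> sqrt T * \<rho> T" using T n\<xi> d by (auto simp: xT Phi_iff not_less)
      have "x \<noteq> 0"
      proof
        assume x0: "x = 0"
        \<comment> \<open>At times up to \<open>- T / 2\<close> the tube has radius at least
          \<open>c\<close> by monotonicity, so points of the region cannot approach the axis at time
          \<open>- T\<close>.\<close>
        define c where "c = sqrt (T / 2) * \<rho> (T / 2)"
        have c: "c > 0" using T d T0 \<rho>pos[of "T / 2"] by (simp add: c_def)
        have "\<xi> \<in> closure ?\<Phi>" using \<xi>(1) by (simp add: frontier_def)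
        then obtain w where w: "w \<in> ?\<Phi>" "dist w \<xi> < min c (T / 2)"
          using c T unfolding closure_approachable by (metis half_gt_zero min_less_iff_conj)
        obtain y S where yS: "w = (y, - S)" by (cases w) (metis add.inverse_inverse)
        have "dist y x < c" "dist (- S) (- T) < T / 2"
          using w(2) dist_fst_le[of w \<xi>] dist_snd_le[of w \<xi>] by (auto simp: yS xT)
        then have "norm y < c" "\<bar>T - S\<bar> < T / 2" by (auto simp: x0 dist_real_def)
        then have y: "norm y < c" "T / 2 \<le> S" by linarith+
        have S: "0 < S" "S < 1" "sqrt S * \<rho> S < norm y" using w(1) by (auto simp: yS Phi_iff)
        have "c \<le> sqrt S * \<rho> S"
          unfolding c_def using y T S \<rho>pos[of "T / 2"] by (intro mult_mono \<rho>le) auto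
        then show False using y S by simp
      qed
      have "W \<tau>0 \<tau>1 1 (x, - T) \<ge> exp (- (1 / 2)) / 2"
        unfolding W_def
      proof (rule heat_potential_ge_tube[OF hyp \<open>x \<noteq> 0\<close>])
        have "\<rho> T < 1" "\<rho> T > 0" using T d T0 \<rho>pos[of T] by auto
        then have "sqrt T * \<rho> T \<le> sqrt T * 1" using T by (intro mult_left_mono) auto
        then have "norm x \<le> sqrt T" using xr by linarith
        then have q: "(norm x)\<^sup>2 \<le> T" using T real_sqrt_pow2[of T] by (metis less_imp_le norm_ge_zero power_mono)
        show "\<tau>0 \<le> T" "T + (norm x)\<^sup>2 \<le> \<tau>1" using T q d by auto
        fix \<tau> assume \<tau>: "\<tau> \<in> {T..T + (norm x)\<^sup>2}"
        have "((norm x)\<^sup>2) powr (real DIM('a) / 2 - 1) = norm x ^ (n - 2)"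
          using norm_powr[of x] by (simp add: m_def flip: n_def)
        also have "\<dots> \<le> (sqrt T * \<rho> T) ^ (n - 2)" using xr by (intro power_mono) auto
        also have "\<dots> = T powr (m - 1) * k T" using T d by (simp add: tube_power)
        also have "\<dots> \<le> \<tau> powr (m - 1) * k (1 * \<tau>)"
          using \<tau> T m_ge k_nonneg by (intro mult_mono powr_mono2 monoD[OF k_mono]) auto
        also have "\<dots> \<le> D 1 \<tau>" unfolding D_def using \<tau> T by (intro dens_bounds) auto
        finally show "((norm x)\<^sup>2) powr (real DIM('a) / 2 - 1) \<le> D 1 \<tau>" .
      qed
      then have "A * W \<tau>0 \<tau>1 1 (x, - T) \<ge> 1" using A mult_left_mono[of "exp (- (1 / 2)) / 2" _ A] by simp
      then have v0: "v \<xi> \<le> 0" by (simp add: v_def xT)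
      \<comment> \<open>Off the axis \<open>v\<close> is continuous also at frontier points, so its
        sign on the tube carries over to nearby points of the region.\<close>
      have "isCont v \<xi>"
      proof -
        have "open {z. fst z \<noteq> (0::'a)}" by (intro open_Collect_neq continuous_intros)
        moreover have "continuous_on {z. fst z \<noteq> (0::'a)} v" using vc' by (simp add: heat_classical_def)
        moreover have "\<xi> \<in> {z. fst z \<noteq> (0::'a)}" using \<open>x \<noteq> 0\<close> by (simp add: xT)
        ultimately show ?thesis using continuous_on_eq_continuous_at by blast
      qed
      then have "(v \<longlongrightarrow> v \<xi>) (at \<xi> within ?\<Phi>)"
        using continuous_at_imp_continuous_within continuous_within by blast
      then have "\<forall>\<^sub>F w in at \<xi> within ?\<Phi>. v w < f \<xi> + e'"
        by (rule order_tendstoD) (use v0 f_nonneg[of \<xi>] e' in linarith)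
      then show ?thesis by eventually_elim simp
    qed
    have "ereal (v z) \<le> u z"
    proof (rule superparabolic_ge_classical[OF opn bounded_Phi _ vc _ z])
      show "superparabolic 2 ?\<Phi> u" using u by (simp add: upper_class_def)
      fix \<xi> e' assume \<xi>: "\<xi> \<in> frontier ?\<Phi>" "snd \<xi> < - \<tau>0" and e': "e' > (0::real)"
      have "ereal (f \<xi> - e' / 2) < Liminf (at \<xi> within ?\<Phi>) u"
        by (rule less_le_trans[of _ "ereal (f \<xi>)"]) (use u \<xi> e' in \<open>auto simp: upper_class_def\<close>)
      then have "\<forall>\<^sub>F w in at \<xi> within ?\<Phi>. ereal (f \<xi> - e' / 2) < u w" by (rule less_LiminfD)
      moreover have "\<forall>\<^sub>F w in at \<xi> within ?\<Phi>. v w \<le> f \<xi> + e' / 2" using e' by (intro key \<xi>) auto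
      ultimately show "\<forall>\<^sub>F w in at \<xi> within ?\<Phi>. ereal (v w - e') \<le> u w"
      proof eventually_elim
        case (elim w)
        then have "ereal (v w - e') \<le> ereal (f \<xi> - e' / 2)" by auto
        then show ?case by (rule order_trans) (use elim in \<open>simp add: less_imp_le\<close>)
      qed
    qed
    then show ?thesis by (simp add: v_def)
  qed
  obtain T1 e where T1: "0 < T1" "T1 \<le> 1" "norm (e::'a) = 1"
    "\<And>T. 0 < T \<Longrightarrow> T \<le> T1 \<Longrightarrow> (sqrt T *\<^sub>R e, - T) \<in> ?\<Phi>"
    using parabola_in_Phi by blast
  have half: "ereal (1 / 2) \<le> upper_perron 2 ?\<Phi> f (sqrt T *\<^sub>R e, - T)" if T: "0 < T" "T \<le> T1" "T \<le> \<tau>1" for T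
    unfolding upper_perron_def
  proof (rule INF_greatest)
    fix u assume u: "u \<in> upper_class 2 ?\<Phi> f"
    let ?x = "sqrt T *\<^sub>R e"
    \<comment> \<open>The cut-off \<open>T / 2\<close> depends on the point: comparison before time
      \<open>- T / 2\<close> includes the level \<open>- T\<close>, and neither the mass bound nor
      the tube bound deteriorates as the cut-off tends to 0.\<close>
    have h: "0 < T / 2" "T / 2 \<le> \<tau>1" using T by auto
    have one: "(0::real) < 1" by simp
    have x: "?x \<noteq> 0" "(norm ?x)\<^sup>2 = T" using T T1(3) by auto
    note hyp = D_cont[OF one h(1)] D_nonneg[OF one h(1)] h dim3
    have "W (T / 2) \<tau>1 1 (?x, - T) \<le> heat_const n * mass (T / 2) \<tau>1 1"
      using heat_potential_le_diag[OF hyp x] by (simp add: W_def mass_def m_def flip: n_def)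
    also have "\<dots> \<le> heat_const n * e0"
      using massle[OF h] heat_const_pos[of n] by (intro mult_left_mono) auto
    finally have "A * W (T / 2) \<tau>1 1 (?x, - T) \<le> 1 / 2"
      using A mult_left_mono[of _ "heat_const n * e0" A] e0(2) by simp
    then have "ereal (1 / 2) \<le> ereal (1 - A * W (T / 2) \<tau>1 1 (?x, - T))" by simp
    also have "\<dots> \<le> u (?x, - T)" using T by (intro low[OF u h] T1(4)) auto
    finally show "ereal (1 / 2) \<le> u (?x, - T)" .
  qed
  have "continuous_on (frontier ?\<Phi>) f" unfolding f_def using d by (intro continuous_intros) auto
  then have "(upper_perron 2 ?\<Phi> f \<longlongrightarrow> ereal (f (0, 0))) ?F" using reg by (simp add: regular_point_def)
  from filterlim_compose[OF this parabola_tendsto[OF T1(4,1)]]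
  have "((\<lambda>T. upper_perron 2 ?\<Phi> f (sqrt T *\<^sub>R e, - T)) \<longlongrightarrow> ereal (f (0, 0))) (at_right 0)" by simp
  moreover have "ereal (f (0, 0)) < ereal (1 / 2)" by (simp add: f_def zero_prod_def[symmetric])
  ultimately have "\<forall>\<^sub>F T in at_right 0. upper_perron 2 ?\<Phi> f (sqrt T *\<^sub>R e, - T) < ereal (1 / 2)"
    by (rule order_tendstoD)
  then obtain b where b: "b > 0" "\<And>T. 0 < T \<Longrightarrow> T < b \<Longrightarrow> upper_perron 2 ?\<Phi> f (sqrt T *\<^sub>R e, - T) < ereal (1 / 2)"
    by (auto simp: eventually_at_right_field)
  define T where "T = min (b / 2) (min T1 \<tau>1)"
  have "0 < T" "T < b" "T \<le> T1" "T \<le> \<tau>1" using b T1 \<tau>1 by (auto simp: T_def)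
  then show False using half[of T] b(2)[of T] by simp
qed

end

theorem proposition5p2:
  fixes \<rho> :: "real \<Rightarrow> real"
  assumes "CARD('n::finite) \<ge> 3"
    and "\<And>\<tau>. \<tau> \<in> {0<..1} \<Longrightarrow> \<rho> \<tau> > 0"
    and "mono_on {0<..1} \<rho>"
    and "(\<rho> \<longlongrightarrow> 0) (at_right 0)"
    and "open (Phi \<rho> :: ((real ^ 'n) \<times> real) set)"
  shows "regular_point 2 (Phi \<rho> :: ((real ^ 'n) \<times> real) set) (0, 0) \<longleftrightarrow>
    (\<integral>\<^sup>+ \<tau>\<in>{0<..1}. ennreal (\<rho> \<tau> ^ (CARD('n) - 2) / \<tau>) \<partial>lborel) = \<infinity>"
proof -
  interpret tube \<rho> "CARD('n)" "TYPE(real ^ 'n)"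
    using assms by unfold_locales auto
  show ?thesis
    unfolding k_integral_eq using divergent_imp_regular convergent_imp_irregular by blast
qed

end
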